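(* Every normalized basic sequence in $Z_3$ admits a subsequence equivalent to the canonical basis of one of the spaces $\ell_2$, $\ell_f$, $\ell_g$.
   Context: All spaces are complex. For the couple $(X_0,X_1)=(\ell_\infty,\ell_1)$ put $\Sigma=\ell_\infty+\ell_1$. The Calderón space $\mathcal C$ of the couple is the Banach space of bounded continuous functions $F:\{z\in\mathbb C:0\le \mathrm{Re}\,z\le 1\}\to\Sigma$, analytic on the open strip, such that for $j=0,1$ the map $t\mapsto F(j+it)$ is continuous from $\mathbb R$ into $X_j$ and tends to $0$ as $|t|\to\infty$, with norm $\|F\|=\max_{j=0,1}\sup_{t}\|F(j+it)\|_{X_j}$. For $k=0,1,2$ let $\Delta_k:\mathcal C\to\Sigma$, $\Delta_k(F)=F^{(k)}(1/2)/k!$. Put $Z_3=\{(\Delta_2F,\Delta_1F,\Delta_0F):F\in\mathcal C\}$ with the quotient norm $\|x\|=\inf\{\|F\|:F\in\mathcal C,\ (\Delta_2F,\Delta_1F,\Delta_0F)=x\}$. $\ell_f$ and $\ell_g$ are the Orlicz sequence spaces of the Orlicz functions which near $0$ are $f(t)=t^2\log^2t$ and $g(t)=t^2\log^4t$; that is, $\ell_f=\{x\in\ell_2:x\log|x|\in\ell_2\}$ and $\ell_g=\{x\in\ell_2:x\log^2|x|\in\ell_2\}$. *)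

theory Defs
  imports "HOL-Analysis.Analysis" "HOL-Library.Function_Algebras"
begin

text \<open>
  The library has no class of complex normed spaces, so a complex normed space is a record: a set of
  points in an ambient group, the complex scalar multiplication of that group, and the norm.
  Nothing outside \<open>points\<close> is meaningful.
\<close>

record 'a cnspace =
  points :: "'a set"
  smul :: "complex \<Rightarrow> 'a \<Rightarrow> 'a"
  nrm :: "'a \<Rightarrow> real"

type_synonym cseq = "nat \<Rightarrow> complex"

definition seq_smul :: "complex \<Rightarrow> cseq \<Rightarrow> cseq" where
  "seq_smul c x = (\<lambda>n. c * x n)"


subsection \<open>Series, basic sequences, equivalence\<close>

definition series_sums :: "'a::ab_group_add cnspace \<Rightarrow> (nat \<Rightarrow> complex) \<Rightarrow> (nat \<Rightarrow> 'a) \<Rightarrow> 'a \<Rightarrow> bool" where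
  "series_sums X a x v \<longleftrightarrow>
     v \<in> points X \<and> (\<lambda>N. nrm X ((\<Sum>n<N. smul X (a n) (x n)) - v)) \<longlonglongrightarrow> 0"

definition closed_span :: "'a::ab_group_add cnspace \<Rightarrow> 'a set \<Rightarrow> 'a set" where
  "closed_span X S =
     {v \<in> points X. \<forall>\<epsilon>>0. \<exists>u \<in> module.span (smul X) S. nrm X (v - u) < \<epsilon>}"

text \<open>A basic sequence is a Schauder basis of its closed linear span.\<close>

definition basic_sequence :: "'a::ab_group_add cnspace \<Rightarrow> (nat \<Rightarrow> 'a) \<Rightarrow> bool" where
  "basic_sequence X x \<longleftrightarrow>
     range x \<subseteq> points X \<and> (\<forall>v \<in> closed_span X (range x). \<exists>!a. series_sums X a x v)"

definition normalized :: "'a cnspace \<Rightarrow> (nat \<Rightarrow> 'a) \<Rightarrow> bool" where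
  "normalized X x \<longleftrightarrow> (\<forall>n. nrm X (x n) = 1)"

definition equivalent_sequences ::
  "'a::ab_group_add cnspace \<Rightarrow> (nat \<Rightarrow> 'a) \<Rightarrow> 'b::ab_group_add cnspace \<Rightarrow> (nat \<Rightarrow> 'b) \<Rightarrow> bool" where
  "equivalent_sequences X x Y y \<longleftrightarrow>
     (\<forall>a. (\<exists>v. series_sums X a x v) \<longleftrightarrow> (\<exists>w. series_sums Y a y w))"


subsection \<open>Sequence spaces\<close>

definition linf :: "cseq cnspace" where
  "linf = \<lparr>points = {x. bounded (range x)}, smul = seq_smul, nrm = (\<lambda>x. SUP n. cmod (x n))\<rparr>"

definition l1 :: "cseq cnspace" where
  "l1 = \<lparr>points = {x. summable (\<lambda>n. cmod (x n))}, smul = seq_smul, nrm = (\<lambda>x. \<Sum>n. cmod (x n))\<rparr>"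

definition l2 :: "cseq cnspace" where
  "l2 = \<lparr>points = {x. summable (\<lambda>n. (cmod (x n))\<^sup>2)}, smul = seq_smul,
         nrm = (\<lambda>x. sqrt (\<Sum>n. (cmod (x n))\<^sup>2))\<rparr>"

definition orlicz_function :: "(real \<Rightarrow> real) \<Rightarrow> bool" where
  "orlicz_function f \<longleftrightarrow>
     f 0 = 0 \<and> convex_on {0..} f \<and> mono_on {0..} f \<and> continuous_on {0..} f \<and>
     filterlim f at_top at_top"

text \<open>The Orlicz sequence space of \<open>f\<close> with its Luxemburg norm.\<close>

definition orlicz_space :: "(real \<Rightarrow> real) \<Rightarrow> cseq cnspace" where
  "orlicz_space f =
     \<lparr>points = {x. \<exists>\<rho>>0. summable (\<lambda>n. f (cmod (x n) / \<rho>))}, smul = seq_smul,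
      nrm = (\<lambda>x. Inf {\<rho>. \<rho> > 0 \<and> summable (\<lambda>n. f (cmod (x n) / \<rho>)) \<and>
                         (\<Sum>n. f (cmod (x n) / \<rho>)) \<le> 1})\<rparr>"

definition unit_seq :: "nat \<Rightarrow> cseq" where
  "unit_seq n = (\<lambda>k. if k = n then 1 else 0)"


subsection \<open>The Calderon space of a couple\<close>

definition sum_space :: "'a::ab_group_add cnspace \<Rightarrow> 'a cnspace \<Rightarrow> 'a cnspace" where
  "sum_space X0 X1 =
     \<lparr>points = {a + b | a b. a \<in> points X0 \<and> b \<in> points X1}, smul = smul X0,
      nrm = (\<lambda>x. Inf {nrm X0 a + nrm X1 b | a b. a \<in> points X0 \<and> b \<in> points X1 \<and> x = a + b})\<rparr>"

definition has_cderiv :: "'a::ab_group_add cnspace \<Rightarrow> (complex \<Rightarrow> 'a) \<Rightarrow> 'a \<Rightarrow> complex \<Rightarrow> bool" where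
  "has_cderiv X F L z \<longleftrightarrow>
     L \<in> points X \<and> ((\<lambda>w. nrm X (smul X (1 / (w - z)) (F w - F z) - L)) \<longlongrightarrow> 0) (at z)"

definition cderiv :: "'a::ab_group_add cnspace \<Rightarrow> (complex \<Rightarrow> 'a) \<Rightarrow> complex \<Rightarrow> 'a" where
  "cderiv X F z = (THE L. has_cderiv X F L z)"

definition norm_continuous_on ::
  "'b::topological_space set \<Rightarrow> 'a::ab_group_add cnspace \<Rightarrow> ('b \<Rightarrow> 'a) \<Rightarrow> bool" where
  "norm_continuous_on S X F \<longleftrightarrow>
     F ` S \<subseteq> points X \<and> (\<forall>z\<in>S. ((\<lambda>w. nrm X (F w - F z)) \<longlongrightarrow> 0) (at z within S))"

definition strip :: "complex set" where
  "strip = {z. 0 \<le> Re z \<and> Re z \<le> 1}"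

text \<open>On the reals, \<open>at_infinity\<close> is the filter of \<open>\<bar>t\<bar> \<rightarrow> \<infinity>\<close>.\<close>

definition boundary_condition :: "'a::ab_group_add cnspace \<Rightarrow> (real \<Rightarrow> 'a) \<Rightarrow> bool" where
  "boundary_condition X G \<longleftrightarrow>
     norm_continuous_on UNIV X G \<and> ((\<lambda>t. nrm X (G t)) \<longlongrightarrow> 0) at_infinity"

text \<open>
  Members are total functions on the complex plane; their values off the closed strip are
  unconstrained, and neither the norm nor the maps \<open>Delta\<close> below depend on them.
\<close>

definition calderon :: "'a::ab_group_add cnspace \<Rightarrow> 'a cnspace \<Rightarrow> (complex \<Rightarrow> 'a) set" where
  "calderon X0 X1 =
     {F. norm_continuous_on strip (sum_space X0 X1) F \<and>
         (\<exists>M. \<forall>z\<in>strip. nrm (sum_space X0 X1) (F z) \<le> M) \<and>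
         (\<forall>z. 0 < Re z \<and> Re z < 1 \<longrightarrow> (\<exists>L. has_cderiv (sum_space X0 X1) F L z)) \<and>
         boundary_condition X0 (\<lambda>t. F (Complex 0 t)) \<and>
         boundary_condition X1 (\<lambda>t. F (Complex 1 t))}"

definition calderon_norm :: "'a cnspace \<Rightarrow> 'a cnspace \<Rightarrow> (complex \<Rightarrow> 'a) \<Rightarrow> real" where
  "calderon_norm X0 X1 F =
     max (SUP t. nrm X0 (F (Complex 0 t))) (SUP t. nrm X1 (F (Complex 1 t)))"

definition Delta :: "'a::ab_group_add cnspace \<Rightarrow> nat \<Rightarrow> (complex \<Rightarrow> 'a) \<Rightarrow> 'a" where
  "Delta X k F = smul X (1 / fact k) ((cderiv X ^^ k) F (1/2))"

definition Delta3 :: "(complex \<Rightarrow> cseq) \<Rightarrow> cseq \<times> cseq \<times> cseq" where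
  "Delta3 F = (let \<Sigma> = sum_space linf l1 in (Delta \<Sigma> 2 F, Delta \<Sigma> 1 F, Delta \<Sigma> 0 F))"

definition Z3 :: "(cseq \<times> cseq \<times> cseq) cnspace" where
  "Z3 = \<lparr>points = Delta3 ` calderon linf l1,
         smul = (\<lambda>c (u, v, w). (seq_smul c u, seq_smul c v, seq_smul c w)),
         nrm = (\<lambda>x. Inf {calderon_norm linf l1 F | F. F \<in> calderon linf l1 \<and> Delta3 F = x})\<rparr>"

end

theory Submission
  imports Defs "HOL-Complex_Analysis.Complex_Analysis" "HOL-Real_Asymp.Real_Asymp"
begin

text \<open>
  Coordinatewise multipliers act contractively on the Calderon space, so Z3 decomposes into
  three-dimensional coordinate blocks, and every normalized basic sequence has a subsequence that is
  a summable perturbation of disjoint finitely supported blocks, once its coordinatewise limit is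
  known to vanish. It vanishes because weighted averages converge to it (Banach-Saks), so that it
  lies in the closed span of every tail.

  For disjoint blocks whose first nonvanishing Taylor coefficient has order \<open>m = 2 - j\<close>, a series
  with coefficients \<open>a\<close> converges iff \<open>\<Sum>|a|\<^sup>2 log\<^bsup>2j\<^esup>|a|\<close> is finite. Sufficiency: multiply
  the representing functions by \<open>exp (-s) (1 + s + \<dots> + s\<^sup>j/j!)\<close> with \<open>s\<close> a multiple of
  \<open>z - 1/2\<close>; this does not change the Taylor coefficients up to order 2, and the slope can be tuned
  to \<open>|a|\<close> so that the boundary values are controlled. Necessity: pair with the extremal functions of
  the couple at coefficients proportional to \<open>|a| log\<^sup>j|a|\<close>.
\<close>

section \<open>Scalar functions on the strip\<close>

text \<open>The tangency orders add up exactly: the multiplier is 1 + O((z - 1/2)^(j+1)) and acts on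
  functions vanishing to order 2 - j, so any change starts at order 3, which Z3 does not see. Hence
  leading order m goes with the exponent 2 - m, and m = 0, 1, 2 with l_g, l_f, l2.

  The leading coefficients of the blocks may be small in l2. If they stay away from 0 along a
  subsequence, both estimates apply to it. If they tend to 0, a lift of small norm with the same
  leading coefficient is subtracted, and the vanishing order goes up by one. A block vanishing to
  order 3 is zero, so this stops.

  Two obstacles precede this reduction. A coordinatewise limit is at first only an array of numbers
  and must be shown to come from Z3; the lower estimates themselves yield this. And a basic sequence
  is given by existence and uniqueness of expansions alone, so a uniform bound on partial sums has
  to be derived from completeness before an element of all tail spans can be seen to vanish.\<close>

definition ostrip :: "complex set" where
  "ostrip = {z. 0 < Re z \<and> Re z < 1}"

lemma open_ostrip: "open ostrip"
  unfolding ostrip_def by (intro open_Collect_conj open_halfspace_Re_gt open_halfspace_Re_lt)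

lemma half_ostrip [simp]: "1/2 \<in> ostrip" by (simp add: ostrip_def)

lemma ostrip_strip: "ostrip \<subseteq> strip" by (auto simp: ostrip_def strip_def)

lemma cball_half_strip: "cball (1/2) (1/2) \<subseteq> strip"
proof
  fix z :: complex assume "z \<in> cball (1/2) (1/2)"
  then have "\<bar>Re z - 1/2\<bar> \<le> 1/2"
    using abs_Re_le_cmod[of "z - 1/2"] by (simp add: dist_norm norm_minus_commute)
  then show "z \<in> strip" unfolding strip_def by (auto simp: abs_if split: if_splits)
qed

lemma ball_half_ostrip: "ball (1/2) (1/2) \<subseteq> ostrip"
proof
  fix z :: complex assume "z \<in> ball (1/2) (1/2)"
  then have "\<bar>Re z - 1/2\<bar> < 1/2"
    using abs_Re_le_cmod[of "z - 1/2"] by (simp add: dist_norm norm_minus_commute)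
  then show "z \<in> ostrip" unfolding ostrip_def by (auto simp: abs_if split: if_splits)
qed

text \<open>The factor \<open>exp (\<epsilon> z\<^sup>2)\<close> decays at infinity, which reduces the strip to a rectangle.\<close>

lemma strip_maximum_principle:
  assumes cont: "continuous_on strip \<phi>" and hol: "\<phi> holomorphic_on ostrip"
    and bdd: "\<And>z. z \<in> strip \<Longrightarrow> cmod (\<phi> z) \<le> B"
    and M: "\<And>t. cmod (\<phi> (Complex 0 t)) \<le> M" "\<And>t. cmod (\<phi> (Complex 1 t)) \<le> M"
    and z: "z \<in> strip"
  shows "cmod (\<phi> z) \<le> M"
proof -
  have M0: "M \<ge> 0" using M(1)[of 0] norm_ge_zero order_trans by blast
  have B0: "B \<ge> 0" using bdd[OF z] norm_ge_zero order_trans by blast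
  have main: "cmod (\<phi> z) * exp (\<epsilon> * ((Re z)\<^sup>2 - (Im z)\<^sup>2)) \<le> M * exp \<epsilon>" if e: "\<epsilon> > 0" for \<epsilon>
  proof -
    define \<psi> where "\<psi> w = \<phi> w * exp (of_real \<epsilon> * w\<^sup>2)" for w
    have nexp: "cmod (exp (of_real \<epsilon> * w\<^sup>2)) = exp (\<epsilon> * ((Re w)\<^sup>2 - (Im w)\<^sup>2))" for w
      by (simp add: power2_eq_square)
    have n\<psi>: "cmod (\<psi> w) = cmod (\<phi> w) * exp (\<epsilon> * ((Re w)\<^sup>2 - (Im w)\<^sup>2))" for w
      by (simp add: \<psi>_def norm_mult nexp del: norm_exp_eq_Re)
    have Mexp: "cmod (\<phi> w) * exp (\<epsilon> * ((Re w)\<^sup>2 - (Im w)\<^sup>2)) \<le> M * exp \<epsilon>"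
      if "cmod (\<phi> w) \<le> M" "w \<in> strip" for w
    proof (intro mult_mono)
      have "(Re w)\<^sup>2 \<le> 1" using that by (auto simp: strip_def power_le_one)
      then have "(Re w)\<^sup>2 - (Im w)\<^sup>2 \<le> 1" using zero_le_power2[of "Im w"] by linarith
      then show "exp (\<epsilon> * ((Re w)\<^sup>2 - (Im w)\<^sup>2)) \<le> exp \<epsilon>" using e by simp
    qed (use that M0 in auto)
    \<comment> \<open>On a tall rectangle the vertical sides contribute M, up to the factor exp
      \<epsilon>, and the horizontal sides an arbitrarily small \<eta>.\<close>
    have bound: "cmod (\<psi> z) \<le> max (M * exp \<epsilon>) \<eta>" if eta: "\<eta> > 0" for \<eta>
    proof -
      have "((\<lambda>R. B * exp (\<epsilon> * (1 - R\<^sup>2))) \<longlongrightarrow> 0) at_top" 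
      proof -
        have "filterlim (\<lambda>R::real. 1 - R\<^sup>2) at_bot at_top" by real_asymp
        then have "filterlim (\<lambda>R::real. \<epsilon> * (1 - R\<^sup>2)) at_bot at_top"
          using e by (simp add: filterlim_tendsto_pos_mult_at_bot[OF tendsto_const])
        from filterlim_compose[OF exp_at_bot this] show ?thesis by (rule tendsto_mult_right_zero)
      qed
      then have "eventually (\<lambda>R. B * exp (\<epsilon> * (1 - R\<^sup>2)) < \<eta> \<and> R > \<bar>Im z\<bar>) at_top"
        using eta by (intro eventually_conj eventually_gt_at_top) (auto dest: order_tendstoD)
      from eventually_happens'[OF _ this]
      obtain R where R: "B * exp (\<epsilon> * (1 - R\<^sup>2)) < \<eta>" "R > \<bar>Im z\<bar>"
        by auto
      define S where "S = cbox (Complex 0 (-R)) (Complex 1 R)"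
      have S: "w \<in> S \<longleftrightarrow> 0 \<le> Re w \<and> Re w \<le> 1 \<and> \<bar>Im w\<bar> \<le> R" for w
        by (auto simp: S_def in_cbox_complex_iff)
      have iS: "interior S = box (Complex 0 (-R)) (Complex 1 R)" by (simp add: S_def)
      have Ss: "S \<subseteq> strip" by (auto simp: S strip_def)
      show ?thesis
      proof (rule maximum_modulus_frontier[of \<psi> S])
        have "interior S \<subseteq> ostrip" unfolding iS by (auto simp: in_box_complex_iff ostrip_def)
        then show "\<psi> holomorphic_on interior S"
          unfolding \<psi>_def by (intro holomorphic_intros holomorphic_on_subset[OF hol])
        have "closure S = S" by (simp add: S_def)
        then show "continuous_on (closure S) \<psi>"
          unfolding \<psi>_def using Ss by (auto intro!: continuous_intros continuous_on_subset[OF cont])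
        show "bounded S" by (simp add: S_def)
        show "z \<in> S" using z R by (auto simp: S strip_def)
        fix w assume "w \<in> frontier S"
        then have w: "w \<in> S" "w \<notin> box (Complex 0 (-R)) (Complex 1 R)"
          unfolding frontier_def iS by (auto simp: S_def)
        then have ws: "w \<in> strip" using Ss by auto
        consider "Re w = 0" | "Re w = 1" | "\<bar>Im w\<bar> = R"
          using w by (auto simp: S in_box_complex_iff)
        then show "cmod (\<psi> w) \<le> max (M * exp \<epsilon>) \<eta>"
        proof cases
          case 1
          then have "w = Complex 0 (Im w)" by (simp add: complex_eq_iff)
          then have "cmod (\<phi> w) \<le> M" using M(1) by metis
          then show ?thesis using Mexp[OF _ ws] n\<psi> by (simp add: le_max_iff_disj)
        next
          case 2
          then have "w = Complex 1 (Im w)" by (simp add: complex_eq_iff)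
          then have "cmod (\<phi> w) \<le> M" using M(2) by metis
          then show ?thesis using Mexp[OF _ ws] n\<psi> by (simp add: le_max_iff_disj)
        next
          case 3
          have "(Re w)\<^sup>2 \<le> 1" using ws by (auto simp: strip_def power_le_one)
          then have "(Re w)\<^sup>2 - (Im w)\<^sup>2 \<le> 1 - R\<^sup>2" using 3 by (metis diff_right_mono power2_abs)
          then have "cmod (\<psi> w) \<le> B * exp (\<epsilon> * (1 - R\<^sup>2))"
            unfolding n\<psi> using bdd[OF ws] e B0 by (intro mult_mono) auto
          then show ?thesis using R by simp
        qed
      qed
    qed
    have "cmod (\<psi> z) \<le> M * exp \<epsilon>"
    proof (rule field_le_epsilon)
      fix \<eta> :: real assume "\<eta> > 0"
      moreover have "0 \<le> M * exp \<epsilon>" using M0 by simp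
      ultimately show "cmod (\<psi> z) \<le> M * exp \<epsilon> + \<eta>" using bound[of \<eta>] by linarith
    qed
    then show ?thesis by (simp add: n\<psi>)
  qed
  have l1: "((\<lambda>\<epsilon>. cmod (\<phi> z) * exp (\<epsilon> * ((Re z)\<^sup>2 - (Im z)\<^sup>2))) \<longlongrightarrow> cmod (\<phi> z) * exp (0 * ((Re z)\<^sup>2 - (Im z)\<^sup>2))) (at_right 0)"
    by (intro tendsto_intros)
  have l2: "((\<lambda>\<epsilon>. M * exp \<epsilon>) \<longlongrightarrow> M * exp 0) (at_right (0::real))"
    by (intro tendsto_intros)
  have "cmod (\<phi> z) * exp (0 * ((Re z)\<^sup>2 - (Im z)\<^sup>2)) \<le> M * exp 0"
    by (rule tendsto_le[OF _ l2 l1]) (auto simp: eventually_at_right_less intro!: eventually_at_rightI[of 0 1] main)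
  then show ?thesis by simp
qed

text \<open>Taylor coefficients rather than derivatives: dividing by \<open>fact i\<close> turns the
  Leibniz rule into a Cauchy product.\<close>

definition tc :: "(complex \<Rightarrow> complex) \<Rightarrow> nat \<Rightarrow> complex" where
  "tc \<phi> i = (deriv ^^ i) \<phi> (1/2) / fact i"

lemma tc_add:
  assumes "\<phi> holomorphic_on ostrip" "\<psi> holomorphic_on ostrip"
  shows "tc (\<lambda>z. \<phi> z + \<psi> z) i = tc \<phi> i + tc \<psi> i"
  unfolding tc_def using higher_deriv_add[OF assms open_ostrip half_ostrip] by (simp add: add_divide_distrib)

lemma tc_mult:
  assumes "\<phi> holomorphic_on ostrip" "\<psi> holomorphic_on ostrip"
  shows "tc (\<lambda>z. \<phi> z * \<psi> z) i = (\<Sum>l\<le>i. tc \<phi> l * tc \<psi> (i - l))"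
proof -
  have "tc (\<lambda>z. \<phi> z * \<psi> z) i =
    (\<Sum>l=0..i. of_nat (i choose l) * (deriv ^^ l) \<phi> (1/2) * (deriv ^^ (i - l)) \<psi> (1/2)) / fact i"
    unfolding tc_def higher_deriv_mult[OF assms open_ostrip half_ostrip] ..
  also have "\<dots> = (\<Sum>l\<le>i. tc \<phi> l * tc \<psi> (i - l))"
    unfolding sum_divide_distrib atMost_atLeast0 tc_def
    by (intro sum.cong refl) (auto simp: binomial_fact field_simps)
  finally show ?thesis .
qed

lemma tc_const: "tc (\<lambda>z. c) i = (if i = 0 then c else 0)"
  by (simp add: tc_def higher_deriv_const)

lemma tc_cmult:
  assumes "\<phi> holomorphic_on ostrip"
  shows "tc (\<lambda>z. c * \<phi> z) i = c * tc \<phi> i"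
  using tc_mult[OF holomorphic_on_const[of c] assms, of i]
  by (simp add: tc_const if_distrib[of "\<lambda>x. x * _"] sum.delta cong: if_cong)

lemma tc_sum:
  assumes "finite K" "\<And>k. k \<in> K \<Longrightarrow> \<phi> k holomorphic_on ostrip"
  shows "tc (\<lambda>z. \<Sum>k\<in>K. \<phi> k z) i = (\<Sum>k\<in>K. tc (\<phi> k) i)"
  using assms
proof (induction K)
  case empty
  then show ?case by (simp add: tc_const)
next
  case (insert k K)
  then show ?case by (simp add: tc_add holomorphic_on_sum)
qed

lemma tc_power: "tc (\<lambda>z. (z - 1/2) ^ m) i = (if i = m then 1 else 0)"
proof -
  have "(deriv ^^ i) (\<lambda>z. (z - 1/2) ^ m) (1/2) = (if i = m then fact m else 0 :: complex)"
  proof -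
    have "pochhammer (of_nat (Suc m - i)) i = (fact m :: complex)" if "i = m"
      using that by (simp add: pochhammer_fact)
    then show ?thesis
      by (cases "i < m") (auto simp: higher_deriv_power not_less pochhammer_0_left power_0_left)
  qed
  then show ?thesis by (simp add: tc_def)
qed

lemma tc_exp: "tc (\<lambda>z. exp (c * (z - 1/2))) i = c ^ i / fact i"
proof -
  have "(deriv ^^ i) (\<lambda>z. exp (c * (z - 1/2))) = (\<lambda>z. c ^ i * exp (c * (z - 1/2)))"
  proof (induction i)
    case (Suc i)
    have "((\<lambda>z. c ^ i * exp (c * (z - 1/2))) has_field_derivative c ^ Suc i * exp (c * (z - 1/2))) (at z)" for z
      by (auto intro!: derivative_eq_intros)
    then show ?case using Suc by (auto intro!: ext DERIV_imp_deriv)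
  qed simp
  then show ?thesis by (simp add: tc_def)
qed

text \<open>Cauchy's inequality on the inscribed disc of radius 1/2, whence the factor 2^i. The
  maximum principle supplies M on its circle; the crude bound B leaves no trace in the
  estimate.\<close>

lemma tc_bound:
  assumes cont: "continuous_on strip \<phi>" and hol: "\<phi> holomorphic_on ostrip"
    and bdd: "\<And>z. z \<in> strip \<Longrightarrow> cmod (\<phi> z) \<le> B"
    and M: "\<And>t. cmod (\<phi> (Complex 0 t)) \<le> M" "\<And>t. cmod (\<phi> (Complex 1 t)) \<le> M"
  shows "cmod (tc \<phi> i) \<le> 2 ^ i * M"
proof -
  have "cmod ((deriv ^^ i) \<phi> (1/2)) \<le> fact i * M / (1/2) ^ i"
  proof (rule Cauchy_inequality)
    show "\<phi> holomorphic_on ball (1/2) (1/2)" by (rule holomorphic_on_subset[OF hol ball_half_ostrip])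
    show "continuous_on (cball (1/2) (1/2)) \<phi>" by (rule continuous_on_subset[OF cont cball_half_strip])
    fix x :: complex assume "cmod (1/2 - x) = 1/2"
    then have "x \<in> strip" using cball_half_strip by (auto simp: dist_norm)
    then show "cmod (\<phi> x) \<le> M" using strip_maximum_principle[OF assms] by blast
  qed simp
  then show ?thesis by (simp add: tc_def norm_divide field_simps)
qed

subsection \<open>Multipliers tangent to the constant 1\<close>

text \<open>A fourth power, because a Gaussian in z - 1/2 would alter the Taylor coefficient of
  order 2. Along vertical lines the real part of (z - 1/2)^4 grows like the fourth power of Im z, so
  this still beats every polynomial.\<close>

definition decay :: "complex \<Rightarrow> complex" where
  "decay z = exp (- ((z - 1/2) ^ 4))"

lemma decay_holomorphic [holomorphic_intros]: "decay holomorphic_on S"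
  unfolding decay_def by (intro holomorphic_intros)

text \<open>The factor of degree 4 leaves room for the quadratic growth of the multipliers and for
  one more power that forces vanishing at infinity. With x^2 at most 1/4 the exponent is at most 7/2
  t^2 - t^4 + 2, hence at most 49/16 + 2, which 6 covers.\<close>

lemma decay_bound:
  assumes "z \<in> strip"
  shows "(1 + \<bar>Im z\<bar>) ^ 4 * cmod (decay z) \<le> exp 6"
proof -
  define x t where "x = Re z - 1/2" and "t = Im z"
  have x: "x\<^sup>2 \<le> 1/4"
  proof -
    have "\<bar>x\<bar> \<le> 1/2" using assms by (auto simp: strip_def x_def abs_if)
    then have "\<bar>x\<bar>\<^sup>2 \<le> (1/2)\<^sup>2" by (intro power_mono) auto
    then show ?thesis by (simp add: power_divide)
  qed
  have "Re (w ^ 4) = Re w ^ 4 - 6 * (Re w)\<^sup>2 * (Im w)\<^sup>2 + Im w ^ 4" for w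
    by (simp add: power4_eq_xxxx power2_eq_square algebra_simps)
  from this[of "z - 1/2"] have "Re ((z - 1/2) ^ 4) = x ^ 4 - 6 * x\<^sup>2 * t\<^sup>2 + t ^ 4"
    by (simp add: x_def t_def)
  moreover have "6 * x\<^sup>2 * t\<^sup>2 \<le> 6 * (1/4) * t\<^sup>2" using x by (intro mult_right_mono) auto
  moreover have "0 \<le> x ^ 4" by simp
  ultimately have 1: "- Re ((z - 1/2) ^ 4) \<le> 3/2 * t\<^sup>2 - t ^ 4" by linarith
  have 2: "4 * \<bar>t\<bar> \<le> 2 * t\<^sup>2 + 2"
  proof -
    have "0 \<le> (\<bar>t\<bar> - 1)\<^sup>2" by simp
    then show ?thesis by (simp add: power2_eq_square algebra_simps)
  qed
  have 3: "7/2 * t\<^sup>2 - t ^ 4 \<le> 49/16"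
  proof -
    have "0 \<le> (t\<^sup>2 - 7/4)\<^sup>2" by simp
    then show ?thesis by (simp add: power2_eq_square power4_eq_xxxx algebra_simps)
  qed
  have "(1 + \<bar>t\<bar>) ^ 4 \<le> exp \<bar>t\<bar> ^ 4" by (intro power_mono exp_ge_add_one_self) auto
  then have "(1 + \<bar>t\<bar>) ^ 4 \<le> exp (4 * \<bar>t\<bar>)" by (simp flip: exp_of_nat_mult)
  then have "(1 + \<bar>t\<bar>) ^ 4 * cmod (decay z) \<le> exp (4 * \<bar>t\<bar>) * exp (3/2 * t\<^sup>2 - t ^ 4)"
    unfolding decay_def norm_exp_eq_Re using 1 by (intro mult_mono) auto
  also have "\<dots> = exp (4 * \<bar>t\<bar> + (3/2 * t\<^sup>2 - t ^ 4))" by (rule exp_add[symmetric])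
  also have "\<dots> \<le> exp 6" using 2 3 by simp
  finally show ?thesis by (simp add: t_def)
qed

lemma tc_from_derivatives:
  assumes "\<And>z. (\<phi> has_field_derivative \<phi>' z) (at z)" "\<And>z. (\<phi>' has_field_derivative \<phi>'' z) (at z)"
  shows "tc \<phi> (Suc 0) = \<phi>' (1/2)" "tc \<phi> 2 = \<phi>'' (1/2) / 2"
proof -
  have 1: "deriv \<phi> = \<phi>'" using assms(1) by (auto intro!: ext DERIV_imp_deriv)
  have 2: "deriv \<phi>' = \<phi>''" using assms(2) by (auto intro!: ext DERIV_imp_deriv)
  show "tc \<phi> (Suc 0) = \<phi>' (1/2)" "tc \<phi> 2 = \<phi>'' (1/2) / 2"
    by (simp_all add: tc_def 1 2 numeral_2_eq_2)
qed

lemma tc_decay: "i \<le> 2 \<Longrightarrow> tc decay i = (if i = 0 then 1 else 0)"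
proof -
  have 1: "(decay has_field_derivative - 4 * (z - 1/2) ^ 3 * decay z) (at z)" for z
    unfolding decay_def by (auto intro!: derivative_eq_intros)
  have 2: "((\<lambda>z. - 4 * (z - 1/2) ^ 3 * decay z) has_field_derivative
      (- 12 * (z - 1/2) ^ 2 * decay z + (- 4 * (z - 1/2) ^ 3) * (- 4 * (z - 1/2) ^ 3 * decay z))) (at z)" for z
    by (auto intro!: derivative_eq_intros 1)
  have "tc decay 0 = 1" "tc decay (Suc 0) = 0" "tc decay 2 = 0"
    using tc_from_derivatives[OF 1 2] by (simp_all add: tc_def decay_def)
  moreover assume "i \<le> 2"
  ultimately show ?thesis by (auto simp: numeral_2_eq_2 le_Suc_eq)
qed

text \<open>With s = 2 \<mu> (z - 1/2), the factor exp (-s) has modulus exp \<mu> on the left edge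
  and exp (-\<mu>) on the right one, so the slope trades size between the edges. The partial sum of
  exp s restores tangency to 1 at 1/2; its price is a factor of degree j in \<mu>.\<close>

definition hker :: "nat \<Rightarrow> real \<Rightarrow> complex \<Rightarrow> complex" where
  "hker j \<mu> z = decay z * (exp (- (2 * of_real \<mu>) * (z - 1/2)) * (\<Sum>i\<le>j. (2 * of_real \<mu> * (z - 1/2)) ^ i / fact i))"

lemma hker_holomorphic [holomorphic_intros]: "hker j \<mu> holomorphic_on S"
  unfolding hker_def by (intro holomorphic_intros) auto

lemma tc_hker:
  assumes "j \<le> 2" "i \<le> j"
  shows "tc (hker j \<mu>) i = (if i = 0 then 1 else 0)"
proof -
  define p where "p z = exp (- (2 * of_real \<mu>) * (z - 1/2)) * (\<Sum>i\<le>j. (2 * of_real \<mu> * (z - 1/2)) ^ i / fact i)" for z :: complex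
  have hp: "p holomorphic_on ostrip" unfolding p_def by (intro holomorphic_intros) auto
  have p: "tc p i = (if i = 0 then 1 else 0)" if "i \<le> j" for i
  proof -
    let ?s = "\<lambda>z::complex. 2 * of_real \<mu> * (z - 1/2)"
    have p0: "tc p 0 = 1" by (simp add: tc_def p_def power_0_left if_distrib[of "\<lambda>x. x / _"] sum.delta cong: if_cong)
    consider "j = 0" | "j = 1" | "j = 2" using assms by linarith
    then show ?thesis
    proof cases
      case 1 with p0 that show ?thesis by simp
    next
      case 2
      have p': "p = (\<lambda>z. exp (- (2 * of_real \<mu>) * (z - 1/2)) * (1 + ?s z))" by (rule ext) (simp add: p_def 2)
      have d1: "(p has_field_derivative - (2 * of_real \<mu>) * ?s z * exp (- (2 * of_real \<mu>) * (z - 1/2))) (at z)" for z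
        unfolding p' by (auto intro!: derivative_eq_intros simp: algebra_simps)
      have "tc p (Suc 0) = 0" using DERIV_imp_deriv[OF d1, of "1/2"] by (simp add: tc_def)
      with p0 that 2 show ?thesis by (cases "i = 0") (auto simp: le_Suc_eq)
    next
      case 3
      have p': "p = (\<lambda>z. exp (- (2 * of_real \<mu>) * (z - 1/2)) * (1 + ?s z + (?s z)^2 / 2))"
        by (rule ext) (simp add: p_def 3 numeral_2_eq_2)
      have d1: "(p has_field_derivative - (2 * of_real \<mu>) * ((?s z)^2/2) * exp (- (2 * of_real \<mu>) * (z - 1/2))) (at z)" for z
        unfolding p' by (auto intro!: derivative_eq_intros simp: field_simps power2_eq_square)
      have d2: "((\<lambda>z. - (2 * of_real \<mu>) * ((?s z)^2/2) * exp (- (2 * of_real \<mu>) * (z - 1/2))) has_field_derivative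
          ((2 * of_real \<mu>)^2 * ((?s z)^2/2) - (2 * of_real \<mu>)^2 * ?s z) * exp (- (2 * of_real \<mu>) * (z - 1/2))) (at z)" for z
        by (auto intro!: derivative_eq_intros simp: field_simps power2_eq_square)
      show ?thesis using p0 tc_from_derivatives[OF d1 d2] that 3
        by (auto simp: numeral_2_eq_2 le_Suc_eq)
    qed
  qed
  have "hker j \<mu> = (\<lambda>z. decay z * p z)" by (simp add: hker_def p_def fun_eq_iff)
  then have "tc (hker j \<mu>) i = (\<Sum>l\<le>i. tc decay l * tc p (i - l))"
    using tc_mult[OF decay_holomorphic hp] by simp
  also have "\<dots> = (\<Sum>l\<le>i. if l = 0 then tc p i else 0)"
    using assms by (intro sum.cong refl) (auto simp: tc_decay)
  also have "\<dots> = tc p i" by simp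
  finally show ?thesis using p[OF assms(2)] by simp
qed

text \<open>In the Cauchy product a coefficient of the multiplier of positive order l vanishes when
  l is at most j, and for larger l it meets a coefficient of \<phi> of order below 2 - j.\<close>

lemma tc_hker_mult:
  assumes h: "\<phi> holomorphic_on ostrip" and j: "j \<le> 2" and i: "i \<le> 2"
    and v: "\<And>l. l < 2 - j \<Longrightarrow> tc \<phi> l = 0"
  shows "tc (\<lambda>z. hker j \<mu> z * \<phi> z) i = tc \<phi> i"
proof -
  have "tc (\<lambda>z. hker j \<mu> z * \<phi> z) i = (\<Sum>l\<le>i. tc (hker j \<mu>) l * tc \<phi> (i - l))"
    by (rule tc_mult[OF hker_holomorphic h])
  also have "\<dots> = (\<Sum>l\<le>i. if l = 0 then tc \<phi> i else 0)"
  proof (intro sum.cong refl)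
    fix l assume "l \<in> {..i}"
    show "tc (hker j \<mu>) l * tc \<phi> (i - l) = (if l = 0 then tc \<phi> i else 0)"
    proof (cases "l \<le> j")
      case True then show ?thesis using tc_hker[OF j True] by auto
    next
      case False
      then have "i - l < 2 - j" using i j \<open>l \<in> {..i}\<close> by auto
      then show ?thesis using v False by simp
    qed
  qed
  also have "\<dots> = tc \<phi> i" by simp
  finally show ?thesis .
qed

lemma sum_exp_le_power:
  fixes s :: complex
  assumes "j \<le> 2"
  shows "cmod (\<Sum>i\<le>j. s ^ i / fact i) \<le> (1 + cmod s) ^ j"
proof -
  have "cmod (\<Sum>i\<le>j. s ^ i / fact i) \<le> (\<Sum>i\<le>j. cmod s ^ i / fact i)"
    by (rule order_trans[OF norm_sum]) (simp add: norm_divide norm_power)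
  also have "\<dots> \<le> (1 + cmod s) ^ j"
  proof -
    consider "j = 0" | "j = 1" | "j = 2" using assms by linarith
    then show ?thesis
      by cases (auto simp: numeral_2_eq_2 power2_eq_square algebra_simps)
  qed
  finally show ?thesis .
qed

text \<open>\<open>decay\<close> absorbs the growth of the polynomial factor in Im z, so that the
  bound depends only on Re z and the slope. The 4 covers 2^j.\<close>

lemma hker_bound:
  assumes z: "z \<in> strip" and j: "j \<le> 2"
  shows "cmod (hker j \<mu> z) \<le> 4 * exp 6 * exp (- 2 * \<mu> * (Re z - 1/2)) * (1 + \<bar>\<mu>\<bar>) ^ j"
proof -
  define t where "t = \<bar>Im z\<bar>"
  have "cmod (z - 1/2) \<le> \<bar>Re (z - 1/2)\<bar> + \<bar>Im (z - 1/2)\<bar>" by (rule cmod_le)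
  also have "\<dots> \<le> 1/2 + t" using z by (auto simp: strip_def t_def abs_if)
  finally have s: "cmod (2 * \<mu> * (z - 1/2)) \<le> 2 * \<bar>\<mu>\<bar> * (1/2 + t)"
    by (simp add: norm_mult mult_left_mono)
  also have "\<dots> \<le> 2 * ((1 + \<bar>\<mu>\<bar>) * (1 + t)) - 1" by (simp add: algebra_simps t_def)
  finally have "1 + cmod (2 * \<mu> * (z - 1/2)) \<le> 2 * ((1 + \<bar>\<mu>\<bar>) * (1 + t))" by simp
  then have "(1 + cmod (2 * \<mu> * (z - 1/2))) ^ j \<le> (2 * ((1 + \<bar>\<mu>\<bar>) * (1 + t))) ^ j"
    by (intro power_mono) auto
  also have "\<dots> = 2 ^ j * (1 + \<bar>\<mu>\<bar>) ^ j * (1 + t) ^ j" by (simp add: power_mult_distrib)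
  also have "\<dots> \<le> 2 ^ 2 * (1 + \<bar>\<mu>\<bar>) ^ j * (1 + t) ^ 4"
    using j by (intro mult_mono power_increasing) (auto simp: t_def)
  finally have b: "cmod (\<Sum>i\<le>j. (2 * of_real \<mu> * (z - 1/2)) ^ i / fact i) \<le> 4 * (1 + \<bar>\<mu>\<bar>) ^ j * (1 + t) ^ 4"
    using sum_exp_le_power[OF j, of "2 * \<mu> * (z - 1/2)"] by simp
  have ne: "cmod (exp (- (2 * of_real \<mu>) * (z - 1/2))) = exp (- 2 * \<mu> * (Re z - 1/2))" by simp
  have "cmod (hker j \<mu> z) \<le> cmod (decay z) * (exp (- 2 * \<mu> * (Re z - 1/2)) * (4 * (1 + \<bar>\<mu>\<bar>) ^ j * (1 + t) ^ 4))"
    unfolding hker_def norm_mult ne using b by (intro mult_left_mono) auto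
  also have "\<dots> = ((1 + t) ^ 4 * cmod (decay z)) * (4 * exp (- 2 * \<mu> * (Re z - 1/2)) * (1 + \<bar>\<mu>\<bar>) ^ j)"
    by (simp add: mult_ac)
  also have "\<dots> \<le> exp 6 * (4 * exp (- 2 * \<mu> * (Re z - 1/2)) * (1 + \<bar>\<mu>\<bar>) ^ j)"
    using decay_bound[OF z] by (intro mult_right_mono) (auto simp: t_def)
  finally show ?thesis by (simp add: mult_ac)
qed

section \<open>The Calderon space in coordinates\<close>

text \<open>Norm bounds as predicates: unlike the norms themselves they include membership in the space, so
  that no junk value of a supremum or of a divergent series occurs.\<close>

definition inf_le :: "cseq \<Rightarrow> real \<Rightarrow> bool" where
  "inf_le x r \<longleftrightarrow> (\<forall>k. cmod (x k) \<le> r)"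

definition one_le :: "cseq \<Rightarrow> real \<Rightarrow> bool" where
  "one_le x r \<longleftrightarrow> (\<forall>K. finite K \<longrightarrow> (\<Sum>k\<in>K. cmod (x k)) \<le> r)"

text \<open>The two edges carry different norms; the locale allows each continuity and convergence
  argument to be given once. Domination makes coordinate projections contractive, and closure under
  coordinatewise limits is a Fatou property, used for infinite series.\<close>

locale seq_ball =
  fixes B :: "cseq \<Rightarrow> real \<Rightarrow> bool"
  assumes ball_add: "B x r \<Longrightarrow> B y s \<Longrightarrow> B (x + y) (r + s)"
    and ball_scale: "B x r \<Longrightarrow> B (seq_smul c x) (cmod c * r)"
    and ball_mono: "B x r \<Longrightarrow> r \<le> s \<Longrightarrow> B x s"
    and ball_dominated: "B x r \<Longrightarrow> (\<And>k. cmod (y k) \<le> cmod (x k)) \<Longrightarrow> B y r"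
    and ball_limit: "(\<And>n. B (X n) r) \<Longrightarrow> (\<And>k. (\<lambda>n. X n k) \<longlonglongrightarrow> x k) \<Longrightarrow> B x r"
    and ball_zero: "B 0 0"
    and ball_coord: "B x r \<Longrightarrow> cmod (x k) \<le> r"
begin

lemma ball_nonneg: "B x r \<Longrightarrow> 0 \<le> r"
  using ball_coord[of x r 0] norm_ge_zero order_trans by blast

lemma ball_uminus: "B x r \<Longrightarrow> B (- x) r"
  by (rule ball_dominated) auto

lemma ball_diff: "B x r \<Longrightarrow> B y s \<Longrightarrow> B (x - y) (r + s)"
  using ball_add[OF _ ball_uminus] by simp

lemma ball_sum:
  "finite J \<Longrightarrow> (\<And>j. j \<in> J \<Longrightarrow> B (X j) (r j)) \<Longrightarrow> B (\<Sum>j\<in>J. X j) (\<Sum>j\<in>J. r j)"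
  by (induction J rule: finite_induct) (auto simp: ball_zero ball_add)

end

interpretation inf: seq_ball inf_le
proof
  fix X :: "nat \<Rightarrow> cseq" and x r
  assume "\<And>n. inf_le (X n) r" "\<And>k. (\<lambda>n. X n k) \<longlonglongrightarrow> x k"
  then show "inf_le x r"
    unfolding inf_le_def by (metis LIMSEQ_le_const2 tendsto_norm)
qed (auto simp: inf_le_def seq_smul_def norm_mult mult_left_mono
      intro: norm_triangle_mono order_trans)

interpretation one: seq_ball one_le
proof
  fix x y :: cseq and r s c
  assume x: "one_le x r"
  show "one_le (x + y) (r + s)" if "one_le y s"
    unfolding one_le_def
  proof (intro allI impI)
    fix K :: "nat set" assume "finite K"
    have "(\<Sum>k\<in>K. cmod ((x + y) k)) \<le> (\<Sum>k\<in>K. cmod (x k)) + (\<Sum>k\<in>K. cmod (y k))"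
      by (simp add: norm_triangle_ineq sum_mono flip: sum.distrib)
    also have "\<dots> \<le> r + s" using x that \<open>finite K\<close> by (auto simp: one_le_def intro: add_mono)
    finally show "(\<Sum>k\<in>K. cmod ((x + y) k)) \<le> r + s" .
  qed
  show "one_le (seq_smul c x) (cmod c * r)"
    using x by (auto simp: one_le_def seq_smul_def norm_mult mult_left_mono simp flip: sum_distrib_left)
  show "one_le x s" if "r \<le> s" using x that by (auto simp: one_le_def intro: order_trans)
  show "one_le y r" if "\<And>k. cmod (y k) \<le> cmod (x k)"
    
    unfolding one_le_def
  proof (intro allI impI)
    fix K :: "nat set" assume "finite K"
    have "(\<Sum>k\<in>K. cmod (y k)) \<le> (\<Sum>k\<in>K. cmod (x k))" by (intro sum_mono that)
    also have "\<dots> \<le> r" using x \<open>finite K\<close> by (simp add: one_le_def)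
    finally show "(\<Sum>k\<in>K. cmod (y k)) \<le> r" .
  qed
  show "cmod (x k) \<le> r" for k
    using x[unfolded one_le_def, rule_format, of "{k}"] by simp
next
  fix X :: "nat \<Rightarrow> cseq" and x r
  assume a: "\<And>n. one_le (X n) r" "\<And>k. (\<lambda>n. X n k) \<longlonglongrightarrow> x k"
  show "one_le x r"
    unfolding one_le_def
  proof (intro allI impI)
    fix K :: "nat set" assume "finite K"
    have "(\<lambda>n. \<Sum>k\<in>K. cmod (X n k)) \<longlonglongrightarrow> (\<Sum>k\<in>K. cmod (x k))"
      by (intro tendsto_sum tendsto_norm a)
    then show "(\<Sum>k\<in>K. cmod (x k)) \<le> r"
      by (rule LIMSEQ_le_const2) (use a \<open>finite K\<close> in \<open>auto simp: one_le_def\<close>)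
  qed
qed (auto simp: one_le_def)

lemma one_le_imp_inf_le: "one_le x r \<Longrightarrow> inf_le x r"
  using one.ball_coord by (auto simp: inf_le_def)

definition bcont :: "(cseq \<Rightarrow> real \<Rightarrow> bool) \<Rightarrow> 'b::metric_space set \<Rightarrow> ('b \<Rightarrow> cseq) \<Rightarrow> bool" where
  "bcont B S F \<longleftrightarrow> (\<forall>z\<in>S. \<exists>r. B (F z) r) \<and>
     (\<forall>z\<in>S. \<forall>\<epsilon>>0. \<exists>\<delta>>0. \<forall>w\<in>S. dist w z < \<delta> \<longrightarrow> B (F w - F z) \<epsilon>)"

definition bvan :: "(cseq \<Rightarrow> real \<Rightarrow> bool) \<Rightarrow> (real \<Rightarrow> cseq) \<Rightarrow> bool" where
  "bvan B G \<longleftrightarrow> (\<forall>\<epsilon>>0. \<exists>R. \<forall>t. \<bar>t\<bar> > R \<longrightarrow> B (G t) \<epsilon>)"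

text \<open>On \<open>points X\<close> the norm is itself an admissible bound, so
  \<open>nrm X x \<le> r\<close> and \<open>B x r\<close> agree there. Elsewhere \<open>nrm\<close>
  carries no meaning, and \<open>B\<close> is false.\<close>

definition gauges :: "cseq cnspace \<Rightarrow> (cseq \<Rightarrow> real \<Rightarrow> bool) \<Rightarrow> bool" where
  "gauges X B \<longleftrightarrow> (\<forall>x. x \<in> points X \<longleftrightarrow> (\<exists>r. B x r)) \<and> (\<forall>x r. B x r \<longrightarrow> nrm X x \<le> r) \<and>
     (\<forall>x. x \<in> points X \<longrightarrow> B x (nrm X x))"

lemma gauges_linf: "gauges linf inf_le"
proof -
  have 1: "(\<exists>r. inf_le x r) \<longleftrightarrow> bounded (range x)" for x
    by (auto simp: inf_le_def bounded_iff)
  have 2: "(SUP n. cmod (x n)) \<le> r" if "inf_le x r" for x r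
    using that by (intro cSUP_least) (auto simp: inf_le_def)
  have 3: "inf_le x (SUP n. cmod (x n))" if "bounded (range x)" for x
    unfolding inf_le_def
  proof
    fix k
    have "bdd_above (range (\<lambda>n. cmod (x n)))"
      using that by (auto simp: bounded_iff bdd_above_def)
    then show "cmod (x k) \<le> (SUP n. cmod (x n))" by (intro cSUP_upper) auto
  qed
  show ?thesis unfolding gauges_def linf_def using 1 2 3 by simp
qed

lemma gauges_l1: "gauges l1 one_le"
proof -
  have 1: "one_le x (\<Sum>n. cmod (x n))" if "summable (\<lambda>n. cmod (x n))" for x
    using that by (auto simp: one_le_def intro: sum_le_suminf)
  have 2: "summable (\<lambda>n. cmod (x n)) \<and> (\<Sum>n. cmod (x n)) \<le> r" if "one_le x r" for x r
  proof -
    have le: "(\<Sum>n<N. cmod (x n)) \<le> r" for N using that by (auto simp: one_le_def)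
    then have "summable (\<lambda>n. cmod (x n))" by (intro summableI_nonneg_bounded) auto
    then show ?thesis using le by (auto intro: suminf_le_const)
  qed
  show ?thesis unfolding gauges_def l1_def using 1 2 by auto
qed

abbreviation "ambient \<equiv> sum_space linf l1"

text \<open>The space l1 lies contractively in linf, so the sum space is linf with the sup norm: any
  splitting bounds the coordinates, and x = x + 0 attains the bound.\<close>

lemma gauges_ambient: "gauges ambient inf_le"
proof -
  have inf: "\<And>x. x \<in> points linf \<longleftrightarrow> (\<exists>r. inf_le x r)" "\<And>x r. inf_le x r \<Longrightarrow> nrm linf x \<le> r"
    "\<And>x. x \<in> points linf \<Longrightarrow> inf_le x (nrm linf x)"
    using gauges_linf by (auto simp: gauges_def)
  have one: "\<And>x. x \<in> points l1 \<longleftrightarrow> (\<exists>r. one_le x r)" "\<And>x r. one_le x r \<Longrightarrow> nrm l1 x \<le> r"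
    "\<And>x. x \<in> points l1 \<Longrightarrow> one_le x (nrm l1 x)"
    using gauges_l1 by (auto simp: gauges_def)
  have z: "0 \<in> points l1" "nrm l1 0 \<le> 0" using one one.ball_zero by blast+
  have pts: "points ambient = points linf"
  proof (intro set_eqI iffI)
    fix x assume "x \<in> points ambient"
    then have "\<exists>a b. x = a + b \<and> a \<in> points linf \<and> b \<in> points l1"
      by (simp only: sum_space_def cnspace.simps mem_Collect_eq)
    then obtain a b where ab: "a \<in> points linf" "b \<in> points l1" "x = a + b"
      by (elim exE conjE)
    obtain r where "inf_le a r" using inf(1) ab(1) by blast
    moreover obtain s where "one_le b s" using one(1) ab(2) by blast
    ultimately have "inf_le x (r + s)" unfolding ab(3) using inf.ball_add one_le_imp_inf_le by blast
    then show "x \<in> points linf" using inf(1) by blast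
  next
    fix x assume "x \<in> points linf"
    then have "x = x + 0 \<and> x \<in> points linf \<and> 0 \<in> points l1" using z(1) by simp
    then have "\<exists>a b. x = a + b \<and> a \<in> points linf \<and> b \<in> points l1" by (intro exI)
    then show "x \<in> points ambient" by (simp only: sum_space_def cnspace.simps mem_Collect_eq)
  qed
  let ?A = "\<lambda>x. {nrm linf a + nrm l1 b | a b. a \<in> points linf \<and> b \<in> points l1 \<and> x = a + b}"
  have nrm: "nrm ambient x = Inf (?A x)" for x by (simp add: sum_space_def)
  have le: "inf_le x r" if "r \<in> ?A x" for x r
  proof -
    obtain a b where ab: "r = nrm linf a + nrm l1 b" "a \<in> points linf" "b \<in> points l1" "x = a + b"
      using \<open>r \<in> ?A x\<close> by blast
    show ?thesis unfolding ab(1,4)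
      by (rule inf.ball_add[OF inf(3)[OF ab(2)] one_le_imp_inf_le[OF one(3)[OF ab(3)]]])
  qed
  have mem: "nrm linf x + nrm l1 0 \<in> ?A x" if "x \<in> points linf" for x
    unfolding mem_Collect_eq by (rule exI[of _ x], rule exI[of _ 0]) (use that z(1) in simp)
  have bdd: "bdd_below (?A x)" for x
    using le inf.ball_nonneg by (intro bdd_belowI[of _ 0]) blast
  have "nrm ambient x \<le> r" if "inf_le x r" for x r
  proof -
    have x: "x \<in> points linf" using that inf(1) by blast
    have "nrm ambient x \<le> nrm linf x + nrm l1 0"
      unfolding nrm by (rule cInf_lower[OF mem[OF x] bdd])
    then show ?thesis using z(2) inf(2)[OF that] by linarith
  qed
  moreover have "inf_le x (nrm ambient x)" if x: "x \<in> points linf" for x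
    unfolding inf_le_def nrm
  proof
    fix k show "cmod (x k) \<le> Inf (?A x)"
    proof (rule cInf_greatest)
      show "?A x \<noteq> {}" using mem[OF x] by blast
      fix r assume "r \<in> ?A x"
      then show "cmod (x k) \<le> r" using inf.ball_coord[OF le] by blast
    qed
  qed
  ultimately show ?thesis unfolding gauges_def pts using inf(1) by simp
qed

section \<open>Continuity and boundary conditions in terms of norm bounds\<close>

lemma (in seq_ball) norm_continuous_on_iff:
  assumes g: "gauges X B"
  shows "norm_continuous_on S X F \<longleftrightarrow> bcont B S F"
proof -
  have g: "\<And>x. x \<in> points X \<longleftrightarrow> (\<exists>r. B x r)" "\<And>x r. B x r \<Longrightarrow> nrm X x \<le> r"
    "\<And>x. x \<in> points X \<Longrightarrow> B x (nrm X x)"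
    using g by (auto simp: gauges_def)
  have d: "F w - F z \<in> points X" if FS: "F ` S \<subseteq> points X" "w \<in> S" "z \<in> S" for w z
  proof -
    obtain r s where "B (F w) r" "B (F z) s" using FS g(1) by blast
    then show ?thesis using ball_diff g(1) by blast
  qed
  have lim: "((\<lambda>w. nrm X (F w - F z)) \<longlongrightarrow> 0) (at z within S) \<longleftrightarrow>
      (\<forall>\<epsilon>>0. \<exists>\<delta>>0. \<forall>w\<in>S. dist w z < \<delta> \<longrightarrow> B (F w - F z) \<epsilon>)" if F: "F ` S \<subseteq> points X" and z: "z \<in> S" for z
  proof
    assume L: "((\<lambda>w. nrm X (F w - F z)) \<longlongrightarrow> 0) (at z within S)"
    show "\<forall>\<epsilon>>0. \<exists>\<delta>>0. \<forall>w\<in>S. dist w z < \<delta> \<longrightarrow> B (F w - F z) \<epsilon>"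
    proof (intro allI impI)
      fix \<epsilon> :: real assume e: "\<epsilon> > 0"
      then obtain \<delta> where "\<delta> > 0" and \<delta>: "\<And>w. w \<in> S \<Longrightarrow> 0 < dist w z \<Longrightarrow> dist w z < \<delta> \<Longrightarrow> dist (nrm X (F w - F z)) 0 < \<epsilon>"
        using L[unfolded Lim_within, rule_format, OF e] by blast
      have "B (F w - F z) \<epsilon>" if w: "w \<in> S" "dist w z < \<delta>" for w
      proof (cases "w = z")
        case True
        then show ?thesis using ball_mono[OF ball_zero, of \<epsilon>] e by simp
      next
        case False
        then have "nrm X (F w - F z) \<le> \<epsilon>" using \<delta>[OF w(1) _ w(2)] by simp
        then show ?thesis by (rule ball_mono[OF g(3)[OF d[OF F w(1) z]]])
      qed
      then show "\<exists>\<delta>>0. \<forall>w\<in>S. dist w z < \<delta> \<longrightarrow> B (F w - F z) \<epsilon>" using \<open>\<delta> > 0\<close> by blast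
    qed
  next
    assume R: "\<forall>\<epsilon>>0. \<exists>\<delta>>0. \<forall>w\<in>S. dist w z < \<delta> \<longrightarrow> B (F w - F z) \<epsilon>"
    show "((\<lambda>w. nrm X (F w - F z)) \<longlongrightarrow> 0) (at z within S)"
      unfolding Lim_within
    proof (intro allI impI)
      fix \<epsilon> :: real assume e: "\<epsilon> > 0"
      then have "\<epsilon>/2 > 0" by simp
      then obtain \<delta> where \<delta>: "\<delta> > 0" "\<forall>w\<in>S. dist w z < \<delta> \<longrightarrow> B (F w - F z) (\<epsilon>/2)"
        using R by blast
      have "dist (nrm X (F w - F z)) 0 < \<epsilon>" if w: "w \<in> S" "dist w z < \<delta>" for w
      proof -
        have b: "B (F w - F z) (\<epsilon>/2)" using \<delta> w by blast
        have "0 \<le> nrm X (F w - F z)" using ball_nonneg[OF g(3)[OF d[OF F w(1) z]]] .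
        then show ?thesis using g(2)[OF b] e by simp
      qed
      then show "\<exists>d>0. \<forall>x\<in>S. 0 < dist x z \<and> dist x z < d \<longrightarrow> dist (nrm X (F x - F z)) 0 < \<epsilon>"
        using \<delta>(1) by blast
    qed
  qed
  have pts: "F ` S \<subseteq> points X \<longleftrightarrow> (\<forall>z\<in>S. \<exists>r. B (F z) r)" using g(1) by blast
  show ?thesis unfolding norm_continuous_on_def bcont_def
    using pts lim by (intro conj_cong ball_cong refl) simp_all
qed

lemma (in seq_ball) boundary_condition_iff:
  assumes g: "gauges X B"
  shows "boundary_condition X G \<longleftrightarrow> bcont B UNIV G \<and> bvan B G"
proof -
  have g': "\<And>x. x \<in> points X \<longleftrightarrow> (\<exists>r. B x r)" "\<And>x r. B x r \<Longrightarrow> nrm X x \<le> r"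
    "\<And>x. x \<in> points X \<Longrightarrow> B x (nrm X x)"
    using g by (auto simp: gauges_def)
  have "((\<lambda>t. nrm X (G t)) \<longlongrightarrow> 0) at_infinity \<longleftrightarrow> bvan B G" if G: "bcont B UNIV G"
  proof -
    have pt: "G t \<in> points X" for t using G g'(1) by (auto simp: bcont_def)
    have nn: "0 \<le> nrm X (G t)" for t using ball_nonneg g'(3)[OF pt] by blast
    have eq: "nrm X (G t) \<le> \<epsilon> \<longleftrightarrow> B (G t) \<epsilon>" for t \<epsilon> using g'(2) g'(3)[OF pt] ball_mono by blast
    have "((\<lambda>t. nrm X (G t)) \<longlongrightarrow> 0) at_infinity \<longleftrightarrow> (\<forall>\<epsilon>>0. \<exists>R. \<forall>t. R \<le> \<bar>t\<bar> \<longrightarrow> nrm X (G t) < \<epsilon>)"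
      unfolding Lim_at_infinity using nn by (simp add: dist_real_def)
    also have "\<dots> \<longleftrightarrow> (\<forall>\<epsilon>>0. \<exists>R. \<forall>t. \<bar>t\<bar> > R \<longrightarrow> nrm X (G t) \<le> \<epsilon>)"
    proof (intro iffI allI impI)
      fix \<epsilon> :: real assume "\<forall>\<epsilon>>0. \<exists>R. \<forall>t. R \<le> \<bar>t\<bar> \<longrightarrow> nrm X (G t) < \<epsilon>" "\<epsilon> > 0"
      then show "\<exists>R. \<forall>t. \<bar>t\<bar> > R \<longrightarrow> nrm X (G t) \<le> \<epsilon>" by (meson less_imp_le)
    next
      fix \<epsilon> :: real assume R: "\<forall>\<epsilon>>0. \<exists>R. \<forall>t. \<bar>t\<bar> > R \<longrightarrow> nrm X (G t) \<le> \<epsilon>" and e: "\<epsilon> > 0"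
      then obtain R where R2: "\<forall>t. \<bar>t\<bar> > R \<longrightarrow> nrm X (G t) \<le> \<epsilon>/2" using half_gt_zero by blast
      then have "nrm X (G t) < \<epsilon>" if "R + 1 \<le> \<bar>t\<bar>" for t
        
      proof -
        have "\<bar>t\<bar> > R" using that by linarith
        then have "nrm X (G t) \<le> \<epsilon>/2" using R2 by blast
        then show ?thesis using e by simp
      qed
      then show "\<exists>R. \<forall>t. R \<le> \<bar>t\<bar> \<longrightarrow> nrm X (G t) < \<epsilon>" by blast
    qed
    finally show ?thesis by (simp add: eq bvan_def)
  qed
  then show ?thesis unfolding boundary_condition_def norm_continuous_on_iff[OF g] by blast
qed

subsection \<open>Complex derivatives are computed coordinatewise\<close>

text \<open>The local bound is common to all coordinates; this is what lets holomorphy in each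
  coordinate imply differentiability in the sup norm.\<close>

definition locally_bounded_on :: "complex set \<Rightarrow> (complex \<Rightarrow> cseq) \<Rightarrow> bool" where
  "locally_bounded_on U G \<longleftrightarrow> (\<forall>z\<in>U. \<exists>\<delta>>0. \<exists>M. ball z \<delta> \<subseteq> U \<and> (\<forall>w\<in>ball z \<delta>. inf_le (G w) M))"

lemma smul_ambient [simp]: "smul ambient = seq_smul"
  by (simp add: sum_space_def linf_def)

lemma has_cderiv_coord:
  assumes "has_cderiv ambient G L z" "locally_bounded_on U G" "z \<in> U"
  shows "((\<lambda>w. G w k) has_field_derivative L k) (at z)"
proof -
  have g: "\<And>x. x \<in> points ambient \<longleftrightarrow> (\<exists>r. inf_le x r)" "\<And>x. x \<in> points ambient \<Longrightarrow> inf_le x (nrm ambient x)"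
    using gauges_ambient by (auto simp: gauges_def)
  obtain \<delta> M where d: "\<delta> > 0" "\<And>w. w \<in> ball z \<delta> \<Longrightarrow> inf_le (G w) M"
    using assms(2,3) unfolding locally_bounded_on_def by meson
  have L: "L \<in> points ambient" and lim: "((\<lambda>w. nrm ambient (seq_smul (1 / (w - z)) (G w - G z) - L)) \<longlongrightarrow> 0) (at z)"
    using assms(1) by (auto simp: has_cderiv_def)
  have "cmod ((G w k - G z k) / (w - z) - L k) \<le> nrm ambient (seq_smul (1 / (w - z)) (G w - G z) - L)"
    if "w \<in> ball z \<delta>" for w
  proof -
    obtain r where "inf_le L r" using L g(1) by blast
    then have "inf_le (seq_smul (1 / (w - z)) (G w - G z) - L) (cmod (1 / (w - z)) * (M + M) + r)"
      using that d by (intro inf.ball_diff inf.ball_scale) auto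
    then have "inf_le (seq_smul (1 / (w - z)) (G w - G z) - L) (nrm ambient (seq_smul (1 / (w - z)) (G w - G z) - L))"
      using g by blast
    then show ?thesis using inf.ball_coord[of _ _ k] by (fastforce simp: seq_smul_def)
  qed
  then have "eventually (\<lambda>w. norm ((G w k - G z k) / (w - z) - L k) \<le>
      nrm ambient (seq_smul (1 / (w - z)) (G w - G z) - L)) (at z)"
    unfolding eventually_at using d(1) by (metis dist_commute mem_ball)
  from Lim_null_comparison[OF this lim]
  have "((\<lambda>w. (G w k - G z k) / (w - z)) \<longlongrightarrow> L k) (at z)" using LIM_zero_iff by blast
  then show ?thesis by (simp add: has_field_derivative_iff)
qed

text \<open>The constants depend only on M and \<delta>, hence serve all coordinates at once. They
  come from Cauchy's inequality on discs of radius \<delta>/4 around points of the half ball, which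
  stay inside the full ball.\<close>

lemma cderiv_estimates:
  assumes bdd: "\<And>w. w \<in> ball z \<delta> \<Longrightarrow> cmod (\<phi> w) \<le> M" and hol: "\<phi> holomorphic_on ball z \<delta>"
    and w: "w \<in> ball z (\<delta>/2)"
  shows "cmod (deriv \<phi> w) \<le> 4 * M / \<delta>"
    and "cmod (\<phi> w - \<phi> z - deriv \<phi> z * (w - z)) \<le> 32 * M / \<delta>\<^sup>2 * (cmod (w - z))\<^sup>2"
proof -
  have d: "\<delta> > 0" using w by (metis dist_not_less_zero half_gt_zero_iff mem_ball order_less_le_trans not_le order.strict_trans1 zero_le_dist)
  have cb: "cball u (\<delta>/4) \<subseteq> ball z \<delta>" if "u \<in> ball z (\<delta>/2)" for u
  proof
    fix v assume "v \<in> cball u (\<delta>/4)"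
    then have "dist z v < \<delta>" using that dist_triangle[of z v u] d by (auto simp: mem_ball mem_cball)
    then show "v \<in> ball z \<delta>" by simp
  qed
  have der: "cmod ((deriv ^^ n) \<phi> u) \<le> fact n * M / (\<delta>/4) ^ n" if u: "u \<in> ball z (\<delta>/2)" for u n
  proof (rule Cauchy_inequality)
    show "\<phi> holomorphic_on ball u (\<delta>/4)"
      using cb[OF u] by (meson ball_subset_cball hol holomorphic_on_subset order_trans)
    show "continuous_on (cball u (\<delta>/4)) \<phi>"
      using cb[OF u] hol holomorphic_on_imp_continuous_on continuous_on_subset by blast
    show "0 < \<delta>/4" using d by simp
    fix x assume "cmod (u - x) = \<delta>/4"
    then have "x \<in> cball u (\<delta>/4)" by (simp add: dist_norm)
    then show "cmod (\<phi> x) \<le> M" using cb[OF u] bdd by blast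
  qed
  show "cmod (deriv \<phi> w) \<le> 4 * M / \<delta>" using der[OF w, of 1] by (simp add: field_simps)
  have "cmod ((deriv ^^ 0) \<phi> w - (\<Sum>i\<le>1. (deriv ^^ i) \<phi> z * (w - z) ^ i / fact i))
      \<le> (2 * M / (\<delta>/4)^2) * cmod (w - z) ^ Suc 1 / fact 1"
  proof (rule complex_Taylor)
    show "convex (ball z (\<delta>/2))" by simp
    show "z \<in> ball z (\<delta>/2)" using d by simp
    fix x i assume x: "x \<in> ball z (\<delta>/2)"
    show "cmod ((deriv ^^ Suc 1) \<phi> x) \<le> 2 * M / (\<delta>/4)^2"
      using der[OF x, of 2] by (simp add: numeral_2_eq_2)
    have "(deriv ^^ i) \<phi> holomorphic_on ball z \<delta>" by (rule holomorphic_higher_deriv[OF hol]) simp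
    then have "((deriv ^^ i) \<phi> has_field_derivative deriv ((deriv ^^ i) \<phi>) x) (at x)"
      using x d by (intro holomorphic_derivI[of _ "ball z \<delta>"]) auto
    then show "((deriv ^^ i) \<phi> has_field_derivative (deriv ^^ Suc i) \<phi> x) (at x within ball z (\<delta>/2))"
      by (simp add: has_field_derivative_at_within)
  qed (use w in auto)
  then show "cmod (\<phi> w - \<phi> z - deriv \<phi> z * (w - z)) \<le> 32 * M / \<delta>\<^sup>2 * (cmod (w - z))\<^sup>2"
    by (simp add: field_simps power2_eq_square)
qed

lemma cderiv_coord:
  assumes lb: "locally_bounded_on U G" and hol: "\<And>k. (\<lambda>w. G w k) holomorphic_on U" and z: "z \<in> U"
  shows "has_cderiv ambient G (\<lambda>k. deriv (\<lambda>w. G w k) z) z"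
    and "cderiv ambient G z = (\<lambda>k. deriv (\<lambda>w. G w k) z)"
proof -
  have g: "\<And>x. x \<in> points ambient \<longleftrightarrow> (\<exists>r. inf_le x r)" "\<And>x. x \<in> points ambient \<Longrightarrow> inf_le x (nrm ambient x)"
    "\<And>x r. inf_le x r \<Longrightarrow> nrm ambient x \<le> r"
    using gauges_ambient by (auto simp: gauges_def)
  obtain \<delta> M where d: "\<delta> > 0" "ball z \<delta> \<subseteq> U" "\<And>w. w \<in> ball z \<delta> \<Longrightarrow> inf_le (G w) M"
    using lb z unfolding locally_bounded_on_def by meson
  have b: "cmod (G w k) \<le> M" if "w \<in> ball z \<delta>" for w k using d(3)[OF that] by (simp add: inf_le_def)
  have h: "(\<lambda>w. G w k) holomorphic_on ball z \<delta>" for k by (rule holomorphic_on_subset[OF hol d(2)])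
  let ?L = "\<lambda>k. deriv (\<lambda>w. G w k) z"
  have "inf_le ?L (4 * M / \<delta>)"
    unfolding inf_le_def using cderiv_estimates(1)[OF b h, of z] d by auto
  then have L: "?L \<in> points ambient" using g(1) by blast
  define f where "f w = seq_smul (1 / (w - z)) (G w - G z) - ?L" for w
  have f: "inf_le (f w) (32 * M / \<delta>\<^sup>2 * cmod (w - z))" if w: "w \<in> ball z (\<delta>/2)" "w \<noteq> z" for w
    unfolding inf_le_def
  proof
    fix k
    have "cmod (f w k) = cmod (G w k - G z k - ?L k * (w - z)) / cmod (w - z)"
      using w by (simp add: f_def seq_smul_def field_simps flip: norm_divide)
    also have "\<dots> \<le> 32 * M / \<delta>\<^sup>2 * (cmod (w - z))\<^sup>2 / cmod (w - z)"
      by (intro divide_right_mono cderiv_estimates(2)[OF b h w(1)]) auto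
    also have "\<dots> = 32 * M / \<delta>\<^sup>2 * cmod (w - z)" using w by (simp add: power2_eq_square)
    finally show "cmod (f w k) \<le> 32 * M / \<delta>\<^sup>2 * cmod (w - z)" .
  qed
  have "norm (nrm ambient (f w)) \<le> 32 * M / \<delta>\<^sup>2 * cmod (w - z)" if w: "w \<in> ball z (\<delta>/2)" "w \<noteq> z" for w
    using g f[OF w] inf.ball_nonneg by (metis abs_of_nonneg real_norm_def)
  then have ev: "eventually (\<lambda>w. norm (nrm ambient (f w)) \<le> 32 * M / \<delta>\<^sup>2 * cmod (w - z)) (at z)"
    unfolding eventually_at using d(1) half_gt_zero by (metis dist_commute mem_ball)
  have "((\<lambda>w. 32 * M / \<delta>\<^sup>2 * cmod (w - z)) \<longlongrightarrow> 32 * M / \<delta>\<^sup>2 * cmod (z - z)) (at z)"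
    by (intro tendsto_intros)
  then have "((\<lambda>w. nrm ambient (f w)) \<longlongrightarrow> 0) (at z)"
    using Lim_null_comparison[OF ev] by simp
  then show hc: "has_cderiv ambient G ?L z" unfolding has_cderiv_def f_def using L by simp
  show "cderiv ambient G z = ?L"
    unfolding cderiv_def
  proof (rule the_equality[where P = "\<lambda>L. has_cderiv ambient G L z", OF hc])
    fix L' assume "has_cderiv ambient G L' z"
    then show "L' = ?L"
      using DERIV_imp_deriv[OF has_cderiv_coord[OF _ lb z]] by (auto intro!: ext)
  qed
qed

text \<open>Local boundedness is carried through the induction because the coordinatewise formula
  for the next derivative rests on it.\<close>

lemma higher_cderiv_coord:
  assumes lb: "locally_bounded_on U G" and hol: "\<And>k. (\<lambda>w. G w k) holomorphic_on U" and U: "open U"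
  shows "locally_bounded_on U ((cderiv ambient ^^ i) G) \<and>
    (\<forall>z\<in>U. \<forall>k. (cderiv ambient ^^ i) G z k = (deriv ^^ i) (\<lambda>w. G w k) z)"
proof (induction i)
  case 0
  then show ?case using lb by simp
next
  case (Suc i)
  let ?G = "(cderiv ambient ^^ i) G"
  have eq: "\<And>z k. z \<in> U \<Longrightarrow> ?G z k = (deriv ^^ i) (\<lambda>w. G w k) z" and lb': "locally_bounded_on U ?G"
    using Suc by auto
  have hol': "(\<lambda>w. ?G w k) holomorphic_on U" for k
    using holomorphic_higher_deriv[OF hol U, of i k] by (rule holomorphic_transform) (simp add: eq)
  have c: "cderiv ambient ?G z = (\<lambda>k. deriv (\<lambda>w. ?G w k) z)" if "z \<in> U" for z
    by (rule cderiv_coord(2)[OF lb' hol' that])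
  have "cderiv ambient ?G z k = deriv ((deriv ^^ i) (\<lambda>w. G w k)) z" if z: "z \<in> U" for z k
  proof -
    have "eventually (\<lambda>w. ?G w k = (deriv ^^ i) (\<lambda>w. G w k) w) (nhds z)"
      using U z eq eventually_nhds by blast
    then show ?thesis unfolding c[OF z] by (rule deriv_cong_ev) simp
  qed
  moreover have "locally_bounded_on U (cderiv ambient ?G)"
    unfolding locally_bounded_on_def
  proof
    fix z assume "z \<in> U"
    then obtain \<delta> M where d: "\<delta> > 0" "ball z \<delta> \<subseteq> U" "\<And>w. w \<in> ball z \<delta> \<Longrightarrow> inf_le (?G w) M"
      using lb' unfolding locally_bounded_on_def by meson
    have sub: "ball z (\<delta>/2) \<subseteq> ball z \<delta>" using d(1) by (intro subset_ball) simp
    have "inf_le (cderiv ambient ?G w) (4 * M / \<delta>)" if w: "w \<in> ball z (\<delta>/2)" for w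
    proof -
      have "w \<in> U" using w sub d by blast
      show ?thesis unfolding c[OF \<open>w \<in> U\<close>] inf_le_def
        using d by (intro allI cderiv_estimates(1)[OF _ _ w] holomorphic_on_subset[OF hol'])
          (auto simp: inf_le_def)
    qed
    then show "\<exists>\<delta>>0. \<exists>M. ball z \<delta> \<subseteq> U \<and> (\<forall>w\<in>ball z \<delta>. inf_le (cderiv ambient ?G w) M)"
      using d sub by (intro exI[of _ "\<delta>/2"] conjI exI[of _ "4 * M / \<delta>"]) auto
  qed
  ultimately show ?case by simp
qed

section \<open>Members of the Calderon space described coordinatewise\<close>

definition cal :: "(complex \<Rightarrow> cseq) \<Rightarrow> bool" where
  "cal F \<longleftrightarrow> bcont inf_le strip F \<and> (\<exists>M. \<forall>z\<in>strip. inf_le (F z) M) \<and>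
     (\<forall>k. (\<lambda>z. F z k) holomorphic_on ostrip) \<and> bvan inf_le (\<lambda>t. F (Complex 0 t)) \<and>
     bcont one_le UNIV (\<lambda>t. F (Complex 1 t)) \<and> bvan one_le (\<lambda>t. F (Complex 1 t))"

lemma bounded_imp_locally_bounded_on_ostrip:
  assumes "\<forall>z\<in>strip. inf_le (F z) M"
  shows "locally_bounded_on ostrip F"
  unfolding locally_bounded_on_def
proof
  fix z assume "z \<in> ostrip"
  then obtain \<delta> where "\<delta> > 0" "ball z \<delta> \<subseteq> ostrip" using open_ostrip open_contains_ball by blast
  then show "\<exists>\<delta>>0. \<exists>M. ball z \<delta> \<subseteq> ostrip \<and> (\<forall>w\<in>ball z \<delta>. inf_le (F w) M)"
    using assms ostrip_strip by blast
qed

lemma calderon_iff_cal: "F \<in> calderon linf l1 \<longleftrightarrow> cal F"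
proof -
  have g: "\<And>x. x \<in> points ambient \<longleftrightarrow> (\<exists>r. inf_le x r)" "\<And>x. x \<in> points ambient \<Longrightarrow> inf_le x (nrm ambient x)"
    "\<And>x r. inf_le x r \<Longrightarrow> nrm ambient x \<le> r"
    using gauges_ambient by (auto simp: gauges_def)
  have bd: "(\<exists>M. \<forall>z\<in>strip. nrm ambient (F z) \<le> M) \<longleftrightarrow> (\<exists>M. \<forall>z\<in>strip. inf_le (F z) M)"
    if "bcont inf_le strip F"
  proof -
    have "nrm ambient (F z) \<le> M \<longleftrightarrow> inf_le (F z) M" if "z \<in> strip" for z M
      using g \<open>bcont inf_le strip F\<close> that inf.ball_mono unfolding bcont_def by blast
    then show ?thesis by blast
  qed
  have hol: "(\<forall>z. 0 < Re z \<and> Re z < 1 \<longrightarrow> (\<exists>L. has_cderiv ambient F L z)) \<longleftrightarrow>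
      (\<forall>k. (\<lambda>z. F z k) holomorphic_on ostrip)" if M: "\<forall>z\<in>strip. inf_le (F z) M" for M
  proof
    assume "\<forall>z. 0 < Re z \<and> Re z < 1 \<longrightarrow> (\<exists>L. has_cderiv ambient F L z)"
    then show "\<forall>k. (\<lambda>z. F z k) holomorphic_on ostrip"
      using has_cderiv_coord[OF _ bounded_imp_locally_bounded_on_ostrip[OF M]]
      unfolding holomorphic_on_open[OF open_ostrip] by (force simp: ostrip_def)
  next
    assume "\<forall>k. (\<lambda>z. F z k) holomorphic_on ostrip"
    then show "\<forall>z. 0 < Re z \<and> Re z < 1 \<longrightarrow> (\<exists>L. has_cderiv ambient F L z)"
      using cderiv_coord(1)[OF bounded_imp_locally_bounded_on_ostrip[OF M]]
      by (auto simp: ostrip_def)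
  qed
  \<comment> \<open>The ambient norm is the norm of the left edge, so continuity on the closed strip
    restricts to it; the right edge has a finer norm of its own.\<close>
  have left: "bcont inf_le UNIV (\<lambda>t. F (Complex 0 t))" if F: "bcont inf_le strip F"
    unfolding bcont_def
  proof (intro conjI ballI allI impI)
    have m: "Complex 0 t \<in> strip" for t by (simp add: strip_def)
    fix t show "\<exists>r. inf_le (F (Complex 0 t)) r" using F m by (auto simp: bcont_def)
    fix \<epsilon> :: real assume "\<epsilon> > 0"
    then obtain \<delta> where d: "\<delta> > 0" "\<And>w. w \<in> strip \<Longrightarrow> dist w (Complex 0 t) < \<delta> \<Longrightarrow> inf_le (F w - F (Complex 0 t)) \<epsilon>"
      using F m unfolding bcont_def by meson
    have "dist (Complex 0 s) (Complex 0 t) = dist s t" for s t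
      by (simp add: dist_norm cmod_def)
    then show "\<exists>\<delta>>0. \<forall>w\<in>UNIV. dist w t < \<delta> \<longrightarrow> inf_le (F (Complex 0 w) - F (Complex 0 t)) \<epsilon>"
      using d m by (metis)
  qed
  show ?thesis
  proof (cases "bcont inf_le strip F \<and> (\<exists>M. \<forall>z\<in>strip. inf_le (F z) M)")
    case True
    then obtain M where F: "bcont inf_le strip F" and M: "\<forall>z\<in>strip. inf_le (F z) M" by blast
    show ?thesis
      unfolding calderon_def cal_def mem_Collect_eq inf.norm_continuous_on_iff[OF gauges_ambient]
        inf.boundary_condition_iff[OF gauges_linf] one.boundary_condition_iff[OF gauges_l1]
        hol[OF M] bd[OF F]
      using left[OF F] by simp
  next
    case False
    then show ?thesis
      unfolding calderon_def cal_def mem_Collect_eq inf.norm_continuous_on_iff[OF gauges_ambient]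
      using bd by (cases "bcont inf_le strip F") (simp_all del: not_all not_ex)
  qed
qed

lemma Delta_cal:
  assumes "cal F"
  shows "Delta ambient i F = (\<lambda>k. tc (\<lambda>z. F z k) i)"
proof -
  obtain M where M: "\<forall>z\<in>strip. inf_le (F z) M" and hol: "\<And>k. (\<lambda>z. F z k) holomorphic_on ostrip"
    using assms by (auto simp: cal_def)
  show ?thesis
    using higher_cderiv_coord[OF bounded_imp_locally_bounded_on_ostrip[OF M] hol open_ostrip, of i]
    by (auto simp: Delta_def tc_def seq_smul_def)
qed

lemma Delta3_cal:
  assumes "cal F"
  shows "Delta3 F = (\<lambda>k. tc (\<lambda>z. F z k) 2, \<lambda>k. tc (\<lambda>z. F z k) 1, \<lambda>k. tc (\<lambda>z. F z k) 0)"
  by (simp add: Delta3_def Let_def Delta_cal[OF assms])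

section \<open>Stability under algebra, restriction and uniform limits\<close>

definition restr :: "nat set \<Rightarrow> cseq \<Rightarrow> cseq" where
  "restr A x = (\<lambda>k. if k \<in> A then x k else 0)"

lemma bcontD:
  assumes "bcont B S F" "z \<in> S" "\<epsilon> > 0"
  obtains \<delta> where "\<delta> > 0" "\<And>w. w \<in> S \<Longrightarrow> dist w z < \<delta> \<Longrightarrow> B (F w - F z) \<epsilon>"
  using assms unfolding bcont_def by blast

lemma bvanD:
  assumes "bvan B F" "\<epsilon> > 0"
  obtains R where "\<And>t. \<bar>t\<bar> > R \<Longrightarrow> B (F t) \<epsilon>"
  using assms unfolding bvan_def by blast

context seq_ball
begin

lemma bcont_add:
  assumes F: "bcont B S F" and G: "bcont B S G"
  shows "bcont B S (\<lambda>z. F z + G z)"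
  unfolding bcont_def
proof (intro conjI ballI allI impI)
  fix z assume z: "z \<in> S"
  obtain r s where "B (F z) r" "B (G z) s" using F G z unfolding bcont_def by blast
  then show "\<exists>r. B (F z + G z) r" using ball_add by blast
  fix \<epsilon> :: real assume e: "\<epsilon> > 0"
  obtain \<delta>1 where 1: "\<delta>1 > 0" "\<And>w. w \<in> S \<Longrightarrow> dist w z < \<delta>1 \<Longrightarrow> B (F w - F z) (\<epsilon>/2)"
    using bcontD[OF F z, of "\<epsilon>/2"] e by auto
  obtain \<delta>2 where 2: "\<delta>2 > 0" "\<And>w. w \<in> S \<Longrightarrow> dist w z < \<delta>2 \<Longrightarrow> B (G w - G z) (\<epsilon>/2)"
    using bcontD[OF G z, of "\<epsilon>/2"] e by auto
  have "B (F w + G w - (F z + G z)) \<epsilon>" if "w \<in> S" "dist w z < min \<delta>1 \<delta>2" for w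
  proof -
    have "B (F w - F z + (G w - G z)) (\<epsilon>/2 + \<epsilon>/2)" using that 1 2 by (intro ball_add) auto
    then show ?thesis by (simp add: algebra_simps)
  qed
  then show "\<exists>\<delta>>0. \<forall>w\<in>S. dist w z < \<delta> \<longrightarrow> B (F w + G w - (F z + G z)) \<epsilon>"
    using 1(1) 2(1) by (intro exI[of _ "min \<delta>1 \<delta>2"]) auto
qed

lemma bcont_scale:
  fixes S :: "'b::metric_space set" and h :: "'b \<Rightarrow> complex"
  assumes F: "bcont B S F" and h: "continuous_on S h"
  shows "bcont B S (\<lambda>z. seq_smul (h z) (F z))"
  unfolding bcont_def
proof (intro conjI ballI allI impI)
  fix z assume z: "z \<in> S"
  then obtain r where r: "B (F z) r" using F unfolding bcont_def by blast
  then have r0: "r \<ge> 0" by (rule ball_nonneg)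
  show "\<exists>r. B (seq_smul (h z) (F z)) r" using ball_scale[OF r] by blast
  fix \<epsilon> :: real assume e: "\<epsilon> > 0"
  define H where "H = cmod (h z) + 1"
  have H: "H > 0" by (simp add: H_def add_nonneg_pos)
  obtain \<delta>1 where 1: "\<delta>1 > 0" "\<And>w. w \<in> S \<Longrightarrow> dist w z < \<delta>1 \<Longrightarrow> B (F w - F z) (\<epsilon> / (2 * H))"
    using bcontD[OF F z, of "\<epsilon> / (2 * H)"] e H by auto
  define \<eta> where "\<eta> = min 1 (\<epsilon> / (2 * (r + 1)))"
  have eta: "\<eta> > 0" using e r0 by (simp add: \<eta>_def)
  then obtain \<delta>2 where 2: "\<delta>2 > 0" "\<And>w. w \<in> S \<Longrightarrow> dist w z < \<delta>2 \<Longrightarrow> dist (h w) (h z) < \<eta>"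
    using h[unfolded continuous_on_iff, rule_format, OF z eta] by blast
  have "B (seq_smul (h w) (F w) - seq_smul (h z) (F z)) \<epsilon>" if w: "w \<in> S" "dist w z < min \<delta>1 \<delta>2" for w
  proof -
    have hw: "cmod (h w - h z) < \<eta>" using 2 w by (simp add: dist_norm)
    then have "cmod (h w) \<le> H" using norm_triangle_ineq2[of "h w" "h z"] by (simp add: H_def \<eta>_def)
    then have a: "cmod (h w) * (\<epsilon> / (2 * H)) \<le> \<epsilon>/2"
      using mult_right_mono[of "cmod (h w)" H "\<epsilon> / (2 * H)"] e H by simp
    have "cmod (h w - h z) * r \<le> \<epsilon> / (2 * (r + 1)) * (r + 1)"
      using hw r0 e by (intro mult_mono) (auto simp: \<eta>_def)
    also have "\<epsilon> / (2 * (r + 1)) * (r + 1) = \<epsilon>/2" using r0 by (simp add: divide_simps)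
    finally have b: "cmod (h w - h z) * r \<le> \<epsilon>/2" .
    have "B (seq_smul (h w) (F w - F z) + seq_smul (h w - h z) (F z)) (\<epsilon>/2 + \<epsilon>/2)"
      using 1 w by (intro ball_add ball_mono[OF ball_scale a] ball_mono[OF ball_scale b] r) auto
    then show ?thesis by (simp add: seq_smul_def fun_diff_def plus_fun_def algebra_simps)
  qed
  then show "\<exists>\<delta>>0. \<forall>w\<in>S. dist w z < \<delta> \<longrightarrow> B (seq_smul (h w) (F w) - seq_smul (h z) (F z)) \<epsilon>"
    using 1(1) 2(1) by (intro exI[of _ "min \<delta>1 \<delta>2"]) auto
qed

lemma ball_restr: "B x r \<Longrightarrow> B (restr A x) r"
  by (erule ball_dominated) (simp add: restr_def)

lemma bcont_restr:
  assumes "bcont B S F"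
  shows "bcont B S (\<lambda>z. restr A (F z))"
proof -
  have "restr A x - restr A y = restr A (x - y)" for x y by (auto simp: restr_def)
  then show ?thesis using assms ball_restr unfolding bcont_def by metis
qed

lemma bcont_uniform_limit:
  assumes "\<And>\<epsilon>. \<epsilon> > 0 \<Longrightarrow> \<exists>G. bcont B S G \<and> (\<forall>z\<in>S. B (F z - G z) \<epsilon>)"
  shows "bcont B S F"
  unfolding bcont_def
proof (intro conjI ballI allI impI)
  fix z assume z: "z \<in> S"
  obtain G where "bcont B S G" "B (F z - G z) 1" using assms[of 1] z by auto
  moreover obtain r where "B (G z) r" using calculation z by (auto simp: bcont_def)
  ultimately show "\<exists>r. B (F z) r" using ball_add[of "F z - G z" 1 "G z" r] by auto
  fix \<epsilon> :: real assume e: "\<epsilon> > 0"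
  obtain G where G: "bcont B S G" "\<forall>z\<in>S. B (F z - G z) (\<epsilon>/3)" using assms[of "\<epsilon>/3"] e by auto
  then obtain \<delta> where d: "\<delta> > 0" "\<And>w. w \<in> S \<Longrightarrow> dist w z < \<delta> \<Longrightarrow> B (G w - G z) (\<epsilon>/3)"
    using bcontD[OF G(1) z, of "\<epsilon>/3"] e by auto
  have "B (F w - F z) \<epsilon>" if w: "w \<in> S" "dist w z < \<delta>" for w
  proof -
    have "B ((F w - G w) + (G w - G z) - (F z - G z)) (\<epsilon>/3 + \<epsilon>/3 + \<epsilon>/3)"
      using G d w z by (intro ball_add ball_diff) auto
    then show ?thesis by (simp add: algebra_simps)
  qed
  then show "\<exists>\<delta>>0. \<forall>w\<in>S. dist w z < \<delta> \<longrightarrow> B (F w - F z) \<epsilon>" using d by blast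
qed

lemma bvan_add:
  assumes F: "bvan B F" and G: "bvan B G"
  shows "bvan B (\<lambda>t. F t + G t)"
  unfolding bvan_def
proof (intro allI impI)
  fix \<epsilon> :: real assume e: "\<epsilon> > 0"
  obtain R1 where 1: "\<And>t. \<bar>t\<bar> > R1 \<Longrightarrow> B (F t) (\<epsilon>/2)" using bvanD[OF F, of "\<epsilon>/2"] e by auto
  obtain R2 where 2: "\<And>t. \<bar>t\<bar> > R2 \<Longrightarrow> B (G t) (\<epsilon>/2)" using bvanD[OF G, of "\<epsilon>/2"] e by auto
  have "B (F t + G t) (\<epsilon>/2 + \<epsilon>/2)" if "\<bar>t\<bar> > max R1 R2" for t
    using that by (intro ball_add 1 2) auto
  then show "\<exists>R. \<forall>t. \<bar>t\<bar> > R \<longrightarrow> B (F t + G t) \<epsilon>" by (intro exI[of _ "max R1 R2"]) simp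
qed

lemma bvan_scale:
  assumes F: "bvan B F" and h: "\<And>t. cmod (h t) \<le> H"
  shows "bvan B (\<lambda>t. seq_smul (h t) (F t))"
  unfolding bvan_def
proof (intro allI impI)
  fix \<epsilon> :: real assume e: "\<epsilon> > 0"
  have H: "H \<ge> 0" using h[of 0] norm_ge_zero order_trans by blast
  have "\<epsilon> / (H + 1) > 0" using e H by simp
  then obtain R where R: "\<And>t. \<bar>t\<bar> > R \<Longrightarrow> B (F t) (\<epsilon> / (H + 1))" using bvanD[OF F] by blast
  have "B (seq_smul (h t) (F t)) \<epsilon>" if "\<bar>t\<bar> > R" for t
  proof (rule ball_mono[OF ball_scale[OF R[OF that]]])
    have "cmod (h t) * (\<epsilon> / (H + 1)) \<le> (H + 1) * (\<epsilon> / (H + 1))"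
      using h[of t] e H by (intro mult_right_mono) auto
    then show "cmod (h t) * (\<epsilon> / (H + 1)) \<le> \<epsilon>" using H by simp
  qed
  then show "\<exists>R. \<forall>t. \<bar>t\<bar> > R \<longrightarrow> B (seq_smul (h t) (F t)) \<epsilon>" by blast
qed

lemma bvan_restr: "bvan B F \<Longrightarrow> bvan B (\<lambda>t. restr A (F t))"
  unfolding bvan_def by (meson ball_restr)

lemma bvan_uniform_limit:
  assumes "\<And>\<epsilon>. \<epsilon> > 0 \<Longrightarrow> \<exists>G. bvan B G \<and> (\<forall>t. B (F t - G t) \<epsilon>)"
  shows "bvan B F"
  unfolding bvan_def
proof (intro allI impI)
  fix \<epsilon> :: real assume e: "\<epsilon> > 0"
  then obtain G where G: "bvan B G" "\<And>t. B (F t - G t) (\<epsilon>/2)" using assms[of "\<epsilon>/2"] by auto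
  then obtain R where R: "\<And>t. \<bar>t\<bar> > R \<Longrightarrow> B (G t) (\<epsilon>/2)" using bvanD[OF G(1), of "\<epsilon>/2"] e by auto
  have "B (F t - G t + G t) (\<epsilon>/2 + \<epsilon>/2)" if "\<bar>t\<bar> > R" for t by (rule ball_add[OF G(2) R[OF that]])
  then show "\<exists>R. \<forall>t. \<bar>t\<bar> > R \<longrightarrow> B (F t) \<epsilon>" by auto
qed

text \<open>Vanishing at infinity disposes of large parameters, and finitely many local bounds cover
  the remaining compact interval.\<close>

lemma bcont_bvan_bounded:
  fixes G :: "real \<Rightarrow> cseq"
  assumes G: "bcont B UNIV G" and van: "bvan B G"
  shows "\<exists>M. \<forall>t. B (G t) M"
proof -
  obtain R where R: "\<And>t. \<bar>t\<bar> > R \<Longrightarrow> B (G t) 1" using bvanD[OF van zero_less_one] by blast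
  have "\<forall>t. \<exists>r \<delta>. \<delta> > 0 \<and> (\<forall>s. dist s t < \<delta> \<longrightarrow> B (G s) r)"
  proof
    fix t
    obtain r where r: "B (G t) r" using G unfolding bcont_def by blast
    obtain \<delta> where d: "\<delta> > 0" "\<And>s. dist s t < \<delta> \<Longrightarrow> B (G s - G t) 1"
      using bcontD[OF G UNIV_I[of t] zero_less_one] by auto
    have "B (G s) (1 + r)" if "dist s t < \<delta>" for s
      using ball_add[OF d(2)[OF that] r] by simp
    then show "\<exists>r \<delta>. \<delta> > 0 \<and> (\<forall>s. dist s t < \<delta> \<longrightarrow> B (G s) r)"
      using d(1) by blast
  qed
  then obtain r \<delta> where d: "\<And>t. \<delta> t > 0" "\<And>s t. dist s t < \<delta> t \<Longrightarrow> B (G s) (r t)" by metis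
  have "{-R..R} \<subseteq> (\<Union>t\<in>{-R..R}. ball t (\<delta> t))" using d by force
  from compactE_image[OF compact_Icc open_ball this]
  obtain C where C: "finite C" "{-R..R} \<subseteq> (\<Union>t\<in>C. ball t (\<delta> t))" by metis
  have "B (G t) (Max (insert 1 (r ` C)))" for t
  proof (cases "\<bar>t\<bar> > R")
    case True
    show ?thesis by (rule ball_mono[OF R[OF True]]) (use C in auto)
  next
    case False
    then have "t \<in> {-R..R}" by (auto simp: abs_if split: if_splits)
    then have "t \<in> (\<Union>t\<in>C. ball t (\<delta> t))" using C(2) by blast
    then obtain s where s: "s \<in> C" "dist s t < \<delta> s" by auto
    show ?thesis by (rule ball_mono[OF d(2)[of t s]]) (use s C in \<open>auto simp: dist_commute\<close>)
  qed
  then show ?thesis by blast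
qed

end

lemma cal_add:
  assumes "cal F" "cal G"
  shows "cal (\<lambda>z. F z + G z)"
proof -
  obtain M N where "\<forall>z\<in>strip. inf_le (F z) M" "\<forall>z\<in>strip. inf_le (G z) N"
    using assms by (auto simp: cal_def)
  then have "\<forall>z\<in>strip. inf_le (F z + G z) (M + N)" by (auto intro: inf.ball_add)
  then show ?thesis using assms unfolding cal_def
    by (auto intro!: inf.bcont_add one.bcont_add inf.bvan_add one.bvan_add holomorphic_intros)
qed

lemma cal_mult:
  assumes F: "cal F" and h: "continuous_on strip h" "h holomorphic_on ostrip"
    and H: "\<And>z. z \<in> strip \<Longrightarrow> cmod (h z) \<le> H"
  shows "cal (\<lambda>z. seq_smul (h z) (F z))"
proof -
  obtain M where M: "\<forall>z\<in>strip. inf_le (F z) M" using F by (auto simp: cal_def)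
  have s: "Complex 0 t \<in> strip" "Complex 1 t \<in> strip" for t by (auto simp: strip_def)
  have "inf_le (seq_smul (h z) (F z)) (H * M)" if "z \<in> strip" for z
  proof -
    have "inf_le (F z) M" using M that by blast
    then show ?thesis
      by (intro inf.ball_mono[OF inf.ball_scale[of _ M]] mult_right_mono H that) (auto intro: inf.ball_nonneg)
  qed
  moreover have "(\<lambda>z. seq_smul (h z) (F z) k) holomorphic_on ostrip" for k
    using F h by (auto simp: cal_def seq_smul_def intro!: holomorphic_intros)
  moreover have "continuous_on UNIV (\<lambda>t. h (Complex 1 t))"
    by (rule continuous_on_compose2[OF h(1)]) (auto intro!: continuous_intros simp: strip_def Complex_eq)
  ultimately show ?thesis using F h H s unfolding cal_def
    by (auto intro!: inf.bcont_scale one.bcont_scale inf.bvan_scale[where H = H] one.bvan_scale[where H = H])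
qed

lemma cal_cmult: "cal F \<Longrightarrow> cal (\<lambda>z. seq_smul c (F z))"
  by (rule cal_mult[of F "\<lambda>_. c" "cmod c"]) auto

lemma cal_restr:
  assumes "cal F"
  shows "cal (\<lambda>z. restr A (F z))"
proof -
  have "(\<lambda>z. restr A (F z) k) holomorphic_on ostrip" for k
    using assms by (cases "k \<in> A") (auto simp: restr_def cal_def)
  moreover obtain M where "\<forall>z\<in>strip. inf_le (F z) M" using assms by (auto simp: cal_def)
  then have "\<forall>z\<in>strip. inf_le (restr A (F z)) M" by (simp add: inf.ball_restr)
  ultimately show ?thesis using assms unfolding cal_def
    by (auto intro!: inf.bcont_restr one.bcont_restr inf.bvan_restr one.bvan_restr)
qed

lemma cal_zero: "cal (\<lambda>z. 0)"
proof -
  have "inf_le 0 \<epsilon>" "one_le 0 \<epsilon>" if "\<epsilon> > 0" for \<epsilon>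
    using that inf.ball_mono[OF inf.ball_zero] one.ball_mono[OF one.ball_zero] by auto
  then show ?thesis unfolding cal_def bcont_def bvan_def
    by (auto intro!: exI[of _ 1])
qed

lemma cal_sum: "finite J \<Longrightarrow> (\<And>j. j \<in> J \<Longrightarrow> cal (F j)) \<Longrightarrow> cal (\<lambda>z. \<Sum>j\<in>J. F j z)"
  by (induction J rule: finite_induct) (auto simp: cal_zero cal_add)

text \<open>Approximation is required in two norms: the sup norm on the strip governs continuity
  and, by Weierstrass' theorem, holomorphy in each coordinate; the l1 norm governs the right
  edge.\<close>

lemma cal_uniform_limit:
  assumes lim: "\<And>\<epsilon>. \<epsilon> > 0 \<Longrightarrow> \<exists>G. cal G \<and> (\<forall>z\<in>strip. inf_le (F z - G z) \<epsilon>) \<and>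
      (\<forall>t. one_le (F (Complex 1 t) - G (Complex 1 t)) \<epsilon>)"
  shows "cal F"
proof -
  have s: "Complex 0 t \<in> strip" for t by (auto simp: strip_def)
  obtain G where "cal G" "\<forall>z\<in>strip. inf_le (F z - G z) 1" using lim[of 1] by auto
  moreover obtain M where "\<forall>z\<in>strip. inf_le (G z) M" using calculation(1) by (auto simp: cal_def)
  ultimately have "\<forall>z\<in>strip. inf_le (F z - G z + G z) (1 + M)"
    using inf.ball_add by metis
  then have bdd: "\<exists>M. \<forall>z\<in>strip. inf_le (F z) M" by auto
  have hol: "(\<lambda>z. F z k) holomorphic_on ostrip" for k
  proof -
    have "\<forall>n. \<exists>G. cal G \<and> (\<forall>z\<in>strip. inf_le (F z - G z) (inverse (real (Suc n)))) \<and>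
        (\<forall>t. one_le (F (Complex 1 t) - G (Complex 1 t)) (inverse (real (Suc n))))"
      by (intro allI lim) simp_all
    then obtain G where G: "\<And>n. cal (G n)" "\<And>n z. z \<in> strip \<Longrightarrow> inf_le (F z - G n z) (inverse (real (Suc n)))"
      by metis
    have ul: "uniform_limit ostrip (\<lambda>n z. G n z k) (\<lambda>z. F z k) sequentially"
    proof (rule uniform_limitI)
      fix e :: real assume "e > 0"
      then have "eventually (\<lambda>n. inverse (real (Suc n)) < e) sequentially"
        by (rule order_tendstoD[OF LIMSEQ_inverse_real_of_nat])
      then show "\<forall>\<^sub>F n in sequentially. \<forall>x\<in>ostrip. dist (G n x k) (F x k) < e"
      proof eventually_elim
        case (elim n)
        show ?case
        proof
          fix x assume "x \<in> ostrip"
          then have "cmod ((F x - G n x) k) \<le> inverse (real (Suc n))"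
            by (intro inf.ball_coord G(2) subsetD[OF ostrip_strip])
          then show "dist (G n x k) (F x k) < e" using elim by (simp add: dist_norm norm_minus_commute)
        qed
      qed
    qed
    show ?thesis
    proof (rule holomorphic_uniform_sequence[OF open_ostrip])
      show "(\<lambda>z. G n z k) holomorphic_on ostrip" for n using G(1) by (auto simp: cal_def)
      fix x assume "x \<in> ostrip"
      then obtain d where "d > 0" "cball x d \<subseteq> ostrip" using open_ostrip open_contains_cball by blast
      then show "\<exists>d>0. cball x d \<subseteq> ostrip \<and> uniform_limit (cball x d) (\<lambda>n z. G n z k) (\<lambda>z. F z k) sequentially"
        using uniform_limit_on_subset[OF ul] by blast
    qed
  qed
  have "bcont inf_le strip F" 
  proof (rule inf.bcont_uniform_limit)
    fix \<epsilon> :: real assume "\<epsilon> > 0"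
    from lim[OF this] obtain G where "cal G" "\<forall>z\<in>strip. inf_le (F z - G z) \<epsilon>" by auto
    then show "\<exists>G. bcont inf_le strip G \<and> (\<forall>z\<in>strip. inf_le (F z - G z) \<epsilon>)"
      by (intro exI[of _ G]) (simp add: cal_def)
  qed
  moreover have "bvan inf_le (\<lambda>t. F (Complex 0 t))"
  proof (rule inf.bvan_uniform_limit)
    fix \<epsilon> :: real assume "\<epsilon> > 0"
    from lim[OF this] obtain G where "cal G" "\<forall>z\<in>strip. inf_le (F z - G z) \<epsilon>" by auto
    then show "\<exists>G. bvan inf_le G \<and> (\<forall>t. inf_le (F (Complex 0 t) - G t) \<epsilon>)"
      using s by (intro exI[of _ "\<lambda>t. G (Complex 0 t)"]) (auto simp: cal_def)
  qed
  moreover have "bcont one_le UNIV (\<lambda>t. F (Complex 1 t))"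
  proof (rule one.bcont_uniform_limit)
    fix \<epsilon> :: real assume "\<epsilon> > 0"
    from lim[OF this] obtain G where "cal G" "\<forall>t. one_le (F (Complex 1 t) - G (Complex 1 t)) \<epsilon>" by auto
    then show "\<exists>G. bcont one_le UNIV G \<and> (\<forall>t\<in>UNIV. one_le (F (Complex 1 t) - G t) \<epsilon>)"
      by (intro exI[of _ "\<lambda>t. G (Complex 1 t)"]) (auto simp: cal_def)
  qed
  moreover have "bvan one_le (\<lambda>t. F (Complex 1 t))"
  proof (rule one.bvan_uniform_limit)
    fix \<epsilon> :: real assume "\<epsilon> > 0"
    from lim[OF this] obtain G where "cal G" "\<forall>t. one_le (F (Complex 1 t) - G (Complex 1 t)) \<epsilon>" by auto
    then show "\<exists>G. bvan one_le G \<and> (\<forall>t. one_le (F (Complex 1 t) - G t) \<epsilon>)"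
      by (intro exI[of _ "\<lambda>t. G (Complex 1 t)"]) (auto simp: cal_def)
  qed
  ultimately show ?thesis unfolding cal_def using bdd hol by blast
qed

subsection \<open>Boundary bounds\<close>

text \<open>Only edge values are constrained; \<open>cal_inf_le\<close> carries the sup bound into
  the strip.\<close>

definition cbd :: "real \<Rightarrow> (complex \<Rightarrow> cseq) \<Rightarrow> bool" where
  "cbd M F \<longleftrightarrow> (\<forall>t. inf_le (F (Complex 0 t)) M \<and> one_le (F (Complex 1 t)) M)"

lemma cbd_nonneg: "cbd M F \<Longrightarrow> 0 \<le> M"
  using inf.ball_nonneg by (auto simp: cbd_def)

lemma cbd_add: "cbd M F \<Longrightarrow> cbd N G \<Longrightarrow> cbd (M + N) (\<lambda>z. F z + G z)"
  by (auto simp: cbd_def intro: inf.ball_add one.ball_add)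

lemma cbd_cmult: "cbd M F \<Longrightarrow> cbd (cmod c * M) (\<lambda>z. seq_smul c (F z))"
  by (auto simp: cbd_def intro: inf.ball_scale one.ball_scale)

lemma cbd_restr: "cbd M F \<Longrightarrow> cbd M (\<lambda>z. restr A (F z))"
  by (auto simp: cbd_def intro: inf.ball_restr one.ball_restr)

lemma cal_bounded: "cal F \<Longrightarrow> \<exists>M. cbd M F"
proof -
  assume F: "cal F"
  then obtain M N where "\<forall>z\<in>strip. inf_le (F z) M" "\<forall>t. one_le (F (Complex 1 t)) N"
    using one.bcont_bvan_bounded unfolding cal_def by blast
  then have "cbd (max M N) F"
    unfolding cbd_def by (auto simp: strip_def intro: inf.ball_mono[of _ M] one.ball_mono[of _ N])
  then show ?thesis ..
qed

lemma cal_coord_continuous: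
  assumes "cal F"
  shows "continuous_on strip (\<lambda>z. F z k)"
  unfolding continuous_on_iff
proof (intro ballI allI impI)
  fix z e assume "z \<in> strip" "(0::real) < e"
  moreover have "bcont inf_le strip F" using assms by (simp add: cal_def)
  ultimately obtain \<delta> where "\<delta> > 0" "\<And>w. w \<in> strip \<Longrightarrow> dist w z < \<delta> \<Longrightarrow> inf_le (F w - F z) (e/2)"
    using bcontD[of inf_le strip F z "e/2"] by auto
  moreover have "dist (F w k) (F z k) < e" if "inf_le (F w - F z) (e/2)" for w
    using inf.ball_coord[OF that, of k] \<open>0 < e\<close> by (simp add: dist_norm)
  ultimately show "\<exists>d>0. \<forall>w\<in>strip. dist w z < d \<longrightarrow> dist (F w k) (F z k) < e" by blast
qed

lemma cal_coord_holomorphic: "cal F \<Longrightarrow> (\<lambda>z. F z k) holomorphic_on ostrip"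
  by (simp add: cal_def)

lemma cal_inf_le:
  assumes F: "cal F" and M: "cbd M F" and z: "z \<in> strip"
  shows "inf_le (F z) M"
  unfolding inf_le_def
proof
  fix k
  obtain N where N: "\<forall>z\<in>strip. inf_le (F z) N" using F by (auto simp: cal_def)
  show "cmod (F z k) \<le> M"
    by (rule strip_maximum_principle[where B = N, OF cal_coord_continuous[OF F] cal_coord_holomorphic[OF F]])
      (use N M z inf.ball_coord one.ball_coord in \<open>auto simp: cbd_def\<close>)
qed

lemma cal_tc_bound:
  assumes F: "cal F" and M: "cbd M F"
  shows "cmod (tc (\<lambda>z. F z k) i) \<le> 2 ^ i * M"
  by (rule tc_bound[OF cal_coord_continuous[OF F] cal_coord_holomorphic[OF F], of _ M])
    (use cal_inf_le[OF F M] M inf.ball_coord one.ball_coord in \<open>auto simp: cbd_def\<close>)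

text \<open>Some finite bound is secured first, so that both suprema are genuine and can be compared
  with M.\<close>

lemma calderon_norm_le_iff:
  assumes "cal F"
  shows "calderon_norm linf l1 F \<le> M \<longleftrightarrow> cbd M F"
proof -
  have i: "\<And>x r. inf_le x r \<Longrightarrow> nrm linf x \<le> r" "\<And>x r. inf_le x r \<Longrightarrow> inf_le x (nrm linf x)"
    using gauges_linf unfolding gauges_def by auto
  have o: "\<And>x r. one_le x r \<Longrightarrow> nrm l1 x \<le> r" "\<And>x r. one_le x r \<Longrightarrow> one_le x (nrm l1 x)"
    using gauges_l1 unfolding gauges_def by auto
  obtain N where N: "cbd N F" using cal_bounded[OF assms] by blast
  have b: "bdd_above (range (\<lambda>t. nrm linf (F (Complex 0 t))))" "bdd_above (range (\<lambda>t. nrm l1 (F (Complex 1 t))))"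
    using N i(1) o(1) by (auto simp: cbd_def intro!: bdd_aboveI[of _ N])
  have "calderon_norm linf l1 F \<le> M \<longleftrightarrow> (\<forall>t. nrm linf (F (Complex 0 t)) \<le> M \<and> nrm l1 (F (Complex 1 t)) \<le> M)"
    unfolding calderon_norm_def using b by (auto simp: cSUP_le_iff)
  also have "\<dots> \<longleftrightarrow> cbd M F"
    unfolding cbd_def
  proof (intro iffI allI conjI)
    fix t assume M: "\<forall>t. nrm linf (F (Complex 0 t)) \<le> M \<and> nrm l1 (F (Complex 1 t)) \<le> M"
    have "inf_le (F (Complex 0 t)) N" "one_le (F (Complex 1 t)) N" using N by (auto simp: cbd_def)
    then show "inf_le (F (Complex 0 t)) M" "one_le (F (Complex 1 t)) M"
      using M inf.ball_mono[OF i(2)] one.ball_mono[OF o(2)] by auto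
  next
    fix t assume "\<forall>t. inf_le (F (Complex 0 t)) M \<and> one_le (F (Complex 1 t)) M"
    then show "nrm linf (F (Complex 0 t)) \<le> M" "nrm l1 (F (Complex 1 t)) \<le> M" using i(1) o(1) by auto
  qed
  finally show ?thesis .
qed

section \<open>The quotient norm\<close>

lemma Z3_nrm_le:
  assumes "cal F" "cbd M F"
  shows "nrm Z3 (Delta3 F) \<le> M"
proof -
  have "nrm Z3 (Delta3 F) \<le> calderon_norm linf l1 F"
    unfolding Z3_def cnspace.simps
  proof (rule cInf_lower)
    show "bdd_below {calderon_norm linf l1 G |G. G \<in> calderon linf l1 \<and> Delta3 G = Delta3 F}"
    proof (rule bdd_belowI[of _ 0])
      fix r assume "r \<in> {calderon_norm linf l1 G |G. G \<in> calderon linf l1 \<and> Delta3 G = Delta3 F}"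
      then obtain G where "r = calderon_norm linf l1 G" "cal G" by (auto simp: calderon_iff_cal)
      then show "0 \<le> r" using calderon_norm_le_iff[of G r] cbd_nonneg by simp
    qed
  qed (use assms calderon_iff_cal in blast)
  also have "\<dots> \<le> M" using calderon_norm_le_iff assms by blast
  finally show ?thesis .
qed

lemma Z3_points: "points Z3 = Delta3 ` Collect cal"
  by (auto simp: Z3_def calderon_iff_cal)

text \<open>Nothing guarantees that the quotient infimum is attained, hence the strict inequality
  and the slack in the norm estimates that use it.\<close>

lemma Z3_nrm_less:
  assumes "X \<in> points Z3" "nrm Z3 X < r"
  shows "\<exists>F. cal F \<and> cbd r F \<and> Delta3 F = X"
proof -
  let ?A = "{calderon_norm linf l1 F |F. F \<in> calderon linf l1 \<and> Delta3 F = X}"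
  have "?A \<noteq> {}" using assms(1) by (auto simp: Z3_points calderon_iff_cal)
  moreover have "Inf ?A < r" using assms(2) by (simp add: Z3_def)
  ultimately obtain s where "s \<in> ?A" "s < r" by (rule cInf_lessD[THEN bexE])
  then obtain F where "cal F" "Delta3 F = X" "calderon_norm linf l1 F \<le> r"
    by (auto simp: calderon_iff_cal)
  then show ?thesis using calderon_norm_le_iff by blast
qed

subsection \<open>Finitely supported members\<close>

lemma (in seq_ball) bcont_coordinate:
  assumes "B (unit_seq k) 1" "continuous_on S \<phi>"
  shows "bcont B S (\<lambda>z. seq_smul (\<phi> z) (unit_seq k))"
proof (rule bcont_scale[OF _ assms(2)])
  show "bcont B S (\<lambda>z. unit_seq k)"
    using assms(1) ball_mono[OF ball_zero] by (auto simp: bcont_def intro!: exI[of _ 1])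
qed

lemma unit_seq_balls: "inf_le (unit_seq k) 1" "one_le (unit_seq k) 1"
proof -
  show o: "one_le (unit_seq k) 1"
    unfolding one_le_def unit_seq_def
    by (auto simp: sum.delta if_distrib[of cmod] cong: if_cong)
  then show "inf_le (unit_seq k) 1" by (rule one_le_imp_inf_le)
qed

lemma (in seq_ball) bvan_coordinate:
  assumes u: "B (unit_seq k) 1" and C: "\<And>t. cmod (\<phi> t) * (1 + \<bar>t\<bar>) \<le> C"
  shows "bvan B (\<lambda>t. seq_smul (\<phi> t) (unit_seq k))"
  unfolding bvan_def
proof (intro allI impI)
  fix \<epsilon> :: real assume e: "\<epsilon> > 0"
  have "B (seq_smul (\<phi> t) (unit_seq k)) \<epsilon>" if "\<bar>t\<bar> > C / \<epsilon>" for t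
  proof (rule ball_mono[OF ball_scale[OF u]])
    have "C \<le> \<epsilon> * (1 + \<bar>t\<bar>)" using that e by (simp add: field_simps)
    then have "cmod (\<phi> t) * (1 + \<bar>t\<bar>) \<le> \<epsilon> * (1 + \<bar>t\<bar>)" using C order_trans by blast
    then show "cmod (\<phi> t) * 1 \<le> \<epsilon>" by (simp add: mult_le_cancel_right)
  qed
  then show "\<exists>R. \<forall>t. \<bar>t\<bar> > R \<longrightarrow> B (seq_smul (\<phi> t) (unit_seq k)) \<epsilon>" by blast
qed

text \<open>The factor \<open>1 + \<bar>Im z\<bar>\<close> encodes boundedness together with
  vanishing along both edges.\<close>

lemma cal_coordinate:
  assumes c: "continuous_on strip \<phi>" and h: "\<phi> holomorphic_on ostrip"
    and C: "\<And>z. z \<in> strip \<Longrightarrow> cmod (\<phi> z) * (1 + \<bar>Im z\<bar>) \<le> C"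
  shows "cal (\<lambda>z. seq_smul (\<phi> z) (unit_seq k))"
proof -
  have s: "Complex 0 t \<in> strip" "Complex 1 t \<in> strip" for t by (auto simp: strip_def)
  have b: "cmod (\<phi> z) \<le> C" if "z \<in> strip" for z
  proof -
    have "cmod (\<phi> z) * 1 \<le> cmod (\<phi> z) * (1 + \<bar>Im z\<bar>)" by (intro mult_left_mono) auto
    then show ?thesis using C[OF that] by simp
  qed
  have "inf_le (seq_smul (\<phi> z) (unit_seq k)) C" if "z \<in> strip" for z
    using inf.ball_mono[OF inf.ball_scale[OF unit_seq_balls(1)]] b[OF that] by simp
  moreover have "(\<lambda>z. seq_smul (\<phi> z) (unit_seq k) l) holomorphic_on ostrip" for l
    using h by (auto simp: seq_smul_def intro!: holomorphic_intros)
  moreover have "continuous_on UNIV (\<lambda>t. \<phi> (Complex 1 t))"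
    by (rule continuous_on_compose2[OF c]) (auto intro!: continuous_intros simp: strip_def Complex_eq)
  ultimately show ?thesis unfolding cal_def
    using unit_seq_balls C[OF s(1)] C[OF s(2)] c
    by (auto intro!: inf.bcont_coordinate one.bcont_coordinate inf.bvan_coordinate one.bvan_coordinate)
qed

lemma cal_finite:
  assumes "finite K" and c: "\<And>k. k \<in> K \<Longrightarrow> continuous_on strip (\<phi> k)"
    and h: "\<And>k. k \<in> K \<Longrightarrow> \<phi> k holomorphic_on ostrip"
    and C: "\<And>k z. k \<in> K \<Longrightarrow> z \<in> strip \<Longrightarrow> cmod (\<phi> k z) * (1 + \<bar>Im z\<bar>) \<le> C k"
  shows "cal (\<lambda>z k. if k \<in> K then \<phi> k z else 0)"
proof -
  have "cal (\<lambda>z. \<Sum>k\<in>K. seq_smul (\<phi> k z) (unit_seq k))"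
    using assms by (intro cal_sum cal_coordinate) auto
  moreover have "(\<Sum>k\<in>K. seq_smul (\<phi> k z) (unit_seq k)) = (\<lambda>k. if k \<in> K then \<phi> k z else 0)" for z
  proof
    fix l
    have "(\<Sum>k\<in>K. seq_smul (\<phi> k z) (unit_seq k)) l = (\<Sum>k\<in>K. seq_smul (\<phi> k z) (unit_seq k) l)"
      using \<open>finite K\<close> by (induction K rule: finite_induct) auto
    then show "(\<Sum>k\<in>K. seq_smul (\<phi> k z) (unit_seq k)) l = (if l \<in> K then \<phi> l z else 0)"
      using \<open>finite K\<close> by (simp add: seq_smul_def unit_seq_def if_distrib[of "\<lambda>x. _ * x"] sum.delta cong: if_cong)
  qed
  ultimately show ?thesis by simp
qed

section \<open>The space as a type\<close>

lemma Delta3_add: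
  assumes "cal F" "cal G"
  shows "Delta3 (\<lambda>z. F z + G z) = Delta3 F + Delta3 G"
  unfolding Delta3_cal[OF cal_add[OF assms]] Delta3_cal[OF assms(1)] Delta3_cal[OF assms(2)]
  by (simp add: fun_eq_iff tc_add cal_coord_holomorphic assms)

lemma Delta3_cmult:
  assumes "cal F"
  shows "Delta3 (\<lambda>z. seq_smul c (F z)) = smul Z3 c (Delta3 F)"
  unfolding Delta3_cal[OF cal_cmult[OF assms]] Delta3_cal[OF assms]
  by (simp add: Z3_def seq_smul_def fun_eq_iff tc_cmult cal_coord_holomorphic assms)

lemma Delta3_zero: "Delta3 (\<lambda>z. 0) = 0"
  unfolding Delta3_cal[OF cal_zero] by (simp add: fun_eq_iff tc_const zero_prod_def)

lemma Z3_closed: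
  shows "0 \<in> points Z3" "X \<in> points Z3 \<Longrightarrow> Y \<in> points Z3 \<Longrightarrow> X + Y \<in> points Z3"
    "X \<in> points Z3 \<Longrightarrow> smul Z3 c X \<in> points Z3"
proof -
  show "0 \<in> points Z3" unfolding Z3_points using Delta3_zero cal_zero by (metis image_eqI mem_Collect_eq)
  show "X + Y \<in> points Z3" if "X \<in> points Z3" "Y \<in> points Z3"
    using that Delta3_add[symmetric] cal_add unfolding Z3_points by auto
  show "smul Z3 c X \<in> points Z3" if "X \<in> points Z3"
    using that Delta3_cmult[symmetric] cal_cmult unfolding Z3_points by auto
qed

lemma smul_Z3: "smul Z3 c (u, v, w) = (seq_smul c u, seq_smul c v, seq_smul c w)"
  by (simp add: Z3_def)

lemma smul_Z3_minus_one: "smul Z3 (-1) X = - X"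
  by (cases X) (simp add: smul_Z3 seq_smul_def fun_Compl_def)

interpretation Z3: module "smul Z3"
proof
  fix a b :: complex and X Y :: "cseq \<times> cseq \<times> cseq"
  show "smul Z3 a (X + Y) = smul Z3 a X + smul Z3 a Y"
    by (cases X; cases Y) (simp add: smul_Z3 seq_smul_def fun_eq_iff algebra_simps)
  show "smul Z3 (a + b) X = smul Z3 a X + smul Z3 b X"
    by (cases X) (simp add: smul_Z3 seq_smul_def fun_eq_iff algebra_simps)
  show "smul Z3 a (smul Z3 b X) = smul Z3 (a * b) X"
    by (cases X) (simp add: smul_Z3 seq_smul_def fun_eq_iff algebra_simps)
  show "smul Z3 1 X = X"
    by (cases X) (simp add: smul_Z3 seq_smul_def)
qed

text \<open>As a type the space joins the classes of normed and Banach spaces, which gives access to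
  series, closures and completeness there. These classes are real, so complex scalars are kept
  separately as \<open>cs\<close>.\<close>

typedef zspace = "points Z3"
  using Z3_closed(1) by blast

definition cs :: "complex \<Rightarrow> zspace \<Rightarrow> zspace" where
  "cs c U = Abs_zspace (smul Z3 c (Rep_zspace U))"

lemma Rep_cs: "Rep_zspace (cs c U) = smul Z3 c (Rep_zspace U)"
  unfolding cs_def by (rule Abs_zspace_inverse) (rule Z3_closed(3)[OF Rep_zspace])

instantiation zspace :: real_normed_vector
begin

definition "0 = Abs_zspace 0"
definition "U + V = Abs_zspace (Rep_zspace U + Rep_zspace V)"
definition "- U = cs (-1) U"
definition "U - V = U + (- V)" for U V :: zspace
definition "scaleR r U = cs (of_real r) U"
definition "norm U = nrm Z3 (Rep_zspace U)"
definition "sgn U = inverse (norm U) *\<^sub>R U" for U :: zspace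
definition "dist U V = norm (U - V)" for U V :: zspace
definition "uniformity = (INF e\<in>{0 <..}. principal {(U::zspace, V). dist U V < e})"
definition "open (S :: zspace set) = (\<forall>U\<in>S. \<forall>\<^sub>F (U', V) in uniformity. U' = U \<longrightarrow> V \<in> S)"

lemma Rep_zero: "Rep_zspace 0 = 0"
  unfolding zero_zspace_def by (rule Abs_zspace_inverse) (rule Z3_closed(1))

lemma Rep_add: "Rep_zspace (U + V) = Rep_zspace U + Rep_zspace V"
  unfolding plus_zspace_def by (rule Abs_zspace_inverse) (rule Z3_closed(2)[OF Rep_zspace Rep_zspace])

lemma Rep_uminus: "Rep_zspace (- U) = - Rep_zspace U"
  by (simp add: uminus_zspace_def Rep_cs smul_Z3_minus_one)

lemma norm_less_imp_cal:
  assumes "norm U < r"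
  shows "\<exists>F. cal F \<and> cbd r F \<and> Rep_zspace U = Delta3 F"
  using Z3_nrm_less[OF Rep_zspace[of U]] assms by (metis norm_zspace_def)

lemma cal_imp_norm_le: "cal F \<Longrightarrow> cbd M F \<Longrightarrow> Rep_zspace U = Delta3 F \<Longrightarrow> norm U \<le> M"
  using Z3_nrm_le[of F M] by (simp add: norm_zspace_def)

lemma norm_zspace_nonneg: "0 \<le> norm (U::zspace)"
proof (rule ccontr)
  assume "\<not> 0 \<le> norm U"
  \<comment> \<open>Half of a negative number exceeds it, so a representing function with a negative
    bound would exist.\<close>
  then have "norm U < norm U / 2" by simp
  from norm_less_imp_cal[OF this] show False
    using cbd_nonneg \<open>\<not> 0 \<le> norm U\<close> by fastforce
qed

lemma zspace_norm_cs_le: "norm (cs c U) \<le> cmod c * norm U"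
proof (rule field_le_epsilon)
  fix e :: real assume e: "e > 0"
  define d where "d = e / (cmod c + 1)"
  have d: "d > 0" using e by (simp add: d_def add_nonneg_pos)
  then obtain F where F: "cal F" "cbd (norm U + d) F" "Rep_zspace U = Delta3 F"
    using norm_less_imp_cal[of U "norm U + d"] by auto
  have "norm (cs c U) \<le> cmod c * (norm U + d)"
    by (rule cal_imp_norm_le[OF cal_cmult[OF F(1)] cbd_cmult[OF F(2)]])
      (simp add: Rep_cs F Delta3_cmult)
  also have "\<dots> \<le> cmod c * norm U + (cmod c + 1) * d" using d by (simp add: algebra_simps)
  also have "(cmod c + 1) * d = e" by (simp add: d_def add_nonneg_eq_0_iff)
  finally show "norm (cs c U) \<le> cmod c * norm U + e" .
qed

lemma zspace_norm_cs: "norm (cs c U) = cmod c * norm U"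
proof (cases "c = 0")
  case True
  have "norm (cs 0 U) \<le> 0" using zspace_norm_cs_le[of 0 U] by simp
  then show ?thesis using True norm_zspace_nonneg[of "cs 0 U"] by simp
next
  case False
  have "cs (1/c) (cs c U) = U"
    using False by (simp flip: Rep_zspace_inject add: Rep_cs)
  then have "norm U \<le> cmod (1/c) * norm (cs c U)" using zspace_norm_cs_le by metis
  then have "cmod c * norm U \<le> norm (cs c U)" using False by (simp add: norm_divide field_simps)
  then show ?thesis using zspace_norm_cs_le[of c U] by simp
qed

text \<open>The factor 2^i of \<open>cal_tc_bound\<close> is at most 4 for the three orders. Besides
  continuity of the coefficients this gives definiteness of the norm.\<close>

lemma zspace_coefficient_bound:
  assumes "Rep_zspace U = (w, y, x)"
  shows "cmod (x k) \<le> 4 * norm U" "cmod (y k) \<le> 4 * norm U" "cmod (w k) \<le> 4 * norm U"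
proof -
  have *: "cmod (x k) \<le> 4 * norm U + e \<and> cmod (y k) \<le> 4 * norm U + e \<and> cmod (w k) \<le> 4 * norm U + e"
    if e: "e > 0" for e
  proof -
    obtain F where F: "cal F" "cbd (norm U + e/4) F" "Rep_zspace U = Delta3 F"
      using norm_less_imp_cal[of U "norm U + e/4"] e by auto
    have xy: "x k = tc (\<lambda>z. F z k) 0" "y k = tc (\<lambda>z. F z k) 1" "w k = tc (\<lambda>z. F z k) 2"
      using F(3) assms Delta3_cal[OF F(1)] by auto
    have "0 \<le> norm U + e/4" using cbd_nonneg[OF F(2)] .
    then show ?thesis
      unfolding xy using cal_tc_bound[OF F(1,2), of k 0] cal_tc_bound[OF F(1,2), of k 1]
        cal_tc_bound[OF F(1,2), of k 2] by (simp add: algebra_simps)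
  qed
  show "cmod (x k) \<le> 4 * norm U" "cmod (y k) \<le> 4 * norm U" "cmod (w k) \<le> 4 * norm U"
    by (rule field_le_epsilon, use * in simp)+
qed

instance
proof
  fix U V W :: zspace and a b :: real
  show "U + V + W = U + (V + W)" "U + V = V + U" "0 + U = U" "- U + U = 0" "U - V = U + - V"
    by (simp_all flip: Rep_zspace_inject add: Rep_add Rep_zero Rep_uminus add_ac minus_zspace_def)
  show "a *\<^sub>R (U + V) = a *\<^sub>R U + a *\<^sub>R V" "(a + b) *\<^sub>R U = a *\<^sub>R U + b *\<^sub>R U"
    "a *\<^sub>R b *\<^sub>R U = (a * b) *\<^sub>R U" "1 *\<^sub>R U = U"
    by (simp_all flip: Rep_zspace_inject
        add: Rep_add Rep_cs scaleR_zspace_def Z3.scale_left_distrib Z3.scale_right_distrib)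
  show "dist U V = norm (U - V)" "sgn U = inverse (norm U) *\<^sub>R U"
    "uniformity = (INF e\<in>{0 <..}. principal {(U::zspace, V). dist U V < e})"
    "open S = (\<forall>U\<in>S. \<forall>\<^sub>F (U', V) in uniformity. U' = U \<longrightarrow> V \<in> S)" for S :: "zspace set"
    by (simp_all add: dist_zspace_def sgn_zspace_def uniformity_zspace_def open_zspace_def)
  show "norm U = 0 \<longleftrightarrow> U = 0"
  proof
    assume "norm U = 0"
    obtain w y x where U: "Rep_zspace U = (w, y, x)" by (metis prod_cases3)
    have "x = 0" "y = 0" "w = 0"
      using zspace_coefficient_bound[OF U] \<open>norm U = 0\<close> by (auto simp: fun_eq_iff)
    then show "U = 0" using U by (simp flip: Rep_zspace_inject add: Rep_zero zero_prod_def)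
  next
    assume "U = 0"
    then have "norm U \<le> 0" using cal_imp_norm_le[of "\<lambda>z. 0" 0 U] cal_zero
      by (simp add: Rep_zero Delta3_zero cbd_def inf.ball_zero one.ball_zero)
    then show "norm U = 0" using norm_zspace_nonneg[of U] by simp
  qed
  show "norm (U + V) \<le> norm U + norm V"
  proof (rule field_le_epsilon)
    fix e :: real assume e: "e > 0"
    obtain F where F: "cal F" "cbd (norm U + e/2) F" "Rep_zspace U = Delta3 F"
      using norm_less_imp_cal[of U "norm U + e/2"] e by auto
    obtain G where G: "cal G" "cbd (norm V + e/2) G" "Rep_zspace V = Delta3 G"
      using norm_less_imp_cal[of V "norm V + e/2"] e by auto
    have "norm (U + V) \<le> (norm U + e/2) + (norm V + e/2)"
      by (rule cal_imp_norm_le[OF cal_add[OF F(1) G(1)] cbd_add[OF F(2) G(2)]])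
        (simp add: Rep_add F G Delta3_add)
    then show "norm (U + V) \<le> norm U + norm V + e" by simp
  qed
  show "norm (a *\<^sub>R U) = \<bar>a\<bar> * norm U"
    by (simp add: scaleR_zspace_def zspace_norm_cs)
qed

end

subsection \<open>Coefficients and projections\<close>

text \<open>\<open>co U i\<close> is the \<open>i\<close>-th Taylor coefficient, so the triple is read from right to left.\<close>

definition co :: "zspace \<Rightarrow> nat \<Rightarrow> cseq" where
  "co U i = (case Rep_zspace U of (w, y, x) \<Rightarrow> if i = 0 then x else if i = 1 then y else w)"

lemma zspace_eqI:
  assumes "\<And>i k. i \<le> 2 \<Longrightarrow> co U i k = co V i k"
  shows "U = V"
proof -
  obtain w y x w' y' x' where U: "Rep_zspace U = (w, y, x)" "Rep_zspace V = (w', y', x')"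
    by (metis prod_cases3)
  have "x k = x' k" "y k = y' k" "w k = w' k" for k
    using assms[of 0 k] assms[of 1 k] assms[of 2 k] by (simp_all add: co_def U)
  then have "Rep_zspace U = Rep_zspace V" unfolding U by auto
  then show ?thesis by (simp add: Rep_zspace_inject)
qed

lemma co_add [simp]: "co (U + V) i k = co U i k + co V i k"
  by (cases "Rep_zspace U" rule: prod_cases3; cases "Rep_zspace V" rule: prod_cases3)
    (simp add: co_def Rep_add)

lemma co_cs [simp]: "co (cs c U) i k = c * co U i k"
  by (cases "Rep_zspace U" rule: prod_cases3) (simp add: co_def Rep_cs smul_Z3 seq_smul_def)

lemma co_zero [simp]: "co 0 i k = 0"
  by (simp add: co_def Rep_zero zero_prod_def)

lemma co_uminus [simp]: "co (- U) i k = - co U i k"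
  by (simp add: uminus_zspace_def)

lemma co_diff [simp]: "co (U - V) i k = co U i k - co V i k"
  using co_add[of U "- V" i k] by simp

lemma co_sum [simp]: "co (\<Sum>j\<in>J. U j) i k = (\<Sum>j\<in>J. co (U j) i k)"
  by (induction J rule: infinite_finite_induct) auto

lemma co_bound: "cmod (co U i k) \<le> 4 * norm U"
proof -
  obtain w y x where U: "Rep_zspace U = (w, y, x)" by (metis prod_cases3)
  show ?thesis using zspace_coefficient_bound[OF U, of k] by (simp add: co_def U)
qed

lemma tendsto_co: "(U \<longlongrightarrow> V) F \<Longrightarrow> ((\<lambda>n. co (U n) i k) \<longlongrightarrow> co V i k) F"
proof -
  assume "(U \<longlongrightarrow> V) F"
  then have "((\<lambda>n. 4 * norm (U n - V)) \<longlongrightarrow> 0) F"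
    by (intro tendsto_mult_right_zero tendsto_norm_zero) (simp add: LIM_zero_iff)
  then have "((\<lambda>n. co (U n) i k - co V i k) \<longlongrightarrow> 0) F"
    by (rule Lim_null_comparison[rotated]) (metis (mono_tags, lifting) always_eventually co_bound co_diff)
  then show ?thesis by (simp add: LIM_zero_iff)
qed

lemma cs_simps [simp]: "cs a (cs b U) = cs (a * b) U" "cs 1 U = U" "cs 0 U = 0" "cs c 0 = 0"
  by (auto intro!: zspace_eqI)

lemma cs_distrib: "cs c (U + V) = cs c U + cs c V" "cs (a + b) U = cs a U + cs b U"
  "cs c (U - V) = cs c U - cs c V" "cs (a - b) U = cs a U - cs b U" "cs (- a) U = - cs a U"
  by (auto intro!: zspace_eqI simp: algebra_simps)

lemma cs_sum: "cs c (\<Sum>j\<in>J. U j) = (\<Sum>j\<in>J. cs c (U j))"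
  by (intro zspace_eqI) (simp add: sum_distrib_left)

lemma norm_cs [simp]: "norm (cs c U) = cmod c * norm U"
  by (rule zspace_norm_cs)

definition mkz :: "(complex \<Rightarrow> cseq) \<Rightarrow> zspace" where
  "mkz F = Abs_zspace (Delta3 F)"

lemma Rep_mkz: "cal F \<Longrightarrow> Rep_zspace (mkz F) = Delta3 F"
  unfolding mkz_def by (rule Abs_zspace_inverse) (auto simp: Z3_points)

lemma co_mkz: "cal F \<Longrightarrow> i \<le> 2 \<Longrightarrow> co (mkz F) i k = tc (\<lambda>z. F z k) i"
proof -
  assume "cal F" "i \<le> 2"
  then have "i = 0 \<or> i = 1 \<or> i = 2" by linarith
  then show ?thesis by (auto simp: co_def Rep_mkz[OF \<open>cal F\<close>] Delta3_cal[OF \<open>cal F\<close>])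
qed

lemma norm_mkz_le: "cal F \<Longrightarrow> cbd M F \<Longrightarrow> norm (mkz F) \<le> M"
  by (rule cal_imp_norm_le) (auto simp: Rep_mkz)

lemma norm_lessE:
  assumes "norm U < r"
  obtains F where "cal F" "cbd r F" "U = mkz F"
  using norm_less_imp_cal[OF assms] Rep_mkz by (metis Rep_zspace_inject)

lemma mkz_cases:
  obtains F where "cal F" "U = mkz F"
  using norm_lessE[of U "norm U + 1"] by auto

lemma mkz_add: "cal F \<Longrightarrow> cal G \<Longrightarrow> mkz (\<lambda>z. F z + G z) = mkz F + mkz G"
  by (simp flip: Rep_zspace_inject add: Rep_mkz cal_add Rep_add Delta3_add)

lemma mkz_cs: "cal F \<Longrightarrow> mkz (\<lambda>z. seq_smul c (F z)) = cs c (mkz F)"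
  by (simp flip: Rep_zspace_inject add: Rep_mkz cal_cmult Rep_cs Delta3_cmult)

lemma mkz_zero: "mkz (\<lambda>z. 0) = 0"
  by (simp flip: Rep_zspace_inject add: Rep_mkz cal_zero Rep_zero Delta3_zero)

lemma mkz_sum: "finite J \<Longrightarrow> (\<And>j. j \<in> J \<Longrightarrow> cal (F j)) \<Longrightarrow> mkz (\<lambda>z. \<Sum>j\<in>J. F j z) = (\<Sum>j\<in>J. mkz (F j))"
  by (induction J rule: finite_induct) (auto simp: mkz_zero mkz_add cal_sum)

lemma mkz_diff:
  assumes "cal F" "cal G"
  shows "cal (\<lambda>z. F z - G z)" "mkz (\<lambda>z. F z - G z) = mkz F - mkz G"
proof -
  have "(\<lambda>z. F z - G z) = (\<lambda>z. F z + seq_smul (-1) (G z))"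
    by (auto simp: fun_eq_iff seq_smul_def)
  then show "cal (\<lambda>z. F z - G z)" "mkz (\<lambda>z. F z - G z) = mkz F - mkz G"
    using assms by (simp_all add: mkz_add mkz_cs cal_add cal_cmult cs_distrib)
qed

lemma tc_restr: "tc (\<lambda>z. restr A (F z) k) i = (if k \<in> A then tc (\<lambda>z. F z k) i else 0)"
  by (simp add: restr_def tc_const)

text \<open>The representing function is arbitrary; the result does not depend on it, because the
  coefficients of the restricted function are the restricted coefficients
  (\<open>pr_mkz\<close>).\<close>

definition pr :: "nat set \<Rightarrow> zspace \<Rightarrow> zspace" where
  "pr A U = mkz (\<lambda>z. restr A ((SOME F. cal F \<and> U = mkz F) z))"

lemma pr_mkz:
  assumes "cal F"
  shows "pr A (mkz F) = mkz (\<lambda>z. restr A (F z))"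
proof -
  define G where "G = (SOME G. cal G \<and> mkz F = mkz G)"
  have G: "cal G \<and> mkz F = mkz G" unfolding G_def by (rule someI[of _ F]) (use assms in simp)
  have "co (mkz (\<lambda>z. restr A (G z))) i k = co (mkz (\<lambda>z. restr A (F z))) i k" if "i \<le> 2" for i k
  proof -
    have "tc (\<lambda>z. G z k) i = tc (\<lambda>z. F z k) i"
      using co_mkz[OF _ that, of F k] co_mkz[OF _ that, of G k] G assms by simp
    then show ?thesis
      using that G assms by (simp add: co_mkz cal_restr tc_restr)
  qed
  then show ?thesis unfolding pr_def G_def[symmetric] by (rule zspace_eqI)
qed

lemma co_pr [simp]:
  assumes "i \<le> 2"
  shows "co (pr A U) i k = (if k \<in> A then co U i k else 0)"
proof -
  obtain F where "cal F" "U = mkz F" by (rule mkz_cases)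
  then show ?thesis using assms by (simp add: pr_mkz co_mkz cal_restr tc_restr)
qed

lemma norm_pr_le: "norm (pr A U) \<le> norm U"
proof (rule field_le_epsilon)
  fix e :: real assume "e > 0"
  then obtain F where "cal F" "cbd (norm U + e) F" "U = mkz F" using norm_lessE[of U "norm U + e"] by auto
  then show "norm (pr A U) \<le> norm U + e"
    by (simp add: pr_mkz norm_mkz_le cal_restr cbd_restr)
qed

subsection \<open>Completeness\<close>

lemma sum_seq_apply: "(\<Sum>j\<in>J. (X j :: cseq)) k = (\<Sum>j\<in>J. X j k)"
  by (induction J rule: infinite_finite_induct) auto

text \<open>The series is summed coordinatewise; each finite section of the tail obeys the geometric
  bound, and the Fatou property \<open>ball_limit\<close> transfers it to the infinite tail.\<close>

lemma (in seq_ball) ball_series_tail: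
  fixes X :: "nat \<Rightarrow> cseq"
  assumes X: "\<And>n. B (X n) ((1/2) ^ n)"
  shows "B ((\<lambda>k. \<Sum>n. X n k) - (\<Sum>n<N. X n)) (2 * (1/2) ^ N)"
proof -
  have le: "cmod (X n k) \<le> (1/2) ^ n" for n k by (rule ball_coord[OF X])
  have sm: "summable (\<lambda>n. X n k)" for k
    by (rule summable_comparison_test'[of "\<lambda>n. (1/2) ^ n" 0]) (use le in auto)
  have geo: "(\<Sum>n\<in>{N..<M}. (1/2) ^ n) \<le> (2 * (1/2) ^ N :: real)" for M
  proof (cases "N \<le> M")
    case True
    then have "(\<Sum>n\<in>{N..<M}. (1/2) ^ n) = (2 * ((1/2) ^ N - (1/2) ^ M) :: real)"
      by (induction M rule: dec_induct) auto
    then show ?thesis by simp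
  qed simp
  show ?thesis
  proof (rule ball_limit)
    show "B (\<Sum>n\<in>{N..<M}. X n) (2 * (1/2) ^ N)" for M
      by (rule ball_mono[OF ball_sum geo]) (use X in auto)
    fix k
    have "(\<lambda>M. (\<Sum>n<M. X n k) - (\<Sum>n<N. X n k)) \<longlonglongrightarrow> (\<Sum>n. X n k) - (\<Sum>n<N. X n k)"
      using summable_LIMSEQ[OF sm] by (intro tendsto_diff tendsto_const)
    moreover have "eventually (\<lambda>M. (\<Sum>n<M. X n k) - (\<Sum>n<N. X n k) = (\<Sum>n\<in>{N..<M}. X n) k) sequentially"
      using eventually_ge_at_top[of N]
      by eventually_elim (simp add: sum_seq_apply sum_diff_nat_ivl flip: atLeast0LessThan)
    ultimately show "(\<lambda>M. (\<Sum>n\<in>{N..<M}. X n) k) \<longlonglongrightarrow> ((\<lambda>k. \<Sum>n. X n k) - (\<Sum>n<N. X n)) k"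
      by (simp add: sum_seq_apply Lim_transform_eventually)
  qed
qed

text \<open>Completeness is proved on representing functions: geometric edge bounds give uniform
  convergence on the strip and on the right edge, and passage to coefficients does not increase
  norms.\<close>

lemma cal_series:
  assumes F: "\<And>n. cal (F n)" "\<And>n. cbd ((1/2) ^ n) (F n)"
  shows "(\<lambda>N. \<Sum>n<N. mkz (F n)) \<longlonglongrightarrow> mkz (\<lambda>z k. \<Sum>n. F n z k)"
proof -
  define G where "G z = (\<lambda>k. \<Sum>n. F n z k)" for z
  define S where "S N z = (\<Sum>n<N. F n z)" for N z
  have S: "cal (S N)" for N unfolding S_def by (intro cal_sum F) auto
  have inf: "inf_le (G z - S N z) (2 * (1/2) ^ N)" if "z \<in> strip" for z N
    unfolding G_def S_def by (intro inf.ball_series_tail cal_inf_le F that)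
  have one: "one_le (G (Complex 1 t) - S N (Complex 1 t)) (2 * (1/2) ^ N)" for t N
    unfolding G_def S_def using F by (intro one.ball_series_tail) (auto simp: cbd_def)
  have lim0: "(\<lambda>N. 2 * (1/2) ^ N :: real) \<longlonglongrightarrow> 0"
    by (intro tendsto_mult_right_zero LIMSEQ_power_zero) simp
  have G: "cal G"
  proof (rule cal_uniform_limit)
    fix \<epsilon> :: real assume "\<epsilon> > 0"
    then obtain N where "2 * (1/2) ^ N < \<epsilon>"
      using order_tendstoD(2)[OF lim0] by (auto simp: eventually_sequentially)
    then show "\<exists>H. cal H \<and> (\<forall>z\<in>strip. inf_le (G z - H z) \<epsilon>) \<and>
        (\<forall>t. one_le (G (Complex 1 t) - H (Complex 1 t)) \<epsilon>)"
      using S inf[THEN inf.ball_mono] one[THEN one.ball_mono] by (intro exI[of _ "S N"]) auto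
  qed
  have "norm ((\<Sum>n<N. mkz (F n)) - mkz G) \<le> 2 * (1/2) ^ N" for N
  proof -
    have "norm (mkz (\<lambda>z. G z - S N z)) \<le> 2 * (1/2) ^ N"
      using inf one by (intro norm_mkz_le mkz_diff G S) (auto simp: cbd_def strip_def)
    moreover have "mkz (S N) = (\<Sum>n<N. mkz (F n))"
      unfolding S_def by (intro mkz_sum F) auto
    ultimately show ?thesis by (simp add: mkz_diff G S norm_minus_commute)
  qed
  then have "(\<lambda>N. (\<Sum>n<N. mkz (F n)) - mkz G) \<longlonglongrightarrow> 0"
    by (intro Lim_null_comparison[OF _ lim0] always_eventually) auto
  then show ?thesis unfolding G_def by (simp add: LIM_zero_iff)
qed

instance zspace :: banach
proof
  fix X :: "nat \<Rightarrow> zspace" assume X: "Cauchy X"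
  have "\<exists>N. \<forall>m\<ge>N. \<forall>n\<ge>N. norm (X m - X n) < (1/2) ^ j" for j
    using X unfolding Cauchy_iff by (metis half_gt_zero_iff zero_less_one zero_less_power zero_less_divide_1_iff zero_less_numeral)
  then obtain N where N: "\<And>j m n. m \<ge> N j \<Longrightarrow> n \<ge> N j \<Longrightarrow> norm (X m - X n) < (1/2) ^ j" by metis
  \<comment> \<open>The partial sums dominate each \<open>N j\<close>, and the summand j makes the
    sequence strictly increasing.\<close>
  define r where "r j = (\<Sum>i\<le>j. N i) + j" for j
  have r: "strict_mono r" by (rule strict_monoI_Suc) (simp add: r_def)
  have rN: "N j \<le> r j" for j unfolding r_def by (rule trans_le_add1) (simp add: member_le_sum)
  have "\<exists>F. cal F \<and> cbd ((1/2) ^ j) F \<and> X (r (Suc j)) - X (r j) = mkz F" for j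
  proof -
    have "norm (X (r (Suc j)) - X (r j)) < (1/2) ^ j"
      by (intro N) (use rN r in \<open>auto intro: order_trans[OF rN] simp: strict_mono_less_eq\<close>)
    then show ?thesis by (meson norm_lessE)
  qed
  then obtain F where F: "\<And>j. cal (F j)" "\<And>j. cbd ((1/2) ^ j) (F j)" "\<And>j. X (r (Suc j)) - X (r j) = mkz (F j)"
    by metis
  have "(\<Sum>j<n. mkz (F j)) = X (r n) - X (r 0)" for n
    using sum_lessThan_telescope[of "\<lambda>j. X (r j)" n] by (simp flip: F(3))
  with cal_series[OF F(1,2)] have "(\<lambda>n. X (r n) - X (r 0)) \<longlonglongrightarrow> mkz (\<lambda>z k. \<Sum>n. F n z k)" by simp
  from tendsto_add[OF this tendsto_const[of "X (r 0)"]]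
  have "(X \<circ> r) \<longlonglongrightarrow> mkz (\<lambda>z k. \<Sum>n. F n z k) + X (r 0)" by (simp add: o_def)
  then show "convergent X" using Cauchy_converges_subseq[OF X r] by (auto simp: convergent_def)
qed

section \<open>Estimates in the space\<close>

lemma strip_distance_bound:
  assumes "z \<in> strip" "m \<le> 2"
  shows "cmod (z - 1/2) ^ m * cmod (decay z) * (1 + \<bar>Im z\<bar>) \<le> exp 6"
proof -
  have "cmod (z - 1/2) \<le> \<bar>Re (z - 1/2)\<bar> + \<bar>Im (z - 1/2)\<bar>" by (rule cmod_le)
  also have "\<dots> \<le> 1 + \<bar>Im z\<bar>" using assms by (auto simp: strip_def abs_if)
  finally have "cmod (z - 1/2) ^ m \<le> (1 + \<bar>Im z\<bar>) ^ m" by (intro power_mono) auto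
  also have "\<dots> \<le> (1 + \<bar>Im z\<bar>) ^ 3" using assms by (intro power_increasing) auto
  finally have "cmod (z - 1/2) ^ m * cmod (decay z) * (1 + \<bar>Im z\<bar>) \<le>
      (1 + \<bar>Im z\<bar>) ^ 3 * cmod (decay z) * (1 + \<bar>Im z\<bar>)"
    by (intro mult_right_mono) auto
  also have "\<dots> = (1 + \<bar>Im z\<bar>) ^ 4 * cmod (decay z)"
    by (simp add: power4_eq_xxxx power3_eq_cube mult_ac)
  also have "\<dots> \<le> exp 6" by (rule decay_bound[OF assms(1)])
  finally show ?thesis .
qed

lemma strip_distance_bound':
  assumes "z \<in> strip" "m \<le> 2"
  shows "cmod (z - 1/2) ^ m * cmod (decay z) \<le> exp 6"
proof -
  have "cmod (z - 1/2) ^ m * cmod (decay z) * 1 \<le> cmod (z - 1/2) ^ m * cmod (decay z) * (1 + \<bar>Im z\<bar>)"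
    by (intro mult_left_mono) auto
  then show ?thesis using strip_distance_bound[OF assms] by simp
qed

lemma cbd_finite:
  assumes K: "finite K" and M: "M \<ge> 0"
    and 0: "\<And>t k. k \<in> K \<Longrightarrow> cmod (\<phi> k (Complex 0 t)) \<le> M"
    and 1: "\<And>t. (\<Sum>k\<in>K. cmod (\<phi> k (Complex 1 t))) \<le> M"
  shows "cbd M (\<lambda>z k. if k \<in> K then \<phi> k z else 0)"
  unfolding cbd_def inf_le_def one_le_def
proof (intro allI conjI impI)
  fix t k show "cmod (if k \<in> K then \<phi> k (Complex 0 t) else 0) \<le> M" using 0 M by auto
next
  fix t and L :: "nat set" assume L: "finite L"
  have "(\<Sum>k\<in>L. cmod (if k \<in> K then \<phi> k (Complex 1 t) else 0)) = (\<Sum>k\<in>L \<inter> K. cmod (\<phi> k (Complex 1 t)))"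
    using L by (intro sum.mono_neutral_cong_right) auto
  also have "\<dots> \<le> (\<Sum>k\<in>K. cmod (\<phi> k (Complex 1 t)))" using K by (intro sum_mono2) auto
  also have "\<dots> \<le> M" by (rule 1)
  finally show "(\<Sum>k\<in>L. cmod (if k \<in> K then \<phi> k (Complex 1 t) else 0)) \<le> M" .
qed

lemma tc_if: "tc (\<lambda>z. if P then \<phi> z else 0) i = (if P then tc \<phi> i else 0)"
  by (simp add: tc_const)

text \<open>Damped quadratic polynomials realise any finite array. The bound grows with the support
  and is meant for a fixed finite set of coordinates, where it turns coordinatewise convergence into
  norm convergence.\<close>

lemma exists_finite_coefficients:
  fixes c :: "nat \<Rightarrow> nat \<Rightarrow> complex"
  assumes K: "finite K"
  shows "\<exists>U. (\<forall>i\<le>2. \<forall>k. co U i k = (if k \<in> K then c i k else 0)) \<and>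
    norm U \<le> exp 6 * (\<Sum>k\<in>K. \<Sum>i\<le>2. cmod (c i k))"
proof -
  define p where "p k z = (\<Sum>i\<le>2. c i k * (z - 1/2) ^ i)" for k z
  define \<phi> where "\<phi> k z = decay z * p k z" for k z
  have hp: "p k holomorphic_on S" for k S unfolding p_def by (intro holomorphic_intros)
  have h: "\<phi> k holomorphic_on S" for k S unfolding \<phi>_def by (intro holomorphic_intros hp)
  have b: "cmod (\<phi> k z) * (1 + \<bar>Im z\<bar>) \<le> exp 6 * (\<Sum>i\<le>2. cmod (c i k))" if z: "z \<in> strip" for k z
  proof -
    have "cmod (\<phi> k z) * (1 + \<bar>Im z\<bar>) \<le> cmod (decay z) * (\<Sum>i\<le>2. cmod (c i k) * cmod (z - 1/2) ^ i) * (1 + \<bar>Im z\<bar>)"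
      unfolding \<phi>_def p_def norm_mult
      by (intro mult_right_mono mult_left_mono order_trans[OF norm_sum]) (auto simp: norm_mult norm_power)
    also have "\<dots> = (\<Sum>i\<le>2. cmod (c i k) * (cmod (z - 1/2) ^ i * cmod (decay z) * (1 + \<bar>Im z\<bar>)))"
      by (simp add: sum_distrib_left sum_distrib_right mult_ac)
    also have "\<dots> \<le> (\<Sum>i\<le>2. cmod (c i k) * exp 6)"
      by (intro sum_mono mult_left_mono strip_distance_bound z) auto
    finally show ?thesis by (simp add: sum_distrib_left mult_ac)
  qed
  have b': "cmod (\<phi> k z) \<le> exp 6 * (\<Sum>i\<le>2. cmod (c i k))" if z: "z \<in> strip" for k z
  proof -
    have "cmod (\<phi> k z) * 1 \<le> cmod (\<phi> k z) * (1 + \<bar>Im z\<bar>)" by (intro mult_left_mono) auto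
    then show ?thesis using b[OF z, of k] by simp
  qed
  define F where "F z k = (if k \<in> K then \<phi> k z else 0)" for z k
  have F: "cal F" unfolding F_def
    by (rule cal_finite[OF K holomorphic_on_imp_continuous_on[OF h] h b])
  have tp: "tc (p k) i = (if i \<le> 2 then c i k else 0)" for k i
  proof -
    have "tc (p k) i = (\<Sum>l\<le>2. tc (\<lambda>z. c l k * (z - 1/2) ^ l) i)"
      unfolding p_def by (rule tc_sum) (auto intro!: holomorphic_intros)
    also have "\<dots> = (\<Sum>l\<le>2. c l k * (if i = l then 1 else 0))"
      by (intro sum.cong refl, subst tc_cmult) (auto simp: tc_power intro!: holomorphic_intros)
    finally have "tc (p k) i = (\<Sum>l\<le>2. c l k * (if i = l then 1 else 0))" .
    then show ?thesis by (simp add: if_distrib[of "\<lambda>x. _ * x"] cong: if_cong)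
  qed
  have t: "tc (\<phi> k) i = c i k" if "i \<le> 2" for k i
  proof -
    have "tc (\<phi> k) i = (\<Sum>l\<le>i. tc decay l * tc (p k) (i - l))"
      unfolding \<phi>_def by (rule tc_mult[OF decay_holomorphic hp])
    also have "\<dots> = (\<Sum>l\<le>i. if l = 0 then tc (p k) i else 0)"
      using that by (intro sum.cong refl) (auto simp: tc_decay)
    finally show ?thesis using that by (simp add: tp)
  qed
  have "co (mkz F) i k = (if k \<in> K then c i k else 0)" if "i \<le> 2" for i k
    unfolding co_mkz[OF F that] F_def tc_if using t[OF that] by simp
  moreover have "norm (mkz F) \<le> exp 6 * (\<Sum>k\<in>K. \<Sum>i\<le>2. cmod (c i k))"
  proof (rule norm_mkz_le[OF F])
    show "cbd (exp 6 * (\<Sum>k\<in>K. \<Sum>i\<le>2. cmod (c i k))) F"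
      unfolding F_def
    proof (rule cbd_finite[OF K])
      show "0 \<le> exp 6 * (\<Sum>k\<in>K. \<Sum>i\<le>2. cmod (c i k))" by (intro mult_nonneg_nonneg sum_nonneg) auto
      show "cmod (\<phi> k (Complex 0 t)) \<le> exp 6 * (\<Sum>k\<in>K. \<Sum>i\<le>2. cmod (c i k))" if "k \<in> K" for t k
        using that K by (intro order_trans[OF b'] mult_left_mono member_le_sum)
          (auto simp: strip_def intro: sum_nonneg)
      show "(\<Sum>k\<in>K. cmod (\<phi> k (Complex 1 t))) \<le> exp 6 * (\<Sum>k\<in>K. \<Sum>i\<le>2. cmod (c i k))" for t
        unfolding sum_distrib_left[of _ _ K] by (intro sum_mono b') (simp add: strip_def)
    qed
  qed
  ultimately show ?thesis by blast
qed

text \<open>The witness is the extremal function \<open>x |x/s|\<^bsup>2z-1\<^esup>\<close> of the couple, damped at infinity.\<close>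

lemma exists_lift:
  assumes K: "finite K" and m: "m \<le> 2"
  shows "\<exists>U. (\<forall>i\<le>2. \<forall>k. k \<notin> K \<longrightarrow> co U i k = 0) \<and> (\<forall>i<m. \<forall>k. co U i k = 0) \<and>
    (\<forall>k\<in>K. co U m k = x k) \<and> norm U \<le> exp 6 * sqrt (\<Sum>k\<in>K. (cmod (x k))\<^sup>2)"
proof -
  define s where "s = sqrt (\<Sum>k\<in>K. (cmod (x k))\<^sup>2)"
  have s2: "s\<^sup>2 = (\<Sum>k\<in>K. (cmod (x k))\<^sup>2)" unfolding s_def by (simp add: sum_nonneg)
  have s0: "s \<ge> 0" unfolding s_def by (simp add: sum_nonneg)
  show ?thesis
  proof (cases "s = 0")
    case True
    then have "\<forall>k\<in>K. x k = 0" using s2 K by (simp add: sum_nonneg_eq_0_iff)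
    then show ?thesis using s0 s_def by (intro exI[of _ 0]) auto
  next
    case False
    then have s: "s > 0" using s0 by simp
    \<comment> \<open>With this slope the modulus before damping is s on the left edge and |x k|^2 /
      s on the right one, and the latter sum to s. The factor \<open>(z - 1/2) ^ m\<close> then
      moves the coefficient to order m. Where x k = 0 the leading factor removes the default value
      of ln.\<close>
    define L where "L k = 2 * ln (cmod (x k) / s)" for k
    define g where "g k z = x k * (exp (of_real (L k) * (z - 1/2)) * decay z)" for k z
    define \<phi> where "\<phi> k z = (z - 1/2) ^ m * g k z" for k z
    have hg: "g k holomorphic_on S" for k S unfolding g_def by (intro holomorphic_intros)
    have h: "\<phi> k holomorphic_on S" for k S unfolding \<phi>_def by (intro holomorphic_intros hg)
    have n\<phi>: "cmod (\<phi> k z) = cmod (x k) * exp (L k * (Re z - 1/2)) * (cmod (z - 1/2) ^ m * cmod (decay z))" for k z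
      by (simp add: \<phi>_def g_def norm_mult norm_power mult_ac)
    have b: "cmod (\<phi> k z) * (1 + \<bar>Im z\<bar>) \<le> cmod (x k) * exp \<bar>L k\<bar> * exp 6" if z: "z \<in> strip" for k z
    proof -
      have "L k * (Re z - 1/2) \<le> \<bar>L k\<bar> * \<bar>Re z - 1/2\<bar>" by (metis abs_ge_self abs_mult)
      also have "\<dots> \<le> \<bar>L k\<bar> * 1" using z by (intro mult_left_mono) (auto simp: strip_def abs_if)
      finally have e: "exp (L k * (Re z - 1/2)) \<le> exp \<bar>L k\<bar>" by simp
      have "cmod (\<phi> k z) * (1 + \<bar>Im z\<bar>) =
          cmod (x k) * exp (L k * (Re z - 1/2)) * (cmod (z - 1/2) ^ m * cmod (decay z) * (1 + \<bar>Im z\<bar>))"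
        by (simp add: n\<phi>)
      also have "\<dots> \<le> cmod (x k) * exp \<bar>L k\<bar> * exp 6"
        using e by (intro mult_mono strip_distance_bound z m) auto
      finally show ?thesis .
    qed
    define F where "F z k = (if k \<in> K then \<phi> k z else 0)" for z k
    have F: "cal F" unfolding F_def
      by (rule cal_finite[OF K holomorphic_on_imp_continuous_on[OF h] h b])
    have t: "tc (\<phi> k) i = (if i < m then 0 else tc (g k) (i - m))" for k i
    proof -
      have "tc (\<phi> k) i = (\<Sum>l\<le>i. tc (\<lambda>z. (z - 1/2) ^ m) l * tc (g k) (i - l))"
        unfolding \<phi>_def by (rule tc_mult[OF _ hg]) (intro holomorphic_intros)
      also have "\<dots> = (\<Sum>l\<le>i. if l = m then tc (g k) (i - m) else 0)"
        by (intro sum.cong refl) (auto simp: tc_power)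
      finally show ?thesis by (simp add: sum.delta)
    qed
    have t0: "tc (g k) 0 = x k" for k by (simp add: tc_def g_def decay_def)
    have c: "co (mkz F) i k = (if k \<in> K \<and> i \<ge> m then tc (g k) (i - m) else 0)" if "i \<le> 2" for i k
      unfolding co_mkz[OF F that] F_def tc_if using t by simp
    have "norm (mkz F) \<le> exp 6 * s"
    proof (rule norm_mkz_le[OF F])
      show "cbd (exp 6 * s) F"
        unfolding F_def
      proof (rule cbd_finite[OF K])
        show "0 \<le> exp 6 * s" using s by simp
        show "cmod (\<phi> k (Complex 0 t)) \<le> exp 6 * s" if "k \<in> K" for t k
        proof (cases "x k = 0")
          case False
          then have "exp (L k * (0 - 1/2)) = s / cmod (x k)"
            using s by (simp add: L_def exp_minus)
          then have "cmod (\<phi> k (Complex 0 t)) = s * (cmod (Complex 0 t - 1/2) ^ m * cmod (decay (Complex 0 t)))"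
            unfolding n\<phi> using False by simp
          also have "\<dots> \<le> s * exp 6" using s by (intro mult_left_mono strip_distance_bound' m) (auto simp: strip_def)
          finally show ?thesis by (simp add: mult.commute)
        qed (use s in \<open>simp add: n\<phi>\<close>)
        show "(\<Sum>k\<in>K. cmod (\<phi> k (Complex 1 t))) \<le> exp 6 * s" for t
        proof -
          have "cmod (\<phi> k (Complex 1 t)) \<le> (cmod (x k))\<^sup>2 / s * exp 6" for k
          proof (cases "x k = 0")
            case False
            then have "exp (L k * (1 - 1/2)) = cmod (x k) / s"
              using s by (simp add: L_def)
            then have "cmod (\<phi> k (Complex 1 t)) =
                (cmod (x k))\<^sup>2 / s * (cmod (Complex 1 t - 1/2) ^ m * cmod (decay (Complex 1 t)))"
              unfolding n\<phi> by (simp add: power2_eq_square)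
            also have "\<dots> \<le> (cmod (x k))\<^sup>2 / s * exp 6"
              using s by (intro mult_left_mono strip_distance_bound' m) (auto simp: strip_def)
            finally show ?thesis .
          qed (simp add: n\<phi>)
          then have "(\<Sum>k\<in>K. cmod (\<phi> k (Complex 1 t))) \<le> (\<Sum>k\<in>K. (cmod (x k))\<^sup>2 / s * exp 6)"
            by (intro sum_mono)
          also have "\<dots> = s\<^sup>2 / s * exp 6" by (simp add: s2 sum_distrib_right sum_divide_distrib)
          finally show ?thesis using s by (simp add: power2_eq_square mult.commute)
        qed
      qed
    qed
    then show ?thesis using c m t0 by (intro exI[of _ "mkz F"]) (auto simp: s_def)
  qed
qed

subsection \<open>Multipliers and convergence of projections\<close>

lemma cal_hker:
  assumes "cal F" "j \<le> 2"
  shows "cal (\<lambda>z. seq_smul (hker j \<mu> z) (F z))"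
proof (rule cal_mult[OF assms(1)])
  show "continuous_on strip (hker j \<mu>)" by (intro holomorphic_on_imp_continuous_on hker_holomorphic)
  fix z assume z: "z \<in> strip"
  have "- 2 * \<mu> * (Re z - 1/2) \<le> \<bar>- 2 * \<mu>\<bar> * \<bar>Re z - 1/2\<bar>" by (metis abs_ge_self abs_mult)
  also have "\<dots> \<le> \<bar>- 2 * \<mu>\<bar> * (1/2)" using z by (intro mult_left_mono) (auto simp: strip_def abs_if)
  finally have "exp (- 2 * \<mu> * (Re z - 1/2)) \<le> exp \<bar>\<mu>\<bar>" by simp
  then have "4 * exp 6 * exp (- 2 * \<mu> * (Re z - 1/2)) * (1 + \<bar>\<mu>\<bar>) ^ j \<le> 4 * exp 6 * exp \<bar>\<mu>\<bar> * (1 + \<bar>\<mu>\<bar>) ^ j"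
    by (intro mult_right_mono mult_left_mono) auto
  then show "cmod (hker j \<mu> z) \<le> 4 * exp 6 * exp \<bar>\<mu>\<bar> * (1 + \<bar>\<mu>\<bar>) ^ j"
    using hker_bound[OF z assms(2), of \<mu>] by linarith
qed (rule hker_holomorphic)

lemma mkz_hker:
  assumes F: "cal F" and j: "j \<le> 2" and v: "\<And>l k. l < 2 - j \<Longrightarrow> co (mkz F) l k = 0"
  shows "mkz (\<lambda>z. seq_smul (hker j \<mu> z) (F z)) = mkz F"
proof (rule zspace_eqI)
  fix i k :: nat assume i: "i \<le> 2"
  have "tc (\<lambda>z. F z k) l = 0" if "l < 2 - j" for l
    using v[OF that, of k] co_mkz[OF F, of l k] that by simp
  then have "tc (\<lambda>z. hker j \<mu> z * F z k) i = tc (\<lambda>z. F z k) i"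
    by (intro tc_hker_mult[OF cal_coord_holomorphic[OF F] j i])
  then show "co (mkz (\<lambda>z. seq_smul (hker j \<mu> z) (F z))) i k = co (mkz F) i k"
    unfolding co_mkz[OF cal_hker[OF F j] i] co_mkz[OF F i] by (simp add: seq_smul_def)
qed

lemma one_le_tail:
  assumes x: "one_le x r" and e: "e > 0"
  shows "\<exists>n. one_le (restr {n..} x) e"
proof -
  have "summable (\<lambda>k. cmod (x k))" using x gauges_l1 by (auto simp: gauges_def l1_def)
  then obtain N where N: "\<And>m n. m \<ge> N \<Longrightarrow> norm (\<Sum>k=m..<n. cmod (x k)) < e"
    using e unfolding summable_Cauchy by metis
  have "one_le (restr {N..} x) e"
    unfolding one_le_def
  proof (intro allI impI)
    fix K :: "nat set" assume K: "finite K"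
    have "(\<Sum>k\<in>K. cmod (restr {N..} x k)) = (\<Sum>k\<in>K \<inter> {N..}. cmod (x k))"
      using K by (intro sum.mono_neutral_cong_right) (auto simp: restr_def)
    also have "\<dots> \<le> (\<Sum>k=N..<Suc (Max K). cmod (x k))"
      using K by (intro sum_mono2) (auto simp: less_Suc_eq_le)
    also have "\<dots> \<le> norm (\<Sum>k=N..<Suc (Max K). cmod (x k))" by (simp only: real_norm_def abs_ge_self)
    also have "\<dots> \<le> e" using N[of N "Suc (Max K)"] by simp
    finally show "(\<Sum>k\<in>K. cmod (restr {N..} x k)) \<le> e" .
  qed
  then show ?thesis ..
qed

lemma one_le_restr_antimono: "one_le (restr {n..} x) e \<Longrightarrow> n \<le> m \<Longrightarrow> one_le (restr {m..} x) e"
  by (erule one.ball_dominated) (auto simp: restr_def)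

text \<open>Compactness on the right edge: an l1 tail that is small at one parameter stays small
  nearby, and vanishing at infinity leaves a compact interval.\<close>

lemma cal_uniform_tail:
  assumes F: "cal F" and e: "e > 0"
  shows "\<exists>n. \<forall>t. one_le (restr {n..} (F (Complex 1 t))) e"
proof -
  define G where "G t = F (Complex 1 t)" for t
  have G: "bcont one_le UNIV G" "bvan one_le G" using F by (simp_all add: cal_def G_def[abs_def])
  obtain R where R: "\<And>t. \<bar>t\<bar> > R \<Longrightarrow> one_le (G t) e" using bvanD[OF G(2) e] by blast
  have "\<exists>n \<delta>. \<delta> > 0 \<and> (\<forall>s. dist s t < \<delta> \<longrightarrow> one_le (restr {n..} (G s)) e)" for t
  proof -
    have e2: "e/2 > 0" using e by simp
    obtain r where r: "one_le (G t) r" using G(1) unfolding bcont_def by blast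
    obtain n where n: "one_le (restr {n..} (G t)) (e/2)" using one_le_tail[OF r e2] by blast
    obtain \<delta> where d: "\<delta> > 0" "\<And>s. dist s t < \<delta> \<Longrightarrow> one_le (G s - G t) (e/2)"
      using bcontD[OF G(1) UNIV_I[of t] e2] by auto
    have "one_le (restr {n..} (G s)) e" if "dist s t < \<delta>" for s
    proof -
      have "one_le (restr {n..} (G s - G t) + restr {n..} (G t)) (e/2 + e/2)"
        by (intro one.ball_add n one.ball_restr[OF d(2)[OF that]])
      moreover have "restr {n..} (G s - G t) + restr {n..} (G t) = restr {n..} (G s)"
        by (auto simp: restr_def)
      ultimately show ?thesis by simp
    qed
    then show ?thesis using d(1) by blast
  qed
  then obtain n \<delta> where d: "\<And>t. \<delta> t > 0" "\<And>s t. dist s t < \<delta> t \<Longrightarrow> one_le (restr {n t..} (G s)) e" by metis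
  have "{-R..R} \<subseteq> (\<Union>t\<in>{-R..R}. ball t (\<delta> t))" using d by force
  from compactE_image[OF compact_Icc open_ball this]
  obtain C where C: "finite C" "{-R..R} \<subseteq> (\<Union>t\<in>C. ball t (\<delta> t))" by metis
  have "one_le (restr {Max (insert 0 (n ` C))..} (G t)) e" for t
  proof (cases "\<bar>t\<bar> > R")
    case True
    show ?thesis by (rule one.ball_restr[OF R[OF True]])
  next
    case False
    then have "t \<in> {-R..R}" by (auto simp: abs_if split: if_splits)
    then have "t \<in> (\<Union>t\<in>C. ball t (\<delta> t))" using C(2) by blast
    then obtain s where s: "s \<in> C" "dist s t < \<delta> s" by auto
    show ?thesis by (rule one_le_restr_antimono[OF d(2)[of t s]]) (use s C in \<open>auto simp: dist_commute\<close>)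
  qed
  then show ?thesis unfolding G_def by blast
qed

text \<open>Tails of a representing function become small on the right edge, but on the left edge
  they are only bounded by M. The multiplier with j = 2 keeps all three coefficients of any
  function; a large negative slope makes the left edge small and inflates the right one, where the
  tail can still be chosen.\<close>

lemma pr_tendsto: "(\<lambda>n. pr {..<n} U) \<longlonglongrightarrow> U"
proof -
  obtain F where F: "cal F" "U = mkz F" by (rule mkz_cases)
  obtain M where M: "cbd M F" using cal_bounded[OF F(1)] by blast
  have M0: "M \<ge> 0" using cbd_nonneg[OF M] .
  have "\<exists>N. \<forall>n\<ge>N. norm (pr {..<n} U - U) \<le> \<epsilon>" if e: "\<epsilon> > 0" for \<epsilon>
  proof -
    have "((\<lambda>L. 4 * exp 6 * exp (- L) * (1 + \<bar>L\<bar>)\<^sup>2 * M) \<longlongrightarrow> 0) at_top" by real_asymp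
    then have "eventually (\<lambda>L. 4 * exp 6 * exp (- L) * (1 + \<bar>L\<bar>)\<^sup>2 * M < \<epsilon>) at_top"
      using e by (rule order_tendstoD)
    from eventually_happens'[OF _ this]
    obtain L where L: "4 * exp 6 * exp (- L) * (1 + \<bar>L\<bar>)\<^sup>2 * M < \<epsilon>" by auto
    \<comment> \<open>This is the inflation of the right edge. It is fixed with L, and only
      afterwards is the tail taken smaller than \<epsilon> / c.\<close>
    define c where "c = 4 * exp 6 * exp L * (1 + \<bar>L\<bar>)\<^sup>2"
    have c: "c > 0" unfolding c_def by (auto intro!: mult_pos_pos zero_less_power)
    obtain N where N: "\<And>t. one_le (restr {N..} (F (Complex 1 t))) (\<epsilon> / c)"
      using cal_uniform_tail[OF F(1), of "\<epsilon> / c"] e c by auto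
    have "norm (pr {..<n} U - U) \<le> \<epsilon>" if n: "n \<ge> N" for n
    proof -
      define G where "G z = restr {n..} (F z)" for z
      have G: "cal G" unfolding G_def by (rule cal_restr[OF F(1)])
      let ?H = "\<lambda>z. seq_smul (hker 2 (- L) z) (G z)"
      have H: "cal ?H" by (rule cal_hker[OF G]) simp
      have "U - pr {..<n} U = pr {n..} U" by (rule zspace_eqI) auto
      also have "\<dots> = mkz G" unfolding F(2) G_def by (rule pr_mkz[OF F(1)])
      also have "\<dots> = mkz ?H" by (rule mkz_hker[OF G, symmetric]) auto
      also have "norm \<dots> \<le> \<epsilon>"
      proof (rule norm_mkz_le[OF H])
        show "cbd \<epsilon> ?H" unfolding cbd_def
        proof (intro allI conjI)
          fix t
          have 0: "Complex 0 t \<in> strip" and 1: "Complex 1 t \<in> strip" by (auto simp: strip_def)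
          have h0: "cmod (hker 2 (- L) (Complex 0 t)) \<le> 4 * exp 6 * exp (- L) * (1 + \<bar>L\<bar>)\<^sup>2"
            using hker_bound[OF 0, of 2 "- L"] by simp
          have h1: "cmod (hker 2 (- L) (Complex 1 t)) \<le> c"
            using hker_bound[OF 1, of 2 "- L"] by (simp add: c_def)
          have "inf_le (G (Complex 0 t)) M" using M unfolding G_def cbd_def by (auto intro: inf.ball_restr)
          then have "inf_le (?H (Complex 0 t)) (cmod (hker 2 (- L) (Complex 0 t)) * M)" by (rule inf.ball_scale)
          moreover have "cmod (hker 2 (- L) (Complex 0 t)) * M \<le> \<epsilon>"
            using mult_right_mono[OF h0 M0] L by linarith
          ultimately show "inf_le (?H (Complex 0 t)) \<epsilon>" by (rule inf.ball_mono)
          have "one_le (G (Complex 1 t)) (\<epsilon> / c)" unfolding G_def by (rule one_le_restr_antimono[OF N n])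
          then have "one_le (?H (Complex 1 t)) (cmod (hker 2 (- L) (Complex 1 t)) * (\<epsilon> / c))" by (rule one.ball_scale)
          moreover have "cmod (hker 2 (- L) (Complex 1 t)) * (\<epsilon> / c) \<le> c * (\<epsilon> / c)"
            using h1 e c by (intro mult_right_mono) auto
          then have "cmod (hker 2 (- L) (Complex 1 t)) * (\<epsilon> / c) \<le> \<epsilon>" using c by simp
          ultimately show "one_le (?H (Complex 1 t)) \<epsilon>" by (rule one.ball_mono)
        qed
      qed
      finally show ?thesis by (simp add: norm_minus_commute)
    qed
    then show ?thesis by blast
  qed
  then have "\<exists>N. \<forall>n\<ge>N. norm (pr {..<n} U - U) < \<epsilon>" if "\<epsilon> > 0" for \<epsilon>
    using that by (meson dense order_le_less_trans)
  then show ?thesis by (simp add: LIMSEQ_iff)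
qed

subsection \<open>Testing against extremal functions\<close>

text \<open>The Taylor coefficient of order i of the scalar function obtained by pairing a
  representing function of U with \<epsilon> k times u k to the power 2 - 2z, the extremal function
  of the dual pairing. For i = 0 it is the l2 pairing; higher orders bring in powers of ln (u k).
  The factor u k cancels the default value of ln at 0.\<close>

definition test :: "(nat \<Rightarrow> complex) \<Rightarrow> (nat \<Rightarrow> real) \<Rightarrow> nat set \<Rightarrow> nat \<Rightarrow> zspace \<Rightarrow> complex" where
  "test \<epsilon> u K i U = (\<Sum>k\<in>K. \<epsilon> k * u k * (\<Sum>l\<le>i. co U l k * (of_real (- 2 * ln (u k)) ^ (i - l) / fact (i - l))))"

text \<open>On the left edge the extremal function has modulus (u k)^2, of sum at most 1, against a
  sup bound; on the right edge it has modulus at most 1 against an l1 bound. So the scalar function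
  is bounded by the same M, and \<open>tc_bound\<close> costs at most 2^2.\<close>

lemma test_bound:
  assumes K: "finite K" and i: "i \<le> 2" and \<epsilon>: "\<And>k. k \<in> K \<Longrightarrow> cmod (\<epsilon> k) \<le> 1"
    and u: "\<And>k. k \<in> K \<Longrightarrow> 0 \<le> u k" "(\<Sum>k\<in>K. (u k)\<^sup>2) \<le> 1"
  shows "cmod (test \<epsilon> u K i U) \<le> 4 * norm U"
proof (rule field_le_epsilon)
  fix e :: real assume "e > 0"
  then obtain F where F: "cal F" "cbd (norm U + e/4) F" "U = mkz F" using norm_lessE[of U "norm U + e/4"] by auto
  define M where "M = norm U + e/4"
  have M0: "M \<ge> 0" using \<open>e > 0\<close> by (simp add: M_def)
  define E where "E k z = exp (of_real (- 2 * ln (u k)) * (z - 1/2))" for k and z :: complex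
  define \<Phi> where "\<Phi> z = (\<Sum>k\<in>K. (\<epsilon> k * u k) * (F z k * E k z))" for z
  have hE: "E k holomorphic_on S" for k S unfolding E_def by (intro holomorphic_intros)
  have tE: "tc (E k) l = of_real (- 2 * ln (u k)) ^ l / fact l" for k l
    unfolding E_def[abs_def] by (rule tc_exp)
  have hF: "(\<lambda>z. F z k) holomorphic_on ostrip" for k by (rule cal_coord_holomorphic[OF F(1)])
  have hFE: "(\<lambda>z. F z k * E k z) holomorphic_on ostrip" for k by (intro holomorphic_intros hE hF)
  have "tc \<Phi> i = (\<Sum>k\<in>K. (\<epsilon> k * u k) * tc (\<lambda>z. F z k * E k z) i)"
    unfolding \<Phi>_def using hFE by (subst tc_sum[OF K]) (auto simp: tc_cmult intro!: holomorphic_on_mult hF hE)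
  also have "\<dots> = test \<epsilon> u K i U"
    unfolding test_def
  proof (intro sum.cong refl arg_cong2[of _ _ _ _ "(*)"])
    fix k
    have "tc (\<lambda>z. F z k * E k z) i = (\<Sum>l\<le>i. tc (\<lambda>z. F z k) l * tc (E k) (i - l))" by (rule tc_mult[OF hF hE])
    also have "\<dots> = (\<Sum>l\<le>i. co U l k * (of_real (- 2 * ln (u k)) ^ (i - l) / fact (i - l)))"
      unfolding tE using i
      by (intro sum.cong refl arg_cong2[of _ _ _ _ "(*)"]) (auto simp: F(3) co_mkz[OF F(1)])
    finally show "tc (\<lambda>z. F z k * E k z) i = (\<Sum>l\<le>i. co U l k * (of_real (- 2 * ln (u k)) ^ (i - l) / fact (i - l)))" .
  qed
  finally have t: "tc \<Phi> i = test \<epsilon> u K i U" .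
  have nE: "cmod (E k z) = exp (- 2 * ln (u k) * (Re z - 1/2))" for k z by (simp add: E_def)
  have n\<Phi>: "cmod (\<Phi> z) \<le> (\<Sum>k\<in>K. u k * (cmod (F z k) * cmod (E k z)))" for z
    unfolding \<Phi>_def
  proof (rule order_trans[OF norm_sum sum_mono])
    fix k assume k: "k \<in> K"
    have "cmod (\<epsilon> k * u k * (F z k * E k z)) = cmod (\<epsilon> k) * (u k * (cmod (F z k) * cmod (E k z)))"
      using u(1)[OF k] by (simp add: norm_mult)
    also have "\<dots> \<le> 1 * (u k * (cmod (F z k) * cmod (E k z)))"
      using \<epsilon>[OF k] u(1)[OF k] by (intro mult_right_mono) auto
    finally show "cmod (\<epsilon> k * u k * (F z k * E k z)) \<le> u k * (cmod (F z k) * cmod (E k z))" by simp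
  qed
  have inf: "cmod (F z k) \<le> M" if "z \<in> strip" for z k
    using inf.ball_coord[OF cal_inf_le[OF F(1,2) that]] by (simp add: M_def)
  have "cmod (tc \<Phi> i) \<le> 2 ^ i * M"
  proof (rule tc_bound)
    show "continuous_on strip \<Phi>"
      unfolding \<Phi>_def 
      by (intro continuous_on_sum continuous_on_mult continuous_on_const cal_coord_continuous[OF F(1)]
          holomorphic_on_imp_continuous_on[OF hE])
    show "\<Phi> holomorphic_on ostrip" unfolding \<Phi>_def by (intro holomorphic_intros hFE hF hE)
    fix z assume z: "z \<in> strip"
    have "cmod (E k z) \<le> exp \<bar>2 * ln (u k)\<bar>" for k
    proof -
      have "- 2 * ln (u k) * (Re z - 1/2) \<le> \<bar>- 2 * ln (u k)\<bar> * \<bar>Re z - 1/2\<bar>" by (metis abs_ge_self abs_mult)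
      also have "\<dots> \<le> \<bar>- 2 * ln (u k)\<bar> * 1" using z by (intro mult_left_mono) (auto simp: strip_def abs_if)
      finally show ?thesis by (simp add: nE)
    qed
    then show "cmod (\<Phi> z) \<le> (\<Sum>k\<in>K. u k * (M * exp \<bar>2 * ln (u k)\<bar>))"
      using u M0 inf[OF z] by (intro order_trans[OF n\<Phi>] sum_mono mult_left_mono mult_mono) auto
  next
    fix t
    have "cmod (\<Phi> (Complex 0 t)) \<le> (\<Sum>k\<in>K. M * (u k)\<^sup>2)"
    proof (intro order_trans[OF n\<Phi>] sum_mono)
      fix k assume k: "k \<in> K"
      show "u k * (cmod (F (Complex 0 t) k) * cmod (E k (Complex 0 t))) \<le> M * (u k)\<^sup>2"
      proof (cases "u k = 0")
        case False
        then have "cmod (E k (Complex 0 t)) = u k" using u(1)[OF k] by (simp add: nE)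
        moreover have FM: "cmod (F (Complex 0 t) k) \<le> M" by (rule inf) (simp add: strip_def)
        ultimately have "u k * (cmod (F (Complex 0 t) k) * cmod (E k (Complex 0 t))) = cmod (F (Complex 0 t) k) * (u k)\<^sup>2"
          by (simp add: power2_eq_square mult_ac)
        also have "\<dots> \<le> M * (u k)\<^sup>2" by (intro mult_right_mono FM) simp
        finally show ?thesis .
      qed simp
    qed
    also have "\<dots> \<le> M" using mult_left_mono[OF u(2) M0] by (simp add: sum_distrib_left)
    finally show "cmod (\<Phi> (Complex 0 t)) \<le> M" .
    have "cmod (\<Phi> (Complex 1 t)) \<le> (\<Sum>k\<in>K. cmod (F (Complex 1 t) k))"
    proof (intro order_trans[OF n\<Phi>] sum_mono)
      fix k assume k: "k \<in> K"
      show "u k * (cmod (F (Complex 1 t) k) * cmod (E k (Complex 1 t))) \<le> cmod (F (Complex 1 t) k)"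
      proof (cases "u k = 0")
        case False
        then have "cmod (E k (Complex 1 t)) = 1 / u k" using u(1)[OF k] by (simp add: nE exp_minus field_simps)
        then show ?thesis using False by simp
      qed simp
    qed
    also have "\<dots> \<le> M" using F(2) K by (auto simp: cbd_def one_le_def M_def)
    finally show "cmod (\<Phi> (Complex 1 t)) \<le> M" .
  qed
  also have "2 ^ i * M \<le> 2 ^ 2 * M" using i M0 by (intro mult_right_mono power_increasing) auto
  finally show "cmod (test \<epsilon> u K i U) \<le> 4 * norm U + e" by (simp add: t M_def)
qed

subsection \<open>Upper estimates for disjoint blocks\<close>

text \<open>Near 0 this is comparable with t^2 (log t)^(2j). The added 1 avoids a zero at modulus 1
  and makes scaling harmless (\<open>weight_scale\<close>).\<close>

definition weight :: "nat \<Rightarrow> complex \<Rightarrow> real" where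
  "weight j a = (cmod a)\<^sup>2 * (1 + \<bar>ln (cmod a)\<bar>) ^ (2 * j)"

lemma weight_nonneg [simp]: "0 \<le> weight j a" by (simp add: weight_def)

lemma weight_ge_square: "(cmod a)\<^sup>2 \<le> weight j a"
  unfolding weight_def by (simp add: mult_le_cancel_left1)

lemma weight_zero [simp]: "weight j 0 = 0" by (simp add: weight_def)

text \<open>With \<open>\<kappa> = 1 - ln |a|\<close> the shift \<open>\<mu> = \<kappa> - j ln \<kappa>\<close> compensates the polynomial
  factor of the multiplier on the left edge and produces the weight on the right edge.\<close>

lemma hker_scaled_bounds:
  assumes a: "cmod a \<le> 1" and j: "j \<le> 2"
  shows "\<exists>\<mu>. (\<forall>t. cmod (a * hker j \<mu> (Complex 0 t)) \<le> 16 * exp 7) \<and>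
    (\<forall>t. cmod (a * hker j \<mu> (Complex 1 t)) \<le> 16 * exp 7 * weight j a)"
proof (cases "a = 0")
  case False
  define r \<kappa> where "r = cmod a" and "\<kappa> = 1 + \<bar>ln r\<bar>"
  have r: "r > 0" "r \<le> 1" using a False by (auto simp: r_def)
  then have l: "\<kappa> = 1 - ln r" "\<kappa> \<ge> 1" by (auto simp: \<kappa>_def)
  then have rl: "r = exp (1 - \<kappa>)" using r by simp
  define \<mu> where "\<mu> = \<kappa> - j * ln \<kappa>"
  have lnl: "0 \<le> ln \<kappa>" "ln \<kappa> \<le> \<kappa> - 1" using l ln_le_minus_one[of \<kappa>] by auto
  \<comment> \<open>This keeps \<mu> between -\<kappa> and \<kappa>, so the polynomial factor of the
    multiplier is \<kappa>^j up to the constant 4.\<close>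
  have "real j * ln \<kappa> \<le> 2 * (\<kappa> - 1)" using j lnl by (intro mult_mono) auto
  then have "\<bar>\<mu>\<bar> \<le> \<kappa>" using lnl by (auto simp: \<mu>_def abs_le_iff)
  then have "(1 + \<bar>\<mu>\<bar>) ^ j \<le> (2 * \<kappa>) ^ j" using l by (intro power_mono) auto
  also have "\<dots> = 2 ^ j * \<kappa> ^ j" by (simp add: power_mult_distrib)
  also have "\<dots> \<le> 2 ^ 2 * \<kappa> ^ j" using j l by (intro mult_right_mono power_increasing) auto
  finally have m: "(1 + \<bar>\<mu>\<bar>) ^ j \<le> 4 * \<kappa> ^ j" by simp
  have lj: "exp (j * ln \<kappa>) = \<kappa> ^ j" using l by (simp add: exp_of_nat_mult)
  have e0: "r * exp \<mu> * \<kappa> ^ j = exp 1"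
  proof -
    have "r * exp \<mu> * \<kappa> ^ j = exp (1 - \<kappa> + \<mu> + j * ln \<kappa>)" by (simp add: rl lj exp_add)
    then show ?thesis by (simp add: \<mu>_def)
  qed
  have e1: "r * exp (- \<mu>) * \<kappa> ^ j = r\<^sup>2 * \<kappa> ^ (2 * j) / exp 1"
  proof -
    have "exp (- \<mu>) = r * \<kappa> ^ j / exp 1"
      using lj by (simp add: \<mu>_def rl exp_diff exp_minus field_simps flip: exp_add)
    then show ?thesis by (simp add: power2_eq_square mult_2 mult_2_right power_add mult_ac)
  qed
  have "cmod (a * hker j \<mu> (Complex 0 t)) \<le> 16 * exp 7" for t
  proof -
    have "cmod (a * hker j \<mu> (Complex 0 t)) \<le> r * (4 * exp 6 * exp \<mu> * (1 + \<bar>\<mu>\<bar>) ^ j)"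
      unfolding norm_mult r_def
      using hker_bound[of "Complex 0 t" j \<mu>] j by (intro mult_left_mono) (auto simp: strip_def)
    also have "\<dots> \<le> r * (4 * exp 6 * exp \<mu> * (4 * \<kappa> ^ j))"
      using r by (intro mult_left_mono m) auto
    also have "\<dots> = 16 * exp 6 * (r * exp \<mu> * \<kappa> ^ j)" by simp
    also have "\<dots> = 16 * exp 7" unfolding e0 by (simp flip: exp_add)
    finally show ?thesis .
  qed
  moreover have "cmod (a * hker j \<mu> (Complex 1 t)) \<le> 16 * exp 7 * weight j a" for t
  proof -
    have "cmod (a * hker j \<mu> (Complex 1 t)) \<le> r * (4 * exp 6 * exp (- \<mu>) * (1 + \<bar>\<mu>\<bar>) ^ j)"
      unfolding norm_mult r_def
      using hker_bound[of "Complex 1 t" j \<mu>] j by (intro mult_left_mono) (auto simp: strip_def)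
    also have "\<dots> \<le> r * (4 * exp 6 * exp (- \<mu>) * (4 * \<kappa> ^ j))"
      using r by (intro mult_left_mono m) auto
    also have "\<dots> = 16 * exp 6 * (r * exp (- \<mu>) * \<kappa> ^ j)" by simp
    also have "\<dots> = 16 * exp 6 * (weight j a / exp 1)" unfolding e1 by (simp add: weight_def r_def \<kappa>_def)
    also have "\<dots> \<le> 16 * exp 7 * weight j a"
    proof -
      have "weight j a / exp 1 \<le> weight j a * exp 1"
        using weight_nonneg[of j a]
        by (simp add: divide_le_eq mult.assoc mult_le_cancel_left1 not_less del: weight_nonneg flip: exp_add)
      then have "16 * exp 6 * (weight j a / exp 1) \<le> 16 * exp 6 * (weight j a * exp 1)"
        by (intro mult_left_mono) auto
      also have "\<dots> = 16 * (exp 6 * exp 1) * weight j a" by simp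
      also have "exp 6 * exp 1 = (exp 7 :: real)" by (simp flip: exp_add)
      finally show ?thesis .
    qed
    finally show ?thesis .
  qed
  ultimately show ?thesis by blast
qed auto

definition blocks :: "(nat \<Rightarrow> nat set) \<Rightarrow> (nat \<Rightarrow> zspace) \<Rightarrow> bool" where
  "blocks A U \<longleftrightarrow> (\<forall>n. finite (A n)) \<and> disjoint_family A \<and>
     (\<forall>n. \<forall>i\<le>2. \<forall>k. k \<notin> A n \<longrightarrow> co (U n) i k = 0)"

definition level :: "nat \<Rightarrow> zspace \<Rightarrow> bool" where
  "level m U \<longleftrightarrow> (\<forall>i<m. \<forall>k. co U i k = 0)"

text \<open>Disjointness decouples the left edge: at each coordinate a single block is present, so
  uniform bounds do not add up. On the right edge l1 norms add, and
  \<open>hker_scaled_bounds\<close> turns the sum into one of weights.\<close>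

lemma block_upper:
  assumes bl: "blocks A U" and j: "j \<le> 2" and lev: "\<And>n. level (2 - j) (U n)"
    and M: "\<And>n. norm (U n) < M" and J: "finite J" and a: "(\<Sum>n\<in>J. weight j (a n)) \<le> 1"
  shows "norm (\<Sum>n\<in>J. cs (a n) (U n)) \<le> 16 * exp 7 * M"
proof -
  have M0: "M > 0" using M[of 0] norm_ge_zero[of "U 0"] by linarith
  have a1: "cmod (a n) \<le> 1" if "n \<in> J" for n
  proof -
    have "weight j (a n) \<le> (\<Sum>n\<in>J. weight j (a n))" using that J by (intro member_le_sum) auto
    then have "(cmod (a n))\<^sup>2 \<le> 1" using a weight_ge_square[of "a n" j] by linarith
    then show ?thesis by (simp add: power_le_one_iff)
  qed
  have "\<exists>\<mu>. \<forall>n\<in>J. (\<forall>t. cmod (a n * hker j (\<mu> n) (Complex 0 t)) \<le> 16 * exp 7) \<and>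
      (\<forall>t. cmod (a n * hker j (\<mu> n) (Complex 1 t)) \<le> 16 * exp 7 * weight j (a n))"
    by (rule bchoice) (use hker_scaled_bounds[OF a1 j] in blast)
  then obtain \<mu> where \<mu>0: "\<And>n t. n \<in> J \<Longrightarrow> cmod (a n * hker j (\<mu> n) (Complex 0 t)) \<le> 16 * exp 7"
    and \<mu>1: "\<And>n t. n \<in> J \<Longrightarrow> cmod (a n * hker j (\<mu> n) (Complex 1 t)) \<le> 16 * exp 7 * weight j (a n)" by metis
  have "\<exists>F. cal F \<and> cbd M F \<and> U n = mkz F" for n using norm_lessE[OF M[of n]] by metis
  then obtain F where F: "\<And>n. cal (F n)" "\<And>n. cbd M (F n)" "\<And>n. U n = mkz (F n)" by metis
  \<comment> \<open>A representing function may spread beyond the support of its block; cutting it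
    back leaves the block unchanged and makes the functions disjoint.\<close>
  define G where "G n z = restr (A n) (F n z)" for n z
  have G: "cal (G n)" "cbd M (G n)" for n unfolding G_def by (intro cal_restr cbd_restr F)+
  have UG: "U n = mkz (G n)" for n
  proof -
    have "U n = pr (A n) (U n)"
      using bl by (intro zspace_eqI) (auto simp: blocks_def)
    then show ?thesis unfolding G_def using F(3) pr_mkz[OF F(1)] by metis
  qed
  define H where "H n z = seq_smul (a n) (seq_smul (hker j (\<mu> n) z) (G n z))" for n z
  have H: "cal (H n)" "mkz (H n) = cs (a n) (U n)" for n
  proof -
    show "cal (H n)" unfolding H_def by (intro cal_cmult cal_hker G j)
    have "mkz (H n) = cs (a n) (mkz (\<lambda>z. seq_smul (hker j (\<mu> n) z) (G n z)))"
      unfolding H_def by (intro mkz_cs cal_hker G j)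
    also have "mkz (\<lambda>z. seq_smul (hker j (\<mu> n) z) (G n z)) = mkz (G n)"
      using lev[of n] UG by (intro mkz_hker G j) (simp add: level_def)
    finally show "mkz (H n) = cs (a n) (U n)" by (simp add: UG)
  qed
  have Heq: "H n z = seq_smul (a n * hker j (\<mu> n) z) (G n z)" for n z
    by (simp add: H_def seq_smul_def mult.assoc)
  define S where "S z = (\<Sum>n\<in>J. H n z)" for z
  have S: "cal S" "mkz S = (\<Sum>n\<in>J. cs (a n) (U n))"
    unfolding S_def using J H by (simp_all add: cal_sum mkz_sum)
  have "cbd (16 * exp 7 * M) S"
    unfolding cbd_def
  proof (intro allI conjI)
    fix t
    show "inf_le (S (Complex 0 t)) (16 * exp 7 * M)"
      unfolding inf_le_def
    proof
      fix k
      have Hk: "cmod (H n (Complex 0 t) k) \<le> 16 * exp 7 * M" if "n \<in> J" for n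
      proof -
        have "cmod (G n (Complex 0 t) k) \<le> M" using G(2)[of n] inf.ball_coord by (auto simp: cbd_def)
        then show ?thesis unfolding Heq seq_smul_def norm_mult[of "a n * _"]
          using \<mu>0[OF that] by (intro mult_mono) auto
      qed
      show "cmod (S (Complex 0 t) k) \<le> 16 * exp 7 * M"
      proof (cases "\<exists>n\<in>J. k \<in> A n")
        case True
        then obtain n where n: "n \<in> J" "k \<in> A n" by blast
        have "H l (Complex 0 t) k = 0" if "l \<noteq> n" for l
        proof -
          have "k \<notin> A l" using bl n that by (auto simp: blocks_def disjoint_family_on_def)
          then show ?thesis by (simp add: Heq seq_smul_def G_def restr_def)
        qed
        then have "S (Complex 0 t) k = (\<Sum>l\<in>J. if l = n then H n (Complex 0 t) k else 0)"
          unfolding S_def sum_seq_apply by (intro sum.cong refl) auto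
        then show ?thesis using n J Hk by simp
      next
        case False
        then have "S (Complex 0 t) k = 0"
          unfolding S_def sum_seq_apply by (intro sum.neutral) (auto simp: Heq seq_smul_def G_def restr_def)
        then show ?thesis using M0 by simp
      qed
    qed
    have o: "one_le (S (Complex 1 t)) (\<Sum>n\<in>J. cmod (a n * hker j (\<mu> n) (Complex 1 t)) * M)"
      unfolding S_def Heq using G(2) by (intro one.ball_sum one.ball_scale J) (auto simp: cbd_def)
    have "(\<Sum>n\<in>J. cmod (a n * hker j (\<mu> n) (Complex 1 t)) * M) \<le> (\<Sum>n\<in>J. 16 * exp 7 * weight j (a n) * M)"
      using M0 \<mu>1 by (intro sum_mono mult_right_mono) auto
    also have "\<dots> = 16 * exp 7 * M * (\<Sum>n\<in>J. weight j (a n))"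
      by (simp add: sum_distrib_left mult_ac)
    also have "\<dots> \<le> 16 * exp 7 * M * 1" using a M0 by (intro mult_left_mono) auto
    finally show "one_le (S (Complex 1 t)) (16 * exp 7 * M)" using one.ball_mono[OF o] by simp
  qed
  from norm_mkz_le[OF S(1) this] show ?thesis by (simp add: S(2))
qed

section \<open>Block sequences\<close>

lemma exists_subsequence:
  assumes "\<And>n. \<exists>N::nat. \<forall>k\<ge>N. P n k"
  shows "\<exists>r::nat \<Rightarrow> nat. strict_mono r \<and> (\<forall>n. P n (r n))"
proof -
  obtain N where N: "\<And>n k. k \<ge> N n \<Longrightarrow> P n k" using assms by metis
  define r where "r j = (\<Sum>i\<le>j. N i) + j" for j
  have "strict_mono r" by (rule strict_monoI_Suc) (simp add: r_def)
  moreover have "N j \<le> r j" for j unfolding r_def by (rule trans_le_add1) (simp add: member_le_sum)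
  ultimately show ?thesis using N by blast
qed

text \<open>Since 1 + p + q is at most (1 + p)(1 + q), a scalar factor enlarges the weight by a
  constant only. This replaces homogeneity, which the weight lacks for positive j.\<close>

lemma weight_scale:
  assumes "c \<noteq> 0"
  shows "weight j (c * a) \<le> ((cmod c)\<^sup>2 * (1 + \<bar>ln (cmod c)\<bar>) ^ (2 * j)) * weight j a"
proof (cases "a = 0")
  case False
  have "ln (cmod (c * a)) = ln (cmod c) + ln (cmod a)" using assms False by (simp add: norm_mult ln_mult)
  then have "1 + \<bar>ln (cmod (c * a))\<bar> \<le> 1 + (\<bar>ln (cmod c)\<bar> + \<bar>ln (cmod a)\<bar>)" by simp
  also have "\<dots> \<le> (1 + \<bar>ln (cmod c)\<bar>) * (1 + \<bar>ln (cmod a)\<bar>)" by (simp add: algebra_simps)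
  finally have "(1 + \<bar>ln (cmod (c * a))\<bar>) ^ (2 * j) \<le> ((1 + \<bar>ln (cmod c)\<bar>) * (1 + \<bar>ln (cmod a)\<bar>)) ^ (2 * j)"
    by (intro power_mono) auto
  then have "(cmod (c * a))\<^sup>2 * (1 + \<bar>ln (cmod (c * a))\<bar>) ^ (2 * j) \<le>
      (cmod (c * a))\<^sup>2 * ((1 + \<bar>ln (cmod c)\<bar>) * (1 + \<bar>ln (cmod a)\<bar>)) ^ (2 * j)"
    by (intro mult_left_mono) auto
  then show ?thesis by (simp add: weight_def norm_mult power_mult_distrib mult_ac)
qed simp

lemma summable_weight_scale:
  assumes "summable (\<lambda>n. weight j (a n))"
  shows "summable (\<lambda>n. weight j (c * a n))"
proof (cases "c = 0")
  case False
  show ?thesis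
    by (rule summable_comparison_test'[OF summable_mult[OF assms], of 0])
      (use weight_scale[OF False] in \<open>auto\<close>)
qed simp

lemma summable_weight_bounded:
  assumes "summable (\<lambda>n. weight j (a n))"
  shows "\<exists>B. \<forall>n. cmod (a n) \<le> B"
proof -
  have "cmod (a n) \<le> sqrt (\<Sum>n. weight j (a n))" for n
  proof -
    have "weight j (a n) \<le> (\<Sum>n. weight j (a n))"
      using sum_le_suminf[OF assms, of "{n}"] by simp
    then have "(cmod (a n))\<^sup>2 \<le> (\<Sum>n. weight j (a n))" using weight_ge_square[of "a n" j] by linarith
    then show ?thesis by (rule real_le_rsqrt)
  qed
  then show ?thesis by blast
qed

text \<open>Associativity of the Cauchy product applied to exp (x + y) = exp x exp y. It is used
  with x and y the logarithms of the inner and outer factors of a test vector.\<close>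

lemma exponential_convolution:
  fixes c :: "nat \<Rightarrow> complex"
  assumes "i \<le> 2"
  shows "(\<Sum>l\<le>i. c l * ((x + y) ^ (i - l) / fact (i - l))) =
    (\<Sum>p\<le>i. (\<Sum>l\<le>p. c l * (x ^ (p - l) / fact (p - l))) * (y ^ (i - p) / fact (i - p)))"
proof -
  have "i = 0 \<or> i = 1 \<or> i = 2" using assms by linarith
  then show ?thesis by (auto simp: numeral_2_eq_2 field_simps power2_eq_square)
qed

lemma cnj_sgn_mult: "cnj (sgn c) * c = of_real (cmod c)"
proof (cases "c = 0")
  case False
  have "cnj (sgn c) * c = c * cnj c / of_real (cmod c)" by (simp add: sgn_eq mult.commute)
  also have "\<dots> = of_real (cmod c)"
    using False by (simp add: power2_eq_square flip: complex_norm_square)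
  finally show ?thesis .
qed simp

text \<open>The test vector is a product, b n on the n-th block times v n inside it, so its l2 norm
  is at most 1. Logarithms of products add, whence the global test splits into the tests of the
  single blocks convolved with powers of ln (b n). The phases of the coefficients are cancelled by
  \<epsilon>.\<close>

lemma block_sum_test:
  fixes U :: "nat \<Rightarrow> zspace" and a :: "nat \<Rightarrow> complex" and b :: "nat \<Rightarrow> real"
  assumes bl: "blocks A U" and i: "i \<le> 2"
    and v: "\<And>n k. v n k \<ge> 0" "\<And>n. (\<Sum>k\<in>A n. (v n k)\<^sup>2) \<le> 1" and \<eta>: "\<And>n k. cmod (\<eta> n k) \<le> 1"
    and b: "\<And>n. b n \<ge> 0" "(\<Sum>n<N. (b n)\<^sup>2) \<le> 1"
  shows "cmod (\<Sum>n<N. of_real (cmod (a n) * b n) *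
      (\<Sum>p\<le>i. test (\<eta> n) (v n) (A n) p (U n) * (of_real (- 2 * ln (b n)) ^ (i - p) / fact (i - p))))
    \<le> 4 * norm (\<Sum>n<N. cs (a n) (U n))"
proof -
  define S where "S = (\<Sum>n<N. cs (a n) (U n))"
  have fin: "finite (A n)" for n using bl by (simp add: blocks_def)
  have dj: "A n \<inter> A l = {}" if "n \<noteq> l" for n l
    using bl that by (auto simp: blocks_def disjoint_family_on_def)
  have off: "co (U n) l k = 0" if "l \<le> 2" "k \<notin> A n" for n l k using bl that by (simp add: blocks_def)
  define ix where "ix k = (THE n. k \<in> A n)" for k
  have ix: "ix k = n" if "k \<in> A n" for k n
    unfolding ix_def using that dj by (intro the_equality) blast+
  define u where "u k = b (ix k) * v (ix k) k" for k
  define \<epsilon> where "\<epsilon> k = cnj (sgn (a (ix k))) * \<eta> (ix k) k" for k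
  have usum: "(\<Sum>k\<in>(\<Union>n<N. A n). g k) = (\<Sum>n<N. \<Sum>k\<in>A n. g k)" for g :: "nat \<Rightarrow> 'c::comm_monoid_add"
    using fin dj by (subst sum.UNION_disjoint) auto
  have "cmod (test \<epsilon> u (\<Union>n<N. A n) i S) \<le> 4 * norm S"
  proof (rule test_bound[OF _ i])
    show "finite (\<Union>n<N. A n)" using fin by auto
    have "cmod (cnj (sgn (a (ix k)))) \<le> 1" for k by (simp add: norm_sgn)
    then show "cmod (\<epsilon> k) \<le> 1" for k
      unfolding \<epsilon>_def norm_mult using \<eta>[of "ix k" k] by (intro mult_le_one) auto
    show "0 \<le> u k" for k by (simp add: u_def b v)
    have "(\<Sum>k\<in>(\<Union>n<N. A n). (u k)\<^sup>2) = (\<Sum>n<N. (b n)\<^sup>2 * (\<Sum>k\<in>A n. (v n k)\<^sup>2))"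
      unfolding usum sum_distrib_left by (intro sum.cong refl) (simp add: u_def ix power_mult_distrib)
    also have "\<dots> \<le> (\<Sum>n<N. (b n)\<^sup>2 * 1)" using v(2) by (intro sum_mono mult_left_mono) auto
    finally show "(\<Sum>k\<in>(\<Union>n<N. A n). (u k)\<^sup>2) \<le> 1" using b(2) by simp
  qed
  moreover have "test \<epsilon> u (\<Union>n<N. A n) i S = (\<Sum>n<N. of_real (cmod (a n) * b n) *
      (\<Sum>p\<le>i. test (\<eta> n) (v n) (A n) p (U n) * (of_real (- 2 * ln (b n)) ^ (i - p) / fact (i - p))))"
    unfolding test_def usum
  proof (intro sum.cong refl)
    fix n assume n: "n \<in> {..<N}"
    define y where "y = complex_of_real (- 2 * ln (b n))"
    define x where "x k = complex_of_real (- 2 * ln (v n k))" for k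
    have S: "co S l k = a n * co (U n) l k" if "k \<in> A n" "l \<le> 2" for l k
    proof -
      have "co S l k = (\<Sum>n'<N. if n' = n then a n * co (U n) l k else 0)"
        unfolding S_def co_sum using that off dj by (intro sum.cong refl) (auto, blast)
      then show ?thesis using n by simp
    qed
    have aa: "cnj (sgn (a n)) * a n = of_real (cmod (a n))"
      by (rule cnj_sgn_mult)
    have "(\<Sum>k\<in>A n. \<epsilon> k * u k * (\<Sum>l\<le>i. co S l k * (of_real (- 2 * ln (u k)) ^ (i - l) / fact (i - l)))) =
        (\<Sum>k\<in>A n. of_real (cmod (a n) * b n) * (\<Sum>p\<le>i. (\<eta> n k * v n k *
          (\<Sum>l\<le>p. co (U n) l k * (x k ^ (p - l) / fact (p - l)))) * (y ^ (i - p) / fact (i - p))))"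
    proof (intro sum.cong refl)
      fix k assume k: "k \<in> A n"
      have uk: "u k = b n * v n k" "\<epsilon> k = cnj (sgn (a n)) * \<eta> n k" using ix[OF k] by (simp_all add: u_def \<epsilon>_def)
      show "\<epsilon> k * u k * (\<Sum>l\<le>i. co S l k * (of_real (- 2 * ln (u k)) ^ (i - l) / fact (i - l))) =
        of_real (cmod (a n) * b n) * (\<Sum>p\<le>i. (\<eta> n k * v n k *
          (\<Sum>l\<le>p. co (U n) l k * (x k ^ (p - l) / fact (p - l)))) * (y ^ (i - p) / fact (i - p)))"
      \<comment> \<open>The logarithm is additive only on positive factors; in the other case u k =
        0 and both sides vanish.\<close>
      proof (cases "b n = 0 \<or> v n k = 0")
        case True
        then show ?thesis by (auto simp: uk)
      next
        case False
        then have "ln (u k) = ln (b n) + ln (v n k)" unfolding uk using b(1)[of n] v(1)[of n k] by (simp add: ln_mult)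
        then have l: "complex_of_real (- 2 * ln (u k)) = x k + y" by (simp add: x_def y_def algebra_simps)
        have "(\<Sum>l\<le>i. co S l k * ((x k + y) ^ (i - l) / fact (i - l))) =
            a n * (\<Sum>l\<le>i. co (U n) l k * ((x k + y) ^ (i - l) / fact (i - l)))"
          unfolding sum_distrib_left using S[OF k] i by (intro sum.cong refl) (simp add: mult_ac)
        also have "\<dots> = a n * (\<Sum>p\<le>i. (\<Sum>l\<le>p. co (U n) l k * (x k ^ (p - l) / fact (p - l))) * (y ^ (i - p) / fact (i - p)))"
          by (subst exponential_convolution[OF i]) simp
        finally have "\<epsilon> k * u k * (\<Sum>l\<le>i. co S l k * (of_real (- 2 * ln (u k)) ^ (i - l) / fact (i - l))) =
          (cnj (sgn (a n)) * a n) * b n * (\<eta> n k * v n k *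
            (\<Sum>p\<le>i. (\<Sum>l\<le>p. co (U n) l k * (x k ^ (p - l) / fact (p - l))) * (y ^ (i - p) / fact (i - p))))"
          unfolding l unfolding uk by (simp add: mult_ac)
        then show ?thesis unfolding aa by (simp add: sum_distrib_left mult_ac)
      qed
    qed
    also have "\<dots> = of_real (cmod (a n) * b n) * (\<Sum>p\<le>i. (\<Sum>k\<in>A n. \<eta> n k * v n k *
          (\<Sum>l\<le>p. co (U n) l k * (x k ^ (p - l) / fact (p - l)))) * (y ^ (i - p) / fact (i - p)))"
      unfolding sum_distrib_left[symmetric] sum_distrib_right by (subst sum.swap) simp
    finally show "(\<Sum>k\<in>A n. \<epsilon> k * u k * (\<Sum>l\<le>i. co S l k * (of_real (- 2 * ln (u k)) ^ (i - l) / fact (i - l)))) =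
      of_real (cmod (a n) * b n) * (\<Sum>p\<le>i. (\<Sum>k\<in>A n. \<eta> n k * v n k *
          (\<Sum>l\<le>p. co (U n) l k * (of_real (- 2 * ln (v n k)) ^ (p - l) / fact (p - l)))) * (of_real (- 2 * ln (b n)) ^ (i - p) / fact (i - p)))"
      unfolding x_def y_def .
  qed
  ultimately show ?thesis by (simp add: S_def)
qed

text \<open>The sum is a polynomial in L of degree at most 2 - m whose top coefficient is at least
  \<delta>. Lower terms cost a constant: for m = 0 the linear term is absorbed by completing the
  square, which produces B^2 / \<delta>.\<close>

lemma leading_term_lower:
  fixes \<theta> :: "nat \<Rightarrow> complex"
  assumes m: "m \<le> 2" and lead: "\<theta> m = of_real \<rho>" "\<rho> \<ge> \<delta>" "\<delta> > 0"
    and low: "\<And>p. p < m \<Longrightarrow> \<theta> p = 0" and B: "\<And>p. p \<le> 2 \<Longrightarrow> cmod (\<theta> p) \<le> B" and L: "L \<ge> 0"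
  shows "\<delta> * L ^ (2 - m) - (B + B\<^sup>2 / \<delta>) \<le>
    Re (\<Sum>p\<le>2. \<theta> p * (of_real (2 * L) ^ (2 - p) / fact (2 - p)))"
proof -
  have B0: "B \<ge> 0" using B[of 0] norm_ge_zero order_trans by (metis zero_le)
  have r: "- B \<le> Re (\<theta> p)" if "p \<le> 2" for p
    using B[OF that] abs_Re_le_cmod[of "\<theta> p"] by linarith
  have q: "0 \<le> B\<^sup>2 / \<delta>" using lead by simp
  have sum: "Re (\<Sum>p\<le>2. \<theta> p * (of_real (2 * L) ^ (2 - p) / fact (2 - p))) =
      Re (\<theta> 0) * (2 * L\<^sup>2) + Re (\<theta> 1) * (2 * L) + Re (\<theta> 2)"
    by (simp add: numeral_2_eq_2 power2_eq_square)
  consider "m = 0" | "m = 1" | "m = 2" using m by linarith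
  then show ?thesis
  proof cases
    case 1
    have "0 \<le> (\<delta> * L - B)\<^sup>2 / \<delta>" using lead by simp
    also have "\<dots> = \<delta> * L\<^sup>2 - 2 * B * L + B\<^sup>2 / \<delta>"
      using lead by (simp add: power2_eq_square field_simps)
    finally have 2: "0 \<le> \<delta> * L\<^sup>2 - 2 * B * L + B\<^sup>2 / \<delta>" .
    have "\<delta> * (2 * L\<^sup>2) \<le> Re (\<theta> 0) * (2 * L\<^sup>2)" using lead 1 by (intro mult_right_mono) auto
    moreover have "- B * (2 * L) \<le> Re (\<theta> 1) * (2 * L)" using r[of 1] L by (intro mult_right_mono) auto
    moreover have "\<delta> * (2 * L\<^sup>2) = 2 * (\<delta> * L\<^sup>2)" "- B * (2 * L) = - (2 * B * L)" by simp_all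
    moreover have "\<delta> * L ^ (2 - m) = \<delta> * L\<^sup>2" using 1 by simp
    ultimately show ?thesis unfolding sum using 2 r[of 2] by linarith
  next
    case 2
    have "\<delta> * (2 * L) \<le> Re (\<theta> 1) * (2 * L)" using lead 2 L by (intro mult_right_mono) auto
    moreover have "0 \<le> \<delta> * L" using lead L by simp
    ultimately show ?thesis unfolding sum using 2 low[of 0] r[of 2] q by simp
  next
    case 3
    then have "\<delta> * L ^ (2 - m) = \<delta>" by simp
    moreover have "Re (\<theta> 0) * (2 * L\<^sup>2) + Re (\<theta> 1) * (2 * L) + Re (\<theta> 2) = \<rho>"
      using 3 low[of 0] low[of 1] lead by simp
    ultimately show ?thesis unfolding sum using lead q B0 by linarith
  qed
qed

text \<open>Recovers \<kappa> = 1 - ln |a| from the logarithm of a dual coefficient proportional to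
  |a| \<kappa>^j, which falls short of it by j ln \<kappa>. The tangent inequality at 4 gives ln
  \<kappa> at most \<kappa>/4 + 2, so for j at most 2 the loss is at most \<kappa>/2 + 4 and
  \<kappa> is at most 10 (1 + L).\<close>

lemma weight_factor_bound:
  fixes \<kappa> :: real
  assumes "\<kappa> \<ge> 1" "j \<le> 2" "L \<ge> 0" "\<kappa> - 1 - j * ln \<kappa> \<le> L"
  shows "\<kappa> ^ j \<le> 200 * (1 + L ^ j)"
proof -
  have "ln (\<kappa> / 4) \<le> \<kappa> / 4 - 1" using assms by (intro ln_le_minus_one) auto
  moreover have "ln 4 \<le> (4 - 1 :: real)" by (rule ln_le_minus_one) simp
  moreover have "ln (\<kappa> / 4) = ln \<kappa> - ln 4" using assms by (simp add: ln_div)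
  ultimately have "ln \<kappa> \<le> \<kappa> / 4 + 2" by linarith
  moreover have "real j * ln \<kappa> \<le> 2 * ln \<kappa>" using assms by (intro mult_right_mono) auto
  ultimately have "\<kappa> \<le> 10 * (1 + L)" using assms by argo
  then have "\<kappa> ^ j \<le> (10 * (1 + L)) ^ j" using assms by (intro power_mono) auto
  also have "\<dots> \<le> 200 * (1 + L ^ j)"
  proof -
    consider "j = 0" | "j = 1" | "j = 2" using assms by linarith
    then show ?thesis
    proof cases
      case 3
      have "0 \<le> (1 - L)\<^sup>2" by simp
      then have "2 * L \<le> 1 + L\<^sup>2" by (simp add: power2_eq_square algebra_simps)
      then show ?thesis using 3 by (simp add: power2_eq_square algebra_simps)
    qed (use assms in auto)
  qed
  finally show ?thesis .
qed

section \<open>Lower estimates for blocks with nondegenerate leading coefficients\<close>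

context
  fixes A :: "nat \<Rightarrow> nat set" and U :: "nat \<Rightarrow> zspace" and m :: nat and M \<delta> :: real
  assumes bl: "blocks A U" and m: "m \<le> 2" and lev: "\<And>n. level m (U n)"
    and M: "\<And>n. norm (U n) \<le> M" and \<delta>: "\<delta> > 0"
    and lead: "\<And>n. \<delta> \<le> sqrt (\<Sum>k\<in>A n. (cmod (co (U n) m k))\<^sup>2)"
begin

text \<open>Each block is tested against its own normalised coefficient vector of order m, so its
  test value is 0 below order m and equals the l2 norm \<rho> n at order m. Testing the sum at order
  m gives the first estimate. Testing at order 2 gives the second, in which the first absorbs the
  lower-order constant C.\<close>

lemma block_dual:
  assumes K: "norm (\<Sum>n<N. cs (a n) (U n)) \<le> K"
    and b: "\<And>n. 0 \<le> b n" "(\<Sum>n<N. (b n)\<^sup>2) \<le> 1"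
  shows "(\<Sum>n<N. cmod (a n) * b n) \<le> 4 * K / \<delta>"
    and "(\<Sum>n<N. cmod (a n) * b n * \<bar>ln (b n)\<bar> ^ (2 - m)) \<le>
      (4 * K + (4 * M + (4 * M)\<^sup>2 / \<delta>) * (4 * K / \<delta>)) / \<delta>"
proof -
  define \<rho> where "\<rho> n = sqrt (\<Sum>k\<in>A n. (cmod (co (U n) m k))\<^sup>2)" for n
  have \<rho>1: "\<rho> n \<ge> \<delta>" for n using lead[of n] by (simp add: \<rho>_def)
  have \<rho>: "\<rho> n \<ge> \<delta>" "\<rho> n > 0" for n using \<rho>1[of n] \<delta> by simp_all
  have \<rho>2: "(\<rho> n)\<^sup>2 = (\<Sum>k\<in>A n. (cmod (co (U n) m k))\<^sup>2)" for n by (simp add: \<rho>_def sum_nonneg)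
  define v where "v n k = cmod (co (U n) m k) / \<rho> n" for n k
  define \<eta> where "\<eta> n k = cnj (sgn (co (U n) m k))" for n k
  define \<theta> where "\<theta> n p = test (\<eta> n) (v n) (A n) p (U n)" for n p
  have fin: "finite (A n)" for n using bl by (simp add: blocks_def)
  have v0: "v n k \<ge> 0" for n k using \<rho>(2)[of n] by (simp add: v_def)
  have v1: "(\<Sum>k\<in>A n. (v n k)\<^sup>2) \<le> 1" for n
    using \<rho>(2)[of n] by (simp add: v_def power_divide flip: sum_divide_distrib \<rho>2)
  have \<eta>1: "cmod (\<eta> n k) \<le> 1" for n k by (simp add: \<eta>_def norm_sgn)
  have \<theta>B: "cmod (\<theta> n p) \<le> 4 * M" if "p \<le> 2" for n p
  proof -
    have "cmod (\<theta> n p) \<le> 4 * norm (U n)"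
      unfolding \<theta>_def by (rule test_bound[OF fin that \<eta>1 v0 v1])
    then show ?thesis using M[of n] by linarith
  qed
  have \<theta>0: "\<theta> n p = 0" if "p < m" for n p
    using lev[of n] that unfolding \<theta>_def test_def level_def by (intro sum.neutral ballI) simp
  have \<theta>m: "\<theta> n m = of_real (\<rho> n)" for n
  proof -
    have "(\<Sum>l\<le>m. co (U n) l k * (of_real (- 2 * ln (v n k)) ^ (m - l) / fact (m - l))) = co (U n) m k" for k
    proof -
      have "(\<Sum>l\<le>m. co (U n) l k * (of_real (- 2 * ln (v n k)) ^ (m - l) / fact (m - l))) =
          (\<Sum>l\<le>m. if l = m then co (U n) m k else 0)"
        using lev[of n] by (intro sum.cong refl) (auto simp: level_def)
      then show ?thesis by simp
    qed
    then have "\<theta> n m = (\<Sum>k\<in>A n. \<eta> n k * v n k * co (U n) m k)" by (simp add: \<theta>_def test_def)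
    also have "\<dots> = (\<Sum>k\<in>A n. of_real ((cmod (co (U n) m k))\<^sup>2 / \<rho> n))"
    proof (intro sum.cong refl)
      fix k
      have "\<eta> n k * v n k * co (U n) m k = (cnj (sgn (co (U n) m k)) * co (U n) m k) * v n k"
        by (simp add: \<eta>_def mult_ac)
      then show "\<eta> n k * v n k * co (U n) m k = of_real ((cmod (co (U n) m k))\<^sup>2 / \<rho> n)"
        by (simp add: cnj_sgn_mult v_def power2_eq_square)
    qed
    also have "\<dots> = of_real ((\<rho> n)\<^sup>2 / \<rho> n)" by (simp add: \<rho>2 sum_divide_distrib)
    finally show ?thesis using \<rho>(2)[of n] by (simp add: power2_eq_square)
  qed
  have main: "cmod (\<Sum>n<N. of_real (cmod (a n) * b n) *
      (\<Sum>p\<le>i. \<theta> n p * (of_real (- 2 * ln (b n)) ^ (i - p) / fact (i - p)))) \<le> 4 * K" if "i \<le> 2" for i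
    using block_sum_test[where v = v and \<eta> = \<eta> and a = a, OF bl that v0 v1 \<eta>1 b] K unfolding \<theta>_def by linarith
  have "(\<Sum>p\<le>m. \<theta> n p * (of_real (- 2 * ln (b n)) ^ (m - p) / fact (m - p))) = of_real (\<rho> n)" for n
  proof -
    have "(\<Sum>p\<le>m. \<theta> n p * (of_real (- 2 * ln (b n)) ^ (m - p) / fact (m - p))) =
        (\<Sum>p\<le>m. if p = m then of_real (\<rho> n) else 0)"
      using \<theta>0 \<theta>m by (intro sum.cong refl) auto
    then show ?thesis by simp
  qed
  then have "cmod (of_real (\<Sum>n<N. cmod (a n) * b n * \<rho> n)) \<le> 4 * K"
    using main[OF m] by simp
  then have *: "(\<Sum>n<N. cmod (a n) * b n * \<rho> n) \<le> 4 * K" unfolding norm_of_real by linarith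
  have "\<delta> * (\<Sum>n<N. cmod (a n) * b n) \<le> (\<Sum>n<N. cmod (a n) * b n * \<rho> n)"
    unfolding sum_distrib_left
  proof (rule sum_mono)
    fix n
    have "cmod (a n) * b n * \<delta> \<le> cmod (a n) * b n * \<rho> n"
      by (intro mult_left_mono \<rho> mult_nonneg_nonneg b) auto
    then show "\<delta> * (cmod (a n) * b n) \<le> cmod (a n) * b n * \<rho> n" by (simp only: mult.commute[of \<delta>])
  qed
  with * show first: "(\<Sum>n<N. cmod (a n) * b n) \<le> 4 * K / \<delta>"
    using \<delta> by (simp add: field_simps)
  define C where "C = 4 * M + (4 * M)\<^sup>2 / \<delta>"
  have "0 \<le> norm (U 0)" by simp
  then have "0 \<le> M" using M[of 0] by linarith
  then have C0: "C \<ge> 0" using \<delta> by (simp add: C_def)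
  have b1: "b n \<le> 1" if "n < N" for n
  proof -
    have "(b n)\<^sup>2 \<le> (\<Sum>n<N. (b n)\<^sup>2)" using that by (intro member_le_sum) auto
    then have "(b n)\<^sup>2 \<le> 1" using b(2) by linarith
    then show ?thesis using b(1)[of n] by (simp add: power_le_one_iff)
  qed
  have each: "cmod (a n) * b n * (\<delta> * \<bar>ln (b n)\<bar> ^ (2 - m) - C) \<le>
      Re (of_real (cmod (a n) * b n) * (\<Sum>p\<le>2. \<theta> n p * (of_real (- 2 * ln (b n)) ^ (2 - p) / fact (2 - p))))"
    if n: "n < N" for n
  proof (cases "b n = 0")
    case False
    then have "ln (b n) \<le> 0" using b(1)[of n] b1[OF n] by simp
    then have l: "- 2 * ln (b n) = 2 * \<bar>ln (b n)\<bar>" by simp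
    have "\<delta> * \<bar>ln (b n)\<bar> ^ (2 - m) - C \<le>
        Re (\<Sum>p\<le>2. \<theta> n p * (of_real (2 * \<bar>ln (b n)\<bar>) ^ (2 - p) / fact (2 - p)))"
      unfolding C_def
      by (rule leading_term_lower[where \<theta> = "\<theta> n", OF m \<theta>m \<rho>(1) \<delta>]) (use \<theta>0 \<theta>B in auto)
    then have "cmod (a n) * b n * (\<delta> * \<bar>ln (b n)\<bar> ^ (2 - m) - C) \<le> cmod (a n) * b n *
        Re (\<Sum>p\<le>2. \<theta> n p * (of_real (2 * \<bar>ln (b n)\<bar>) ^ (2 - p) / fact (2 - p)))"
      using b(1)[of n] by (intro mult_left_mono) auto
    also have "\<dots> = Re (of_real (cmod (a n) * b n) *
        (\<Sum>p\<le>2. \<theta> n p * (of_real (2 * \<bar>ln (b n)\<bar>) ^ (2 - p) / fact (2 - p))))"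
      by (simp only: scaleR_conv_of_real[symmetric] scaleR_complex.simps)
    finally show ?thesis unfolding l .
  qed simp
  have "(\<Sum>n<N. cmod (a n) * b n * (\<delta> * \<bar>ln (b n)\<bar> ^ (2 - m) - C)) \<le>
      Re (\<Sum>n<N. of_real (cmod (a n) * b n) *
        (\<Sum>p\<le>2. \<theta> n p * (of_real (- 2 * ln (b n)) ^ (2 - p) / fact (2 - p))))"
    unfolding Re_sum using each by (intro sum_mono) simp
  also have "\<dots> \<le> 4 * K" using main[of 2] complex_Re_le_cmod order_trans by blast
  finally have "(\<Sum>n<N. cmod (a n) * b n * (\<delta> * \<bar>ln (b n)\<bar> ^ (2 - m) - C)) \<le> 4 * K" .
  moreover have "(\<Sum>n<N. cmod (a n) * b n * (\<delta> * \<bar>ln (b n)\<bar> ^ (2 - m) - C)) =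
      \<delta> * (\<Sum>n<N. cmod (a n) * b n * \<bar>ln (b n)\<bar> ^ (2 - m)) - C * (\<Sum>n<N. cmod (a n) * b n)"
    by (simp add: sum_distrib_left algebra_simps sum_subtractf)
  moreover have "C * (\<Sum>n<N. cmod (a n) * b n) \<le> C * (4 * K / \<delta>)" by (intro mult_left_mono first C0)
  ultimately have "\<delta> * (\<Sum>n<N. cmod (a n) * b n * \<bar>ln (b n)\<bar> ^ (2 - m)) \<le> 4 * K + C * (4 * K / \<delta>)" by linarith
  then show "(\<Sum>n<N. cmod (a n) * b n * \<bar>ln (b n)\<bar> ^ (2 - m)) \<le>
      (4 * K + (4 * M + (4 * M)\<^sup>2 / \<delta>) * (4 * K / \<delta>)) / \<delta>"
    unfolding C_def using \<delta> by (simp add: field_simps)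
qed

text \<open>The dual vector is the optimal one in l2 for the sequence |a| \<kappa>^j: pairing with
  it returns the square root of the weight sum S. Since \<kappa>^j is controlled by 1 + |ln b|^j,
  the two estimates of \<open>block_dual\<close> bound this root by D, independently of N.\<close>

lemma block_lower_small:
  assumes K: "\<And>N. norm (\<Sum>n<N. cs (a n) (U n)) \<le> K" and a: "\<And>n. cmod (a n) \<le> 1"
  shows "summable (\<lambda>n. weight (2 - m) (a n))"
proof -
  define j where "j = 2 - m"
  define D where "D = 200 * (4 * K / \<delta> + (4 * K + (4 * M + (4 * M)\<^sup>2 / \<delta>) * (4 * K / \<delta>)) / \<delta>)"
  define \<kappa> where "\<kappa> n = 1 + \<bar>ln (cmod (a n))\<bar>" for n
  have w: "weight j (a n) = (cmod (a n) * \<kappa> n ^ j)\<^sup>2" for n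
    by (simp add: weight_def \<kappa>_def power_mult_distrib power_mult[symmetric] mult.commute[of j])
  have "(\<Sum>n<N. weight j (a n)) \<le> max 1 (D\<^sup>2)" for N
  proof (cases "(\<Sum>n<N. weight j (a n)) \<le> 1")
    case False
    define S where "S = (\<Sum>n<N. weight j (a n))"
    \<comment> \<open>With S above 1 the normalisation only lowers ln (b n), which is the sign
      needed to bound \<kappa> through |ln (b n)|; smaller sums need no estimate.\<close>
    have S: "S > 1" using False by (simp add: S_def)
    define b where "b n = cmod (a n) * \<kappa> n ^ j / sqrt S" for n
    have b0: "b n \<ge> 0" for n using S by (simp add: b_def \<kappa>_def)
    have "(\<Sum>n<N. (b n)\<^sup>2) = S / S"
      unfolding b_def power_divide S_def sum_divide_distrib using S by (intro sum.cong refl) (simp add: w S_def)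
    then have b1: "(\<Sum>n<N. (b n)\<^sup>2) \<le> 1" using S by simp
    have est: "\<kappa> n ^ j * (cmod (a n) * b n) \<le> 200 * (1 + \<bar>ln (b n)\<bar> ^ j) * (cmod (a n) * b n)" for n
    proof (cases "a n = 0")
      case False
      then have an: "cmod (a n) > 0" by simp
      have k1: "\<kappa> n \<ge> 1" by (simp add: \<kappa>_def)
      have "ln (b n) = ln (cmod (a n)) + j * ln (\<kappa> n) - ln (sqrt S)"
        unfolding b_def using an k1 S by (simp add: ln_div ln_mult ln_realpow)
      moreover have "ln (sqrt S) \<ge> 0" using S by simp
      moreover have "\<kappa> n = 1 - ln (cmod (a n))" using a[of n] an by (simp add: \<kappa>_def)
      ultimately have "\<kappa> n - 1 - j * ln (\<kappa> n) \<le> \<bar>ln (b n)\<bar>" by linarith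
      then have "\<kappa> n ^ j \<le> 200 * (1 + \<bar>ln (b n)\<bar> ^ j)"
        by (intro weight_factor_bound k1) (simp_all add: j_def)
      then show ?thesis using b0[of n] by (intro mult_right_mono) auto
    qed simp
    have "sqrt S = S / sqrt S" using S by (simp add: real_div_sqrt)
    also have "\<dots> = (\<Sum>n<N. \<kappa> n ^ j * (cmod (a n) * b n))"
      unfolding S_def w sum_divide_distrib by (intro sum.cong refl) (simp add: b_def S_def w power2_eq_square)
    also have "\<dots> \<le> (\<Sum>n<N. 200 * (1 + \<bar>ln (b n)\<bar> ^ j) * (cmod (a n) * b n))"
      by (intro sum_mono est)
    also have "\<dots> = 200 * ((\<Sum>n<N. cmod (a n) * b n) + (\<Sum>n<N. cmod (a n) * b n * \<bar>ln (b n)\<bar> ^ j))"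
      by (simp add: sum_distrib_left algebra_simps sum.distrib)
    also have "\<dots> \<le> D"
      unfolding D_def j_def by (intro mult_left_mono add_mono block_dual[OF K b0 b1]) simp
    finally have "(sqrt S)\<^sup>2 \<le> D\<^sup>2" using S by (intro power_mono) auto
    then show ?thesis using S by (simp add: S_def)
  qed simp
  then show ?thesis unfolding j_def by (intro summableI_nonneg_bounded) auto
qed

lemma block_lower:
  assumes K: "\<And>N. norm (\<Sum>n<N. cs (a n) (U n)) \<le> K"
  shows "summable (\<lambda>n. weight (2 - m) (a n))"
proof -
  have "K \<ge> 0" using K[of 0] by simp
  define R where "R = max 1 (4 * K / \<delta>)"
  have R: "R > 0" by (simp add: R_def)
  have "cmod (a n) \<le> R" for n
  proof -
    \<comment> \<open>A unit vector as b isolates one coefficient; the resulting uniform bound R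
      allows scaling to modulus at most 1.\<close>
    have "(\<Sum>l<Suc n. cmod (a l) * (if l = n then 1 else 0)) \<le> 4 * K / \<delta>"
      by (rule block_dual(1)[OF K]) (auto simp: if_distrib[of "\<lambda>x. x\<^sup>2"] cong: if_cong)
    then show ?thesis by (simp add: R_def if_distrib[of "\<lambda>x. _ * x"] cong: if_cong)
  qed
  then have a: "cmod (1 / of_real R * a n) \<le> 1" for n using R by (simp add: norm_divide divide_le_eq)
  have "norm (\<Sum>n<N. cs (1 / of_real R * a n) (U n)) \<le> 1 / R * K" for N
  proof -
    have "(\<Sum>n<N. cs (1 / of_real R * a n) (U n)) = cs (1 / of_real R) (\<Sum>n<N. cs (a n) (U n))"
      by (simp add: cs_sum)
    also have "norm \<dots> = 1 / R * norm (\<Sum>n<N. cs (a n) (U n))" using R by (simp add: norm_divide)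
    also have "\<dots> \<le> 1 / R * K" using R K by (intro mult_left_mono) auto
    finally show ?thesis .
  qed
  from block_lower_small[OF this a] have "summable (\<lambda>n. weight (2 - m) (of_real R * (1 / of_real R * a n)))"
    by (rule summable_weight_scale)
  then show ?thesis using R by simp
qed

end

text \<open>\<open>block_upper\<close> wants total weight at most 1 and the weight is not
  homogeneous in general, so it is applied to a / q with q fixed by e. Scaling keeps the weights
  summable, hence late sections qualify.\<close>

lemma block_upper_summable:
  assumes bl: "blocks A U" and m: "m \<le> 2" and lev: "\<And>n. level m (U n)"
    and M: "\<And>n. norm (U n) \<le> M" and a: "summable (\<lambda>n. weight (2 - m) (a n))"
  shows "summable (\<lambda>n. cs (a n) (U n))"
  unfolding summable_Cauchy
proof (intro allI impI)
  fix e :: real assume e: "e > 0"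
  define M' where "M' = M + 1"
  have M': "norm (U n) < M'" for n using M[of n] by (simp add: M'_def)
  have M'0: "M' > 0" using M'[of 0] norm_ge_zero[of "U 0"] by linarith
  define q where "q = e / (2 * (16 * exp 7 * M'))"
  have q: "q > 0" using e M'0 by (simp add: q_def)
  have "summable (\<lambda>n. weight (2 - m) (1 / of_real q * a n))" by (rule summable_weight_scale[OF a])
  then obtain N where N: "\<And>p r. p \<ge> N \<Longrightarrow> norm (\<Sum>n=p..<r. weight (2 - m) (1 / of_real q * a n)) < 1"
    unfolding summable_Cauchy by (meson zero_less_one)
  have "norm (\<Sum>n=p..<r. cs (a n) (U n)) < e" if p: "p \<ge> N" for p r
  proof -
    have lev': "level (2 - (2 - m)) (U n)" for n using lev[of n] m by simp
    have "(\<Sum>n=p..<r. weight (2 - m) (1 / of_real q * a n)) \<le> 1"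
      using N[OF p, of r] by (simp add: abs_less_iff)
    then have "norm (\<Sum>n=p..<r. cs (1 / of_real q * a n) (U n)) \<le> 16 * exp 7 * M'"
      by (intro block_upper[OF bl _ lev' M']) auto
    then have "q * norm (\<Sum>n=p..<r. cs (1 / of_real q * a n) (U n)) \<le> q * (16 * exp 7 * M')"
      using q by (intro mult_left_mono) auto
    also have "q * (16 * exp 7 * M') = e / 2" using M'0 by (simp add: q_def)
    also have "q * norm (\<Sum>n=p..<r. cs (1 / of_real q * a n) (U n)) =
        norm (cs (of_real q) (\<Sum>n=p..<r. cs (1 / of_real q * a n) (U n)))" using q by simp
    also have "cs (of_real q) (\<Sum>n=p..<r. cs (1 / of_real q * a n) (U n)) = (\<Sum>n=p..<r. cs (a n) (U n))"
      using q by (simp add: cs_sum)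
    finally show ?thesis using e by simp
  qed
  then show "\<exists>N. \<forall>p\<ge>N. \<forall>r. norm (\<Sum>n=p..<r. cs (a n) (U n)) < e" by blast
qed

subsection \<open>Extracting a subsequence\<close>

text \<open>The lower half starts from bounded partial sums rather than convergence; this stronger
  form is also what \<open>boundedly_complete\<close> exploits.\<close>

definition governed :: "nat \<Rightarrow> (nat \<Rightarrow> zspace) \<Rightarrow> bool" where
  "governed j X \<longleftrightarrow>
    (\<forall>a K. (\<forall>N. norm (\<Sum>n<N. cs (a n) (X n)) \<le> K) \<longrightarrow> summable (\<lambda>n. weight j (a n))) \<and>
    (\<forall>a. summable (\<lambda>n. weight j (a n)) \<longrightarrow> summable (\<lambda>n. cs (a n) (X n)))"

text \<open>In both directions the coefficients are bounded, once because the vectors stay away from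
  0 and once by summability of the weights; the summable perturbation then contributes an absolutely
  convergent series.\<close>

lemma governed_perturb:
  assumes U: "governed j U" and sm: "summable (\<lambda>n. norm (X n - U n))"
    and \<delta>: "\<delta> > 0" "\<And>n. \<delta> \<le> norm (X n)"
  shows "governed j X"
  unfolding governed_def
proof (intro conjI allI impI)
  fix a K assume K: "\<forall>N. norm (\<Sum>n<N. cs (a n) (X n)) \<le> K"
  have an: "cmod (a n) \<le> 2 * K / \<delta>" for n
  proof -
    have "norm ((\<Sum>l<Suc n. cs (a l) (X l)) - (\<Sum>l<n. cs (a l) (X l))) \<le> K + K"
      by (intro order_trans[OF norm_triangle_ineq4] add_mono K[rule_format])
    then have "cmod (a n) * norm (X n) \<le> 2 * K" by simp
    moreover have "cmod (a n) * \<delta> \<le> cmod (a n) * norm (X n)" using \<delta> by (intro mult_left_mono) auto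
    ultimately show ?thesis using \<delta> by (simp add: field_simps)
  qed
  have K0: "0 \<le> 2 * K / \<delta>" using an[of 0] norm_ge_zero order_trans by blast
  have "norm (\<Sum>n<N. cs (a n) (U n)) \<le> K + 2 * K / \<delta> * (\<Sum>n. norm (X n - U n))" for N
  proof -
    have "(\<Sum>n<N. cs (a n) (U n)) = (\<Sum>n<N. cs (a n) (X n)) - (\<Sum>n<N. cs (a n) (X n - U n))"
      by (simp add: cs_distrib sum_subtractf)
    then have "norm (\<Sum>n<N. cs (a n) (U n)) \<le> norm (\<Sum>n<N. cs (a n) (X n)) + norm (\<Sum>n<N. cs (a n) (X n - U n))"
      by (simp add: norm_triangle_ineq4)
    also have "norm (\<Sum>n<N. cs (a n) (X n - U n)) \<le> (\<Sum>n<N. 2 * K / \<delta> * norm (X n - U n))"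
      using an by (intro sum_norm_le) (simp add: mult_right_mono del: times_divide_eq_left)
    also have "\<dots> \<le> 2 * K / \<delta> * (\<Sum>n. norm (X n - U n))"
      unfolding sum_distrib_left[symmetric] using sm K0 by (intro mult_left_mono sum_le_suminf) auto
    finally show ?thesis using K[rule_format, of N] by linarith
  qed
  then show "summable (\<lambda>n. weight j (a n))" using U unfolding governed_def by blast
next
  fix a assume a: "summable (\<lambda>n. weight j (a n))"
  then obtain B where B: "\<And>n. cmod (a n) \<le> B" using summable_weight_bounded by blast
  have "summable (\<lambda>n. cs (a n) (X n - U n))"
  proof (rule summable_comparison_test'[OF summable_mult[OF sm, of B], of 0])
    fix n show "norm (cs (a n) (X n - U n)) \<le> B * norm (X n - U n)"
      using B[of n] by (simp add: mult_right_mono)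
  qed
  moreover have "summable (\<lambda>n. cs (a n) (U n))" using U a by (simp add: governed_def)
  ultimately have "summable (\<lambda>n. cs (a n) (X n - U n) + cs (a n) (U n))" by (rule summable_add)
  then show "summable (\<lambda>n. cs (a n) (X n))" by (simp add: cs_distrib)
qed

lemma blocks_subseq:
  assumes "blocks A U" "strict_mono r"
  shows "blocks (\<lambda>n. A (r n)) (\<lambda>n. U (r n))"
  using assms unfolding blocks_def disjoint_family_on_def
  by (auto simp: strict_mono_eq)

text \<open>Induction on the number 3 - m of orders left, with blocks and bounds left free because
  raising the level changes them along a subsequence. At level 3 the lower bound \<delta> is
  contradicted.\<close>

theorem block_subsequence:
  assumes "blocks A U" "m \<le> 3" "\<And>n. level m (U n)" "\<And>n. norm (U n) \<le> M"
    "\<delta> > 0" "\<And>n. \<delta> \<le> norm (U n)"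
  shows "\<exists>r j. strict_mono r \<and> j \<le> 2 \<and> governed j (\<lambda>n. U (r n))"
  using assms
proof (induction "3 - m" arbitrary: m A U M \<delta>)
  case 0
  then have "m = 3" by simp
  then have "U 0 = 0" using 0(4)[of 0] by (intro zspace_eqI) (simp add: level_def)
  then show ?case using 0(6) 0(7)[of 0] by simp
next
  case (Suc d)
  note bl = Suc.prems(1) and lev = Suc.prems(3) and M = Suc.prems(4) and \<delta> = Suc.prems(5,6)
  have m: "m \<le> 2" using Suc.hyps(2) by simp
  define \<rho> where "\<rho> n = sqrt (\<Sum>k\<in>A n. (cmod (co (U n) m k))\<^sup>2)" for n
  have \<rho>0: "\<rho> n \<ge> 0" for n by (simp add: \<rho>_def sum_nonneg)
  show ?case
  proof (cases "\<rho> \<longlonglongrightarrow> 0")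
    case False
    then obtain e where e: "e > 0" "\<And>N. \<exists>n\<ge>N. \<not> \<rho> n < e"
      using \<rho>0 unfolding LIMSEQ_iff by auto
    then have "infinite {n. e \<le> \<rho> n}"
      unfolding infinite_nat_iff_unbounded_le by (force simp: not_less)
    then obtain r :: "nat \<Rightarrow> nat" where r: "strict_mono r" "\<And>n. e \<le> \<rho> (r n)"
      using infinite_enumerate by blast
    have "governed (2 - m) (\<lambda>n. U (r n))"
      unfolding governed_def
    proof (intro conjI allI impI)
      fix a K assume "\<forall>N. norm (\<Sum>n<N. cs (a n) (U (r n))) \<le> K"
      then show "summable (\<lambda>n. weight (2 - m) (a n))"
        using r(2) by (intro block_lower[OF blocks_subseq[OF bl r(1)] m lev M e(1)]) (auto simp: \<rho>_def)
    next
      fix a assume "summable (\<lambda>n. weight (2 - m) (a n))"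
      then show "summable (\<lambda>n. cs (a n) (U (r n)))"
        by (rule block_upper_summable[OF blocks_subseq[OF bl r(1)] m lev M])
    qed
    then show ?thesis using r(1) by (intro exI[of _ r] exI[of _ "2 - m"]) simp
  next
    case True
    have "\<exists>V. (\<forall>i\<le>2. \<forall>k. k \<notin> A n \<longrightarrow> co V i k = 0) \<and> (\<forall>i<m. \<forall>k. co V i k = 0) \<and>
      (\<forall>k\<in>A n. co V m k = co (U n) m k) \<and> norm V \<le> exp 6 * \<rho> n" for n
      unfolding \<rho>_def using bl by (intro exists_lift m) (simp add: blocks_def)
    then obtain V where V: "\<And>n i k. i \<le> 2 \<Longrightarrow> k \<notin> A n \<Longrightarrow> co (V n) i k = 0"
      "\<And>n i k. i < m \<Longrightarrow> co (V n) i k = 0" "\<And>n k. k \<in> A n \<Longrightarrow> co (V n) m k = co (U n) m k"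
      "\<And>n. norm (V n) \<le> exp 6 * \<rho> n" by metis
    \<comment> \<open>The tolerances are summable, as a perturbation requires, and at most
      \<delta>/2, so that removing the lifts keeps the remainders W above \<delta>/2.\<close>
    have "\<exists>N. \<forall>k\<ge>N. exp 6 * \<rho> k \<le> \<delta> / 2 * (1/2) ^ n" for n
    proof -
      have lim: "(\<lambda>k. exp 6 * \<rho> k) \<longlonglongrightarrow> 0" using True by (rule tendsto_mult_right_zero)
      have "eventually (\<lambda>k. exp 6 * \<rho> k < \<delta> / 2 * (1/2) ^ n) sequentially"
        by (rule order_tendstoD(2)[OF lim]) (use \<delta>(1) in simp)
      then show ?thesis unfolding eventually_sequentially by (meson less_imp_le)
    qed
    from exists_subsequence[where P = "\<lambda>n k. exp 6 * \<rho> k \<le> \<delta> / 2 * (1/2) ^ n", OF this] obtain r :: "nat \<Rightarrow> nat"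
      where r: "strict_mono r" "\<And>n. exp 6 * \<rho> (r n) \<le> \<delta> / 2 * (1/2) ^ n" by blast
    define W where "W n = U (r n) - V (r n)" for n
    have nV: "norm (V (r n)) \<le> \<delta> / 2 * (1/2) ^ n" for n using V(4) r(2) order_trans by blast
    have nV2: "norm (V (r n)) \<le> \<delta> / 2" for n
    proof -
      have "\<delta> / 2 * (1/2) ^ n \<le> \<delta> / 2 * 1" using \<delta>(1) by (intro mult_left_mono power_le_one) auto
      then show ?thesis using nV[of n] by linarith
    qed
    have offU: "co (U n) i k = 0" if "i \<le> 2" "k \<notin> A n" for n i k using bl that by (simp add: blocks_def)
    have "\<exists>r' j. strict_mono r' \<and> j \<le> 2 \<and> governed j (\<lambda>n. W (r' n))"
    proof (rule Suc.hyps(1))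
      show "d = 3 - Suc m" "Suc m \<le> 3" using Suc.hyps(2) by simp_all
      show "blocks (\<lambda>n. A (r n)) W"
        using blocks_subseq[OF bl r(1)] V(1) unfolding blocks_def W_def by simp
      show "level (Suc m) (W n)" for n
        unfolding level_def W_def less_Suc_eq
      proof (intro allI impI)
        fix i k assume "i < m \<or> i = m"
        then show "co (U (r n) - V (r n)) i k = 0"
          using lev[of "r n"] V offU m by (cases "k \<in> A (r n)") (auto simp: level_def)
      qed
      show "norm (W n) \<le> M + \<delta> / 2" for n
        unfolding W_def using norm_triangle_ineq4[of "U (r n)" "V (r n)"] M[of "r n"] nV2[of n] by linarith
      show "\<delta> / 2 > 0" using \<delta>(1) by simp
      show "\<delta> / 2 \<le> norm (W n)" for n
        unfolding W_def using norm_triangle_ineq2[of "U (r n)" "V (r n)"] \<delta>(2)[of "r n"] nV2[of n] by linarith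
    qed
    then obtain r' j where r': "strict_mono r'" "j \<le> 2" "governed j (\<lambda>n. W (r' n))" by blast
    have "governed j (\<lambda>n. U (r (r' n)))"
    proof (rule governed_perturb[OF r'(3) _ \<delta>(1)])
      have "norm (V (r (r' n))) \<le> \<delta> / 2 * (1/2) ^ n" for n
      proof -
        \<comment> \<open>A strictly increasing r' satisfies n \<le> r' n, so the geometric bound
          survives passage to the further subsequence.\<close>
        have "(1/2 :: real) ^ r' n \<le> (1/2) ^ n" using seq_suble[OF r'(1)] by (intro power_decreasing) auto
        then have "\<delta> / 2 * (1/2) ^ r' n \<le> \<delta> / 2 * (1/2) ^ n" using \<delta>(1) by (intro mult_left_mono) auto
        then show ?thesis using nV[of "r' n"] by linarith
      qed
      moreover have "U (r (r' n)) - W (r' n) = V (r (r' n))" for n by (simp add: W_def)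
      moreover have "summable (\<lambda>n. \<delta> / 2 * (1/2 :: real) ^ n)" by (intro summable_mult summable_geometric) simp
      ultimately show "summable (\<lambda>n. norm (U (r (r' n)) - W (r' n)))"
        by (rule_tac summable_comparison_test'[where g = "\<lambda>n. \<delta> / 2 * (1/2) ^ n" and N = 0]) simp_all
      show "\<delta> \<le> norm (U (r (r' n)))" for n by (rule \<delta>(2))
    qed
    then show ?thesis using r(1) r'(1,2)
      by (intro exI[of _ "r \<circ> r'"] exI[of _ j]) (auto intro: strict_mono_o)
  qed
qed

section \<open>Gliding humps and bounded completeness\<close>

lemma norm_finite_le:
  assumes K: "finite K" and off: "\<And>i k. i \<le> 2 \<Longrightarrow> k \<notin> K \<Longrightarrow> co U i k = 0"
  shows "norm U \<le> exp 6 * (\<Sum>k\<in>K. \<Sum>i\<le>2. cmod (co U i k))"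
proof -
  obtain V where V: "\<And>i k. i \<le> 2 \<Longrightarrow> co V i k = (if k \<in> K then co U i k else 0)"
    "norm V \<le> exp 6 * (\<Sum>k\<in>K. \<Sum>i\<le>2. cmod (co U i k))"
    using exists_finite_coefficients[OF K, of "co U"] by blast
  have "U = V" by (rule zspace_eqI) (use V(1) off in auto)
  then show ?thesis using V(2) by simp
qed

lemma tendsto_zero_finite_support:
  assumes K: "finite K" and off: "\<And>n i k. i \<le> 2 \<Longrightarrow> k \<notin> K \<Longrightarrow> co (U n) i k = 0"
    and lim: "\<And>i k. i \<le> 2 \<Longrightarrow> (\<lambda>n. co (U n) i k) \<longlonglongrightarrow> 0"
  shows "U \<longlonglongrightarrow> 0"
proof -
  have "(\<lambda>n. exp 6 * (\<Sum>k\<in>K. \<Sum>i\<le>2. cmod (co (U n) i k))) \<longlonglongrightarrow> 0"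
    by (intro tendsto_mult_right_zero tendsto_null_sum tendsto_norm_zero lim) simp
  then show ?thesis
    by (rule Lim_null_comparison[rotated]) (intro always_eventually allI norm_finite_le K off)
qed

text \<open>A gliding hump. For a fixed cut p, coordinatewise convergence makes the part before p
  small for late indices r; for the chosen r a cut q makes the part beyond it small; q is the next
  p. The state of the recursion is the triple (r, p, q).\<close>

lemma exists_block_approximation:
  assumes null: "\<And>i k. i \<le> 2 \<Longrightarrow> (\<lambda>n. co (X n) i k) \<longlonglongrightarrow> 0" and e: "\<And>n::nat. 0 < e n"
  shows "\<exists>r A B. strict_mono (r :: nat \<Rightarrow> nat) \<and> blocks A B \<and> (\<forall>n. norm (X (r n) - B n) \<le> e n) \<and>
    (\<forall>n. norm (B n) \<le> norm (X (r n)))"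
proof -
  define P where "P n = (\<lambda>(r, p, q). norm (pr {..<p} (X r)) \<le> e n / 2 \<and> p < q \<and> norm (X r - pr {..<q} (X r)) \<le> e n / 2)"
    for n :: nat
  define Q where "Q n = (\<lambda>(r, p :: nat, q) (r', p', q' :: nat). r < (r' :: nat) \<and> p' = (q :: nat))"
    for n :: nat
  have pre: "\<exists>q>p. norm (X r - pr {..<q} (X r)) \<le> e n / 2" for n p r
  proof -
    have "(\<lambda>q. X r - pr {..<q} (X r)) \<longlonglongrightarrow> X r - X r" by (intro tendsto_diff tendsto_const pr_tendsto)
    then have "(\<lambda>q. norm (X r - pr {..<q} (X r))) \<longlonglongrightarrow> 0" using tendsto_norm_zero by auto
    then have "eventually (\<lambda>q. norm (X r - pr {..<q} (X r)) < e n / 2 \<and> p < q) sequentially"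
      using e[of n] by (intro eventually_conj eventually_gt_at_top order_tendstoD(2)) auto
    from eventually_happens'[OF _ this] show ?thesis by (auto intro: less_imp_le)
  qed
  have small: "\<exists>r>r0. norm (pr {..<p} (X r)) \<le> e n / 2" for n p r0
  proof -
    have "(\<lambda>r. pr {..<p} (X r)) \<longlonglongrightarrow> 0"
    proof (rule tendsto_zero_finite_support[of "{..<p}"])
      fix i k :: nat assume "i \<le> 2"
      then show "(\<lambda>r. co (pr {..<p} (X r)) i k) \<longlonglongrightarrow> 0" using null[of i k] by (cases "k < p") simp_all
    qed auto
    then have "eventually (\<lambda>r. norm (pr {..<p} (X r)) < e n / 2 \<and> r0 < r) sequentially"
      using e[of n] by (intro eventually_conj eventually_gt_at_top order_tendstoD(2)[OF tendsto_norm_zero]) auto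
    from eventually_happens'[OF _ this] show ?thesis by (auto intro: less_imp_le)
  qed
  have step: "\<exists>y. P n y \<and> r0 < fst y \<and> fst (snd y) = p" for n r0 p
  proof -
    obtain r where r: "r > r0" "norm (pr {..<p} (X r)) \<le> e n / 2" using small by blast
    obtain q where "q > p" "norm (X r - pr {..<q} (X r)) \<le> e n / 2" using pre by blast
    then show ?thesis using r by (intro exI[of _ "(r, p, q)"]) (simp add: P_def)
  qed
  have "\<exists>f. \<forall>n. P n (f n) \<and> Q n (f n) (f (Suc n))"
  proof (rule dependent_nat_choice)
    show "\<exists>x. P 0 x" using step by blast
    fix x n
    show "\<exists>y. P (Suc n) y \<and> Q n x y"
    proof -
      obtain y where "P (Suc n) y" "fst x < fst y" "fst (snd y) = snd (snd x)" using step by blast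
      then show ?thesis by (intro exI[of _ y]) (auto simp: Q_def split: prod.splits)
    qed
  qed
  then obtain f where f: "\<And>n. P n (f n)" "\<And>n. Q n (f n) (f (Suc n))" by blast
  define r p q where "r n = fst (f n)" and "p n = fst (snd (f n))" and "q n = snd (snd (f n))" for n
  have fn: "f n = (r n, p n, q n)" for n by (simp add: r_def p_def q_def)
  have 1: "norm (pr {..<p n} (X (r n))) \<le> e n / 2" "p n < q n" "norm (X (r n) - pr {..<q n} (X (r n))) \<le> e n / 2"
    "r n < r (Suc n)" "p (Suc n) = q n" for n
    using f[of n] unfolding P_def Q_def fn by auto
  have sm: "strict_mono r" using 1(4) by (rule strict_monoI_Suc)
  have sp: "strict_mono p" using 1(2,5) by (intro strict_monoI_Suc) simp
  define B where "B n = pr {p n..<p (Suc n)} (X (r n))" for n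
  have "blocks (\<lambda>n. {p n..<p (Suc n)}) B"
    unfolding blocks_def disjoint_family_on_def
  proof (intro conjI allI ballI impI)
    fix m n :: nat assume "m \<noteq> n"
    then have "p (Suc m) \<le> p n \<or> p (Suc n) \<le> p m"
      using sp by (simp add: strict_mono_less_eq Suc_le_eq) linarith
    then show "{p m..<p (Suc m)} \<inter> {p n..<p (Suc n)} = {}" by auto
  qed (auto simp: B_def)
  moreover have "norm (X (r n) - B n) \<le> e n" for n
  proof -
    have eq: "X (r n) - B n = (X (r n) - pr {..<q n} (X (r n))) + pr {..<p n} (X (r n))"
      using 1(2)[of n] by (intro zspace_eqI) (auto simp: B_def 1(5))
    show ?thesis
      unfolding eq
      using norm_triangle_ineq[of "X (r n) - pr {..<q n} (X (r n))" "pr {..<p n} (X (r n))"] 1(1,3)[of n]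
      by linarith
  qed
  moreover have "norm (B n) \<le> norm (X (r n))" for n unfolding B_def by (rule norm_pr_le)
  ultimately show ?thesis using sm by blast
qed

text \<open>A non-Cauchy sequence of partial sums would contain blocks bounded below whose sums stay
  bounded, contradicting that the governing weights of a constant sequence are not summable.\<close>

lemma boundedly_complete:
  fixes c :: "nat \<Rightarrow> nat \<Rightarrow> complex"
  assumes V: "\<And>p i k. i \<le> 2 \<Longrightarrow> co (V p) i k = (if k < p then c i k else 0)" and M: "\<And>p. norm (V p) \<le> M"
  shows "\<exists>X. \<forall>i\<le>2. \<forall>k. co X i k = c i k"
proof -
  have "Cauchy V"
  proof (rule ccontr)
    assume "\<not> Cauchy V"
    then obtain \<delta> where \<delta>: "\<delta> > 0" "\<And>N. \<exists>m\<ge>N. \<exists>n\<ge>N. \<not> norm (V m - V n) < \<delta>"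
      unfolding Cauchy_iff by auto
    have step: "\<exists>m n. N \<le> m \<and> m < n \<and> \<delta> \<le> norm (V n - V m)" for N
    proof -
      obtain m n where mn: "m \<ge> N" "n \<ge> N" "\<not> norm (V m - V n) < \<delta>" using \<delta>(2) by blast
      then have "m \<noteq> n" using \<delta>(1) by auto
      then consider "m < n" | "n < m" by linarith
      then show ?thesis
      proof cases
        case 1
        then show ?thesis using mn norm_minus_commute[of "V m" "V n"] by - (rule exI[of _ m], rule exI[of _ n], auto simp: not_less)
      next
        case 2
        then show ?thesis using mn by - (rule exI[of _ n], rule exI[of _ m], auto simp: not_less)
      qed
    qed
    define P where "P x \<longleftrightarrow> fst x < snd x \<and> \<delta> \<le> norm (V (snd x) - V (fst x))" for x :: "nat \<times> nat"
    have "\<exists>f. \<forall>n::nat. P (f n) \<and> snd (f n) \<le> fst (f (Suc n))"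
    proof (rule dependent_nat_choice)
      show "\<exists>x. P x" using step[of 0] by (auto simp: P_def)
      fix x and n :: nat
      obtain m n' where "snd x \<le> m" "m < n'" "\<delta> \<le> norm (V n' - V m)" using step by blast
      then show "\<exists>y. P y \<and> snd x \<le> fst y" by (intro exI[of _ "(m, n')"]) (simp add: P_def)
    qed
    then obtain f where f: "\<And>n. P (f n)" "\<And>n. snd (f n) \<le> fst (f (Suc n))" by blast
    define p q where "p n = fst (f n)" and "q n = snd (f n)" for n
    have pq: "p n < q n" "\<delta> \<le> norm (V (q n) - V (p n))" "q n \<le> p (Suc n)" for n
      using f[of n] by (auto simp: P_def p_def q_def)
    have pmono: "strict_mono p" using pq(1,3) by (intro strict_monoI_Suc) (rule less_le_trans)
    define A where "A n = {p n..<q n}" for n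
    define D where "D n = V (q n) - V (p n)" for n
    have dj: "A m \<inter> A n = {}" if "m < n" for m n
    proof -
      have "p (Suc m) \<le> p n" using that pmono by (simp add: strict_mono_less_eq)
      then show ?thesis using pq(3)[of m] by (auto simp: A_def)
    qed
    have coD: "co (D n) i k = (if k \<in> A n then c i k else 0)" if "i \<le> 2" for n i k
      using pq(1)[of n] that by (auto simp: D_def A_def V)
    have bl: "blocks A D"
      unfolding blocks_def disjoint_family_on_def
    proof (intro conjI allI ballI impI)
      fix m n :: nat assume "m \<noteq> n"
      then show "A m \<inter> A n = {}" using dj[of m n] dj[of n m] by (metis inf_commute nat_neq_iff)
    qed (auto simp: coD, simp add: A_def)
    have nD: "norm (D n) \<le> 2 * M" for n
      unfolding D_def using norm_triangle_ineq4[of "V (q n)" "V (p n)"] M[of "p n"] M[of "q n"] by linarith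
    have lev: "level 0 (D n)" for n by (simp add: level_def)
    have "\<delta> \<le> norm (D n)" for n unfolding D_def by (rule pq)
    from block_subsequence[OF bl _ lev nD \<delta>(1) this]
    obtain r j where r: "strict_mono r" "governed j (\<lambda>n. D (r n))" by auto
    have "norm (\<Sum>n<N. cs 1 (D (r n))) \<le> M" for N
    proof -
      define L where "L = Max (insert 0 ((\<lambda>n. q (r n)) ` {..<N}))"
      have L: "q (r n) \<le> L" if "n < N" for n unfolding L_def using that by (intro Max_ge) auto
      \<comment> \<open>All these differences are cut out of one section V L, so their sum is a
        projection of it and inherits the bound M.\<close>
      have "(\<Sum>n<N. D (r n)) = pr (\<Union>n<N. A (r n)) (V L)"
      proof (rule zspace_eqI)
        fix i k :: nat assume i: "i \<le> 2"
        show "co (\<Sum>n<N. D (r n)) i k = co (pr (\<Union>n<N. A (r n)) (V L)) i k"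
        proof (cases "\<exists>n<N. k \<in> A (r n)")
          case True
          then obtain n where n: "n < N" "k \<in> A (r n)" by blast
          have "k \<notin> A (r l)" if "l \<noteq> n" for l
          proof -
            have "r l \<noteq> r n" using that r(1) by (simp add: strict_mono_eq)
            then show ?thesis using bl n(2) by (auto simp: blocks_def disjoint_family_on_def)
          qed
          then have "co (\<Sum>n<N. D (r n)) i k = (\<Sum>l<N. if l = n then c i k else 0)"
            unfolding co_sum using n(2) by (intro sum.cong refl) (auto simp: coD[OF i])
          moreover have "k < L" using n L[OF n(1)] by (auto simp: A_def)
          ultimately show ?thesis using n i by (auto simp: V)
        next
          case False
          then have "co (\<Sum>n<N. D (r n)) i k = 0"
            unfolding co_sum by (intro sum.neutral) (auto simp: coD[OF i])
          moreover have "k \<notin> (\<Union>n<N. A (r n))" using False by auto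
          ultimately show ?thesis using i by simp
        qed
      qed
      then show ?thesis by (simp add: order_trans[OF norm_pr_le M])
    qed
    then have "summable (\<lambda>n::nat. weight j 1)"
      using conjunct1[OF r(2)[unfolded governed_def], rule_format, of "\<lambda>n. 1" M] by simp
    then show False by (simp add: weight_def summable_const_iff)
  qed
  then obtain X where X: "V \<longlonglongrightarrow> X" using Cauchy_convergent_iff convergent_def by blast
  have "co X i k = c i k" if "i \<le> 2" for i k
  proof -
    have "eventually (\<lambda>p. co (V p) i k = c i k) sequentially"
      using eventually_gt_at_top[of k] by eventually_elim (simp add: V that)
    then have "(\<lambda>p. co (V p) i k) \<longlonglongrightarrow> c i k" by (rule tendsto_eventually)
    then show ?thesis using tendsto_co[OF X] LIMSEQ_unique by blast
  qed
  then show ?thesis by blast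
qed

section \<open>Basic sequences\<close>

definition expands :: "(nat \<Rightarrow> zspace) \<Rightarrow> (nat \<Rightarrow> complex) \<Rightarrow> zspace \<Rightarrow> bool" where
  "expands x a v \<longleftrightarrow> (\<lambda>n. cs (a n) (x n)) sums v"

lemma expands_diff: "expands x a v \<Longrightarrow> expands x b w \<Longrightarrow> expands x (\<lambda>n. a n - b n) (v - w)"
  unfolding expands_def cs_distrib by (rule sums_diff)

lemma bounded_linear_cs: "bounded_linear (cs c)" "bounded_linear (\<lambda>c. cs c U)"
proof -
  show "bounded_linear (cs c)"
    by (rule bounded_linear_intro[where K = "cmod c"])
      (auto simp: cs_distrib scaleR_zspace_def mult.commute)
  show "bounded_linear (\<lambda>c. cs c U)"
    by (rule bounded_linear_intro[where K = "norm U"])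
      (auto simp: cs_distrib scaleR_zspace_def scaleR_conv_of_real)
qed

lemma expands_cs: "expands x a v \<Longrightarrow> expands x (\<lambda>n. c * a n) (cs c v)"
  unfolding expands_def using bounded_linear.sums[OF bounded_linear_cs(1)] by fastforce

lemma expands_finite:
  assumes "finite F"
  shows "expands x (\<lambda>n. if n \<in> F then c n else 0) (\<Sum>n\<in>F. cs (c n) (x n))"
proof -
  have "(\<lambda>n. if n \<in> F then cs (c n) (x n) else 0) sums (\<Sum>n\<in>F. cs (c n) (x n))"
    by (rule sums_If_finite_set[OF assms])
  moreover have "(\<lambda>n. cs (if n \<in> F then c n else 0) (x n)) = (\<lambda>n. if n \<in> F then cs (c n) (x n) else 0)" by auto
  ultimately show ?thesis by (simp add: expands_def)
qed

definition lspan :: "(nat \<Rightarrow> zspace) \<Rightarrow> nat set \<Rightarrow> zspace set" where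
  "lspan x T = {\<Sum>n\<in>F. cs (c n) (x n) | F c. finite F \<and> F \<subseteq> T}"

context
  fixes x :: "nat \<Rightarrow> zspace"
  assumes nx: "\<And>n. norm (x n) = 1"
    and basic: "\<And>v. v \<in> closure (lspan x UNIV) \<Longrightarrow> \<exists>!a. expands x a v"
begin

definition expandable where "expandable = closure (lspan x UNIV)"

lemma expands_imp_expandable: "expands x a v \<Longrightarrow> v \<in> expandable"
proof -
  assume "expands x a v"
  then have "(\<lambda>N. \<Sum>n<N. cs (a n) (x n)) \<longlonglongrightarrow> v" by (simp add: expands_def sums_def)
  moreover have "(\<Sum>n<N. cs (a n) (x n)) \<in> lspan x UNIV" for N unfolding lspan_def by blast
  ultimately show ?thesis unfolding expandable_def closure_sequential
    by (intro exI[of _ "\<lambda>N. \<Sum>n<N. cs (a n) (x n)"]) simp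
qed

lemma expands_unique: "expands x a v \<Longrightarrow> expands x b v \<Longrightarrow> a = b"
  using basic expands_imp_expandable unfolding expandable_def by blast

lemma expandable_expands: "v \<in> expandable \<Longrightarrow> \<exists>a. expands x a v"
  using basic unfolding expandable_def by blast

section \<open>The basis constant\<close>

definition pbound :: "real \<Rightarrow> (nat \<Rightarrow> complex) \<Rightarrow> bool" where
  "pbound k a \<longleftrightarrow> (\<forall>N. norm (\<Sum>n<N. cs (a n) (x n)) \<le> k)"

definition controlled :: "real \<Rightarrow> zspace set" where
  "controlled k = {v. \<exists>a. expands x a v \<and> pbound k a}"

lemma pbound_diff: "pbound k a \<Longrightarrow> pbound l b \<Longrightarrow> pbound (k + l) (\<lambda>n. a n - b n)"
  unfolding pbound_def cs_distrib sum_subtractf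
  by (auto intro: order_trans[OF norm_triangle_ineq4] add_mono)

lemma pbound_cs: "pbound k a \<Longrightarrow> pbound (cmod c * k) (\<lambda>n. c * a n)"
  unfolding pbound_def by (simp flip: cs_simps(1) cs_sum add: mult_left_mono)

lemma expandable_diff: "v \<in> expandable \<Longrightarrow> w \<in> expandable \<Longrightarrow> v - w \<in> expandable"
  using expandable_expands expands_diff expands_imp_expandable by meson

lemma expandable_add: "v \<in> expandable \<Longrightarrow> w \<in> expandable \<Longrightarrow> v + w \<in> expandable"
  using expandable_diff[of v "- w"] expandable_diff[of 0 w] expandable_diff[of w w] by simp

lemma expandable_cs: "v \<in> expandable \<Longrightarrow> cs c v \<in> expandable"
  using expandable_expands expands_cs expands_imp_expandable by meson

text \<open>The Baire category theorem gives density of some \<open>controlled k\<close> in a ball, and successive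
  approximation removes the closure, as in the open mapping theorem.\<close>

lemma exists_dense_ball: "\<exists>k \<rho>. \<rho> > 0 \<and> k \<ge> 0 \<and> (\<forall>w\<in>expandable. norm w < \<rho> \<longrightarrow> w \<in> closure (controlled k))"
proof -
  have WkW: "closure (controlled k) \<subseteq> expandable" for k
  proof -
    have "controlled k \<subseteq> expandable" using expands_imp_expandable by (auto simp: controlled_def)
    then show ?thesis unfolding expandable_def by (simp add: closure_minimal)
  qed
  have cW: "closed expandable" by (simp add: expandable_def)
  have cm: "completely_metrizable_space (top_of_set expandable)"
    using cW completely_metrizable_space_closedin completely_metrizable_space_euclidean closed_closedin by blast
  have W0: "0 \<in> expandable" using expands_imp_expandable[of "\<lambda>n. 0" 0] by (simp add: expands_def)
  have un: "(\<Union>k. closure (controlled (real k))) = expandable"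
  proof (intro equalityI subsetI)
    fix v assume "v \<in> expandable"
    then obtain a where a: "expands x a v" using expandable_expands by blast
    then have "bounded (range (\<lambda>N. \<Sum>n<N. cs (a n) (x n)))"
      by (intro summable_imp_sums_bounded) (auto simp: expands_def summable_def)
    then obtain b where b: "\<And>N. norm (\<Sum>n<N. cs (a n) (x n)) \<le> b" unfolding bounded_iff by blast
    obtain k :: nat where "b \<le> real k" using real_arch_simple by blast
    then have "pbound (real k) a" unfolding pbound_def using b order_trans by blast
    then have "v \<in> controlled (real k)" using a by (auto simp: controlled_def)
    then show "v \<in> (\<Union>k. closure (controlled (real k)))" using closure_subset by blast
  qed (use WkW in blast)
  have "\<exists>k. top_of_set expandable interior_of closure (controlled (real k)) \<noteq> {}"
  proof (rule ccontr)
    assume "\<not> ?thesis"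
    then have "top_of_set expandable interior_of \<Union> (range (\<lambda>k. closure (controlled (real k)))) = {}"
      using cm WkW by (intro Baire_category_alt) (auto intro!: closed_subset)
    then have "top_of_set expandable interior_of expandable = {}" using un by simp
    then show False using W0 by (metis empty_iff interior_of_topspace topspace_euclidean_subtopology)
  qed
  then obtain k v where v: "v \<in> top_of_set expandable interior_of closure (controlled (real k))" by blast
  then obtain T where T: "openin (top_of_set expandable) T" "v \<in> T" "T \<subseteq> closure (controlled (real k))"
    by (auto simp: interior_of_def)
  then have vW: "v \<in> expandable" using WkW by blast
  from T(1,2) obtain \<rho> where \<rho>: "\<rho> > 0" "ball v \<rho> \<inter> expandable \<subseteq> T" unfolding openin_contains_ball by blast
  have "w \<in> closure (controlled (2 * real k))" if w: "w \<in> expandable" "norm w < \<rho>" for w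
  proof -
    have 1: "v + w \<in> closure (controlled (real k))"
    proof -
      have "v + w \<in> ball v \<rho> \<inter> expandable" using expandable_add[OF vW w(1)] w(2) by (simp add: dist_norm)
      then show ?thesis using \<rho>(2) T(3) by blast
    qed
    have 2: "v \<in> closure (controlled (real k))" using T by blast
    obtain s where s: "\<And>n. s n \<in> controlled (real k)" "s \<longlonglongrightarrow> v + w" using 1 closure_sequential by blast
    obtain t where t: "\<And>n. t n \<in> controlled (real k)" "t \<longlonglongrightarrow> v" using 2 closure_sequential by blast
    have "(\<lambda>n. s n - t n) \<longlonglongrightarrow> v + w - v" by (intro tendsto_diff s t)
    moreover have "s n - t n \<in> controlled (2 * real k)" for n
    proof -
      obtain a b where "expands x a (s n)" "pbound (real k) a" "expands x b (t n)" "pbound (real k) b"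
        using s(1)[of n] t(1)[of n] by (auto simp: controlled_def)
      then have "expands x (\<lambda>n. a n - b n) (s n - t n)" "pbound (2 * real k) (\<lambda>n. a n - b n)"
        using expands_diff pbound_diff[of "real k" a "real k" b] by auto
      then show ?thesis unfolding controlled_def by blast
    qed
    ultimately show ?thesis unfolding closure_sequential by (intro exI[of _ "\<lambda>n. s n - t n"]) simp
  qed
  then show ?thesis using \<rho>(1) by - (rule exI[of _ "2 * real k"], rule exI[of _ \<rho>], simp)
qed

text \<open>Scaling w into the dense ball, approximating there within \<rho>/4 and scaling back
  leaves a relative error of one half.\<close>

lemma approximate_expansion:
  "\<exists>C\<ge>0. \<forall>w\<in>expandable. \<exists>u a. expands x a u \<and> pbound (C * norm w) a \<and> norm (w - u) \<le> norm w / 2"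
proof -
  obtain k \<rho> where \<rho>: "\<rho> > 0" and k: "k \<ge> 0" and d: "\<And>w. w \<in> expandable \<Longrightarrow> norm w < \<rho> \<Longrightarrow> w \<in> closure (controlled k)"
    using exists_dense_ball by blast
  define C where "C = 2 * k / \<rho>"
  have "\<exists>u a. expands x a u \<and> pbound (C * norm w) a \<and> norm (w - u) \<le> norm w / 2" if w: "w \<in> expandable" for w
  proof (cases "w = 0")
    case True
    then show ?thesis by - (rule exI[of _ 0], rule exI[of _ "\<lambda>n. 0"], simp add: expands_def pbound_def)
  next
    case False
    define s where "s = \<rho> / (2 * norm w)"
    have s: "s > 0" using False \<rho> by (simp add: s_def)
    have "norm (cs (of_real s) w) = s * norm w" using s by simp
    also have "\<dots> < \<rho>" using False \<rho> by (simp add: s_def)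
    finally have "norm (cs (of_real s) w) < \<rho>" .
    then have "cs (of_real s) w \<in> closure (controlled k)" using d expandable_cs w by blast
    then obtain u where u: "u \<in> controlled k" "dist u (cs (of_real s) w) < \<rho> / 4"
      unfolding closure_approachable using \<rho> by (meson divide_pos_pos zero_less_numeral)
    then obtain a where a: "expands x a u" "pbound k a" by (auto simp: controlled_def)
    have "w - cs (of_real (1/s)) u = cs (of_real (1/s)) (cs (of_real s) w - u)"
      using s by (simp add: cs_distrib)
    then have "norm (w - cs (of_real (1/s)) u) = 1/s * norm (cs (of_real s) w - u)"
      using s by (simp add: norm_divide)
    also have "\<dots> \<le> 1/s * (\<rho> / 4)" using u(2) s by (intro mult_left_mono) (auto simp: dist_norm norm_minus_commute)
    also have "\<dots> = norm w / 2" using \<rho> by (simp add: s_def)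
    finally have 1: "norm (w - cs (of_real (1/s)) u) \<le> norm w / 2" .
    have "cmod (of_real (1/s)) * k = C * norm w" using s \<rho> by (simp add: s_def C_def norm_divide)
    then have "pbound (C * norm w) (\<lambda>n. of_real (1/s) * a n)" using pbound_cs[OF a(2), of "of_real (1/s)"] by simp
    then show ?thesis using expands_cs[OF a(1)] 1 by blast
  qed
  moreover have "C \<ge> 0" using k \<rho> by (simp add: C_def)
  ultimately show ?thesis by blast
qed

text \<open>Iterated halving writes w as a series of vectors u i whose expansions have partial sums
  bounded by the geometric q i. Adding these expansions gives one of w with partial sums at most 2 C
  norm w; uniqueness identifies it with the given one.\<close>

lemma basis_constant: "\<exists>K. \<forall>w a. expands x a w \<longrightarrow> pbound (K * norm w) a"
proof -
  obtain C where C: "C \<ge> 0" and ap: "\<And>w. w \<in> expandable \<Longrightarrow> \<exists>u a. expands x a u \<and> pbound (C * norm w) a \<and> norm (w - u) \<le> norm w / 2"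
    using approximate_expansion by blast
  have "pbound (2 * C * norm w) a" if wa: "expands x a w" for w a
  proof -
    have wW: "w \<in> expandable" by (rule expands_imp_expandable[OF wa])
    obtain U e where Ue: "\<And>w. w \<in> expandable \<Longrightarrow> expands x (e w) (U w) \<and> pbound (C * norm w) (e w) \<and> norm (w - U w) \<le> norm w / 2"
      using ap by metis
    define w' where "w' i = ((\<lambda>w. w - U w) ^^ i) w" for i
    have w'0: "w' 0 = w" and w'S: "w' (Suc i) = w' i - U (w' i)" for i by (simp_all add: w'_def)
    have w'expandable: "w' i \<in> expandable" for i
    proof (induction i)
      case (Suc i)
      have "U (w' i) \<in> expandable" using Ue[OF Suc] expands_imp_expandable by blast
      then show ?case unfolding w'S by (rule expandable_diff[OF Suc])
    qed (simp add: w'0 wW)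
    have w'n: "norm (w' i) \<le> norm w * (1/2) ^ i" for i
    proof (induction i)
      case (Suc i)
      have "norm (w' (Suc i)) \<le> norm (w' i) / 2" unfolding w'S using Ue[OF w'expandable] by blast
      then show ?case using Suc by simp
    qed (simp add: w'0)
    define b where "b i = e (w' i)" for i
    define u where "u i = U (w' i)" for i
    define q where "q i = C * norm w * (1/2) ^ i" for i
    have bu: "expands x (b i) (u i)" for i using Ue[OF w'expandable] by (simp add: b_def u_def)
    have pb: "norm (\<Sum>n<N. cs (b i n) (x n)) \<le> q i" for i N
    proof -
      have "pbound (C * norm (w' i)) (b i)" using Ue[OF w'expandable] by (simp add: b_def)
      then have "norm (\<Sum>n<N. cs (b i n) (x n)) \<le> C * norm (w' i)" by (simp add: pbound_def)
      also have "\<dots> \<le> C * (norm w * (1/2) ^ i)" by (intro mult_left_mono w'n C)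
      finally show ?thesis by (simp add: q_def)
    qed
    have q: "summable q" "suminf q = 2 * C * norm w"
    proof -
      have "q sums (C * norm w * (1 / (1 - 1/2)))" unfolding q_def by (intro sums_mult geometric_sums) simp
      then show "summable q" "suminf q = 2 * C * norm w" by (simp_all add: sums_iff)
    qed
    have un: "norm (u i) \<le> q i" for i
    proof (rule LIMSEQ_le_const2)
      show "(\<lambda>N. norm (\<Sum>n<N. cs (b i n) (x n))) \<longlonglongrightarrow> norm (u i)"
        using bu[of i] by (intro tendsto_norm) (simp add: expands_def sums_def)
    qed (use pb in auto)
    have bn: "cmod (b i n) \<le> 2 * q i" for i n
    proof -
      have "cs (b i n) (x n) = (\<Sum>l<Suc n. cs (b i l) (x l)) - (\<Sum>l<n. cs (b i l) (x l))" by simp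
      then have "norm (cs (b i n) (x n)) \<le> norm (\<Sum>l<Suc n. cs (b i l) (x l)) + norm (\<Sum>l<n. cs (b i l) (x l))"
        by (metis norm_triangle_ineq4)
      then show ?thesis using pb[where i = i and N = "Suc n"] pb[where i = i and N = n] nx[of n] by simp
    qed
    have sb: "summable (\<lambda>i. b i n)" for n
      by (rule summable_comparison_test'[OF summable_mult[OF q(1), of 2], of 0]) (use bn in auto)
    have sq: "summable (\<lambda>i. \<Sum>n<N. cs (b i n) (x n))" for N
      by (rule summable_comparison_test'[OF q(1), of 0]) (use pb in auto)
    have su: "summable (\<lambda>i. norm (u i))" by (rule summable_comparison_test'[OF q(1), of 0]) (use un in auto)
    define a' where "a' n = (\<Sum>i. b i n)" for n
    have pa: "(\<Sum>n<N. cs (a' n) (x n)) = (\<Sum>i. \<Sum>n<N. cs (b i n) (x n))" for N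
    proof -
      have c: "cs (a' n) (x n) = (\<Sum>i. cs (b i n) (x n))" "summable (\<lambda>i. cs (b i n) (x n))" for n
        unfolding a'_def using bounded_linear.suminf[OF bounded_linear_cs(2) sb]
          bounded_linear.summable[OF bounded_linear_cs(2) sb] by auto
      show ?thesis unfolding c(1) by (rule suminf_sum[symmetric]) (rule c(2))
    qed
    have usum: "(\<Sum>i. u i) = w"
    proof -
      have "(\<Sum>i<I. u i) = w - w' I" for I by (induction I) (simp_all add: w'0 w'S u_def)
      moreover have "(\<lambda>I. w' I) \<longlonglongrightarrow> 0"
      proof (rule Lim_null_comparison)
        show "(\<lambda>i. norm w * (1/2) ^ i) \<longlonglongrightarrow> 0" by (intro tendsto_mult_right_zero LIMSEQ_power_zero) simp
      qed (use w'n in auto)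
      then have "(\<lambda>I. w - w' I) \<longlonglongrightarrow> w - 0" by (intro tendsto_diff tendsto_const)
      ultimately have "u sums w" by (simp add: sums_def)
      then show ?thesis by (simp add: sums_iff)
    qed
    have dn: "norm ((\<Sum>n<N. cs (b i n) (x n)) - u i) \<le> 2 * q i" for i N
      using norm_triangle_ineq4[of "\<Sum>n<N. cs (b i n) (x n)" "u i"] pb[where i = i and N = N] un[of i] by simp
    \<comment> \<open>Tannery's theorem exchanges the limit in N with the sum over i, dominated by 2
      q i; thus the summed expansion converges to w.\<close>
    have "(\<lambda>N. \<Sum>i. norm ((\<Sum>n<N. cs (b i n) (x n)) - u i)) \<longlonglongrightarrow> (\<Sum>i. 0)"
    proof (rule conjunct2[OF conjunct2[OF tannerys_theorem]])
      fix i
      have "(\<lambda>N. (\<Sum>n<N. cs (b i n) (x n)) - u i) \<longlonglongrightarrow> u i - u i"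
        using bu[of i] by (intro tendsto_diff tendsto_const) (simp add: expands_def sums_def)
      then show "(\<lambda>N. norm ((\<Sum>n<N. cs (b i n) (x n)) - u i)) \<longlonglongrightarrow> 0" using tendsto_norm_zero by auto
    next
      show "\<forall>\<^sub>F (i, N) in at_top \<times>\<^sub>F sequentially. norm (norm ((\<Sum>n<N. cs (b i n) (x n)) - u i)) \<le> 2 * q i"
        using dn by (intro always_eventually) auto
      show "summable (\<lambda>i. 2 * q i)" by (rule summable_mult[OF q(1)])
    qed simp
    then have lim0: "(\<lambda>N. \<Sum>i. norm ((\<Sum>n<N. cs (b i n) (x n)) - u i)) \<longlonglongrightarrow> 0" by simp
    have "norm ((\<Sum>n<N. cs (a' n) (x n)) - w) \<le> (\<Sum>i. norm ((\<Sum>n<N. cs (b i n) (x n)) - u i))" for N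
    proof -
      have "(\<Sum>n<N. cs (a' n) (x n)) - w = (\<Sum>i. (\<Sum>n<N. cs (b i n) (x n)) - u i)"
        unfolding pa usum[symmetric] by (rule suminf_diff[OF sq summable_norm_cancel[OF su]])
      moreover have "summable (\<lambda>i. norm ((\<Sum>n<N. cs (b i n) (x n)) - u i))"
        by (rule summable_comparison_test'[OF summable_mult[OF q(1), of 2], of 0])
          (use dn in simp)
      ultimately show ?thesis by (simp add: summable_norm)
    qed
    then have "(\<lambda>N. (\<Sum>n<N. cs (a' n) (x n)) - w) \<longlonglongrightarrow> 0"
      by (intro Lim_null_comparison[OF _ lim0] always_eventually) auto
    then have "expands x a' w" by (simp add: expands_def sums_def LIM_zero_iff)
    then have aa: "a = a'" using expands_unique wa by blast
    have "norm (\<Sum>n<N. cs (a n) (x n)) \<le> 2 * C * norm w" for N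
    proof -
      have sn: "summable (\<lambda>i. norm (\<Sum>n<N. cs (b i n) (x n)))"
        by (rule summable_comparison_test'[OF q(1), of 0]) (use pb in auto)
      have "norm (\<Sum>n<N. cs (a n) (x n)) \<le> (\<Sum>i. norm (\<Sum>n<N. cs (b i n) (x n)))"
        unfolding aa pa by (rule summable_norm[OF sn])
      also have "\<dots> \<le> suminf q" by (rule suminf_le[OF pb sn q(1)])
      finally show ?thesis by (simp add: q(2))
    qed
    then show ?thesis by (simp add: pbound_def)
  qed
  then show ?thesis by blast
qed

text \<open>Subtracting a vector of the span beyond m does not change the first m coefficients of X,
  so the m-th partial sum is bounded by the basis constant times a distance that can be made
  arbitrarily small.\<close>

lemma tails_zero:
  assumes X: "\<And>m e. e > 0 \<Longrightarrow> \<exists>u\<in>lspan x {m..}. norm (X - u) < e"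
  shows "X = 0"
proof -
  obtain K where K: "\<And>w a. expands x a w \<Longrightarrow> pbound (K * norm w) a" using basis_constant by blast
  have "X \<in> closure (lspan x UNIV)"
    unfolding closure_approachable
  proof (intro allI impI)
    fix e :: real assume "e > 0"
    then obtain u where "u \<in> lspan x {0..}" "norm (X - u) < e" using X by blast
    then show "\<exists>y\<in>lspan x UNIV. dist y X < e"
      by (intro bexI[of _ u]) (auto simp: dist_norm norm_minus_commute lspan_def)
  qed
  then obtain a where a: "expands x a X" using expandable_expands by (auto simp: expandable_def)
  have "(\<Sum>n<m. cs (a n) (x n)) = 0" for m
  proof -
    have "norm (\<Sum>n<m. cs (a n) (x n)) \<le> 0 + e" if e: "e > 0" for e
    proof -
      have "e / (\<bar>K\<bar> + 1) > 0" using e by simp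
      then obtain u where u: "u \<in> lspan x {m..}" "norm (X - u) < e / (\<bar>K\<bar> + 1)" using X by blast
      then obtain F c where F: "finite F" "F \<subseteq> {m..}" "u = (\<Sum>n\<in>F. cs (c n) (x n))" by (auto simp: lspan_def)
      have "expands x (\<lambda>n. a n - (if n \<in> F then c n else 0)) (X - u)"
        unfolding F(3) by (intro expands_diff a expands_finite F)
      from K[OF this] have "norm (\<Sum>n<m. cs (a n - (if n \<in> F then c n else 0)) (x n)) \<le> K * norm (X - u)"
        by (simp add: pbound_def)
      moreover have "(\<Sum>n<m. cs (a n - (if n \<in> F then c n else 0)) (x n)) = (\<Sum>n<m. cs (a n) (x n))"
        using F(2) by (intro sum.cong refl) auto
      moreover have "K * norm (X - u) \<le> (\<bar>K\<bar> + 1) * (e / (\<bar>K\<bar> + 1))"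
        using u(2) e by (intro mult_mono) auto
      moreover have "(\<bar>K\<bar> + 1) * (e / (\<bar>K\<bar> + 1)) = e" by (simp add: add_nonneg_eq_0_iff)
      ultimately show ?thesis by simp
    qed
    then have "norm (\<Sum>n<m. cs (a n) (x n)) \<le> 0" by (rule field_le_epsilon)
    then show ?thesis by simp
  qed
  then have "(\<lambda>n. cs (a n) (x n)) sums 0" by (simp add: sums_def)
  then show ?thesis using a sums_unique2 unfolding expands_def by blast
qed

end

section \<open>The weights of \<open>l2\<close> and of the Orlicz spaces\<close>

lemma sum_unit_seq:
  "(\<Sum>n<N. seq_smul (a n) (unit_seq n)) = (\<lambda>k. if k < N then a k else 0)"
proof
  fix k
  have "(\<Sum>n<N. seq_smul (a n) (unit_seq n)) k = (\<Sum>n<N. if n = k then a k else 0)"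
    unfolding sum_seq_apply by (intro sum.cong refl) (auto simp: seq_smul_def unit_seq_def)
  then show "(\<Sum>n<N. seq_smul (a n) (unit_seq n)) k = (if k < N then a k else 0)" by simp
qed

lemma summable_finite_change:
  fixes f g :: "nat \<Rightarrow> real"
  assumes "summable f" "\<And>k. k \<ge> N \<Longrightarrow> g k = f k"
  shows "summable g"
proof -
  have "eventually (\<lambda>k. g k = f k) sequentially"
    using assms(2) eventually_sequentially by blast
  then show ?thesis using summable_cong assms(1) by blast
qed

text \<open>Norm convergence forces coordinatewise convergence, so the only candidate for the sum is
  \<open>a\<close> itself; conversely the error after N terms is the tail of the series of
  squares.\<close>

lemma l2_unit_seq_iff: "(\<exists>w. series_sums l2 a unit_seq w) \<longleftrightarrow> summable (\<lambda>n. weight 0 (a n))"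
proof
  assume "summable (\<lambda>n. weight 0 (a n))"
  then have a: "summable (\<lambda>n. (cmod (a n))\<^sup>2)" by (simp add: weight_def)
  define T where "T N = (\<Sum>k. (cmod (((\<Sum>n<N. seq_smul (a n) (unit_seq n)) - a) k))\<^sup>2)" for N
  have T: "T N = (\<Sum>n. (cmod (a n))\<^sup>2) - (\<Sum>n<N. (cmod (a n))\<^sup>2)" for N
  proof -
    have "(\<lambda>k. (cmod (a k))\<^sup>2 - (if k \<in> {..<N} then (cmod (a k))\<^sup>2 else 0)) sums
        ((\<Sum>n. (cmod (a n))\<^sup>2) - (\<Sum>n<N. (cmod (a n))\<^sup>2))"
      by (intro sums_diff summable_sums a sums_If_finite_set) simp
    moreover have "(\<lambda>k. (cmod (a k))\<^sup>2 - (if k \<in> {..<N} then (cmod (a k))\<^sup>2 else 0)) =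
        (\<lambda>k. (cmod (((\<Sum>n<N. seq_smul (a n) (unit_seq n)) - a) k))\<^sup>2)"
      by (auto simp: sum_unit_seq)
    ultimately show ?thesis unfolding T_def by (simp add: sums_iff)
  qed
  have "(\<lambda>N. (\<Sum>n. (cmod (a n))\<^sup>2) - (\<Sum>n<N. (cmod (a n))\<^sup>2)) \<longlonglongrightarrow> (\<Sum>n. (cmod (a n))\<^sup>2) - (\<Sum>n. (cmod (a n))\<^sup>2)"
    by (intro tendsto_diff tendsto_const summable_LIMSEQ a)
  then have "T \<longlonglongrightarrow> 0" by (simp flip: T)
  from tendsto_real_sqrt[OF this] have "(\<lambda>N. sqrt (T N)) \<longlonglongrightarrow> 0" by simp
  then have "series_sums l2 a unit_seq a"
    using a unfolding series_sums_def T_def by (simp add: l2_def)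
  then show "\<exists>w. series_sums l2 a unit_seq w" by (rule exI[of _ a])
next
  assume "\<exists>w. series_sums l2 a unit_seq w"
  then obtain w where w: "summable (\<lambda>n. (cmod (w n))\<^sup>2)"
    and lim: "(\<lambda>N. sqrt (\<Sum>k. (cmod (((\<Sum>n<N. seq_smul (a n) (unit_seq n)) - w) k))\<^sup>2)) \<longlonglongrightarrow> 0"
    unfolding series_sums_def by (auto simp: l2_def)
  have "a k = w k" for k
  proof -
    have "cmod (a k - w k) \<le> sqrt (\<Sum>l. (cmod (((\<Sum>n<N. seq_smul (a n) (unit_seq n)) - w) l))\<^sup>2)" if "N > k" for N
    proof -
      have "summable (\<lambda>l. (cmod (((\<Sum>n<N. seq_smul (a n) (unit_seq n)) - w) l))\<^sup>2)"
        by (rule summable_finite_change[OF w, of N]) (simp add: sum_unit_seq)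
      from sum_le_suminf[OF this, of "{k}"] have
        "(cmod (a k - w k))\<^sup>2 \<le> (\<Sum>l. (cmod (((\<Sum>n<N. seq_smul (a n) (unit_seq n)) - w) l))\<^sup>2)"
        using that by (simp add: sum_unit_seq)
      then show ?thesis by (rule real_le_rsqrt)
    qed
    then have "cmod (a k - w k) \<le> 0"
      by (intro LIMSEQ_le_const[OF lim]) (auto intro!: exI[of _ "Suc k"])
    then show ?thesis by simp
  qed
  then have "a = w" by auto
  then show "summable (\<lambda>n. weight 0 (a n))" using w by (simp add: weight_def)
qed

context
  fixes f :: "real \<Rightarrow> real" and j :: nat
  assumes f: "orlicz_function f" and near: "\<forall>\<^sub>F t in at_right 0. f t = t\<^sup>2 * (ln t) ^ (2 * j)"
    and j: "j \<le> 2"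
begin

lemma orlicz_basics:
  shows "f 0 = 0" "\<And>s t. 0 \<le> s \<Longrightarrow> s \<le> t \<Longrightarrow> f s \<le> f t" "\<And>t. 0 \<le> t \<Longrightarrow> 0 \<le> f t"
    "\<And>t c. 0 \<le> t \<Longrightarrow> 0 \<le> c \<Longrightarrow> c \<le> 1 \<Longrightarrow> f (c * t) \<le> c * f t"
proof -
  show 0: "f 0 = 0" using f by (simp add: orlicz_function_def)
  show m: "f s \<le> f t" if "0 \<le> s" "s \<le> t" for s t
    using f that by (auto simp: orlicz_function_def mono_on_def)
  show "0 \<le> f t" if "0 \<le> t" for t using m[of 0 t] that 0 by simp
  show "f (c * t) \<le> c * f t" if "0 \<le> t" "0 \<le> c" "c \<le> 1" for t c
  proof -
    have "convex_on {0..} f" using f by (simp add: orlicz_function_def)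
    from convex_onD[OF this, of c 0 t] that show ?thesis by (simp add: 0)
  qed
qed

lemma orlicz_near_zero:
  obtains t0 where "0 < t0" "t0 < 1"
    "\<And>t. 0 < t \<Longrightarrow> t < t0 \<Longrightarrow> 0 < f t"
    "\<And>a. cmod a < t0 \<Longrightarrow> f (cmod a) \<le> weight j a"
    "\<And>a. cmod a < t0 \<Longrightarrow> weight j a \<le> 16 * f (cmod a)"
proof -
  obtain b where b: "b > 0" "\<And>t. 0 < t \<Longrightarrow> t < b \<Longrightarrow> f t = t\<^sup>2 * (ln t) ^ (2 * j)"
    using near unfolding eventually_at_right_field by auto
  \<comment> \<open>Below exp (-1) the modulus of ln t is at least 1, so 1 + |ln t| is at most twice
    |ln t|; with 2 j at most 4 this gives the factor 16.\<close>
  define t0 where "t0 = min b (exp (-1))"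
  have t0: "t0 > 0" "t0 < 1" "t0 \<le> b" "t0 \<le> exp (-1)" using b(1) by (auto simp: t0_def min_less_iff_disj)
  have ln1: "ln t < -1" if "0 < t" "t < t0" for t
    using that t0(4) by (metis exp_less_cancel_iff exp_ln less_le_trans)
  have ft: "f t = t\<^sup>2 * \<bar>ln t\<bar> ^ (2 * j)" if "0 < t" "t < t0" for t
    using b(2)[OF that(1)] that t0(3) by (simp add: power_mult)
  have c: "f (cmod a) \<le> weight j a \<and> weight j a \<le> 16 * f (cmod a)" if "cmod a < t0" for a
  proof (cases "a = 0")
    case False
    define t where "t = cmod a"
    have t: "0 < t" "t < t0" using False that by (auto simp: t_def)
    have l: "\<bar>ln t\<bar> \<ge> 1" using ln1[OF t] by simp
    have 1: "\<bar>ln t\<bar> ^ (2 * j) \<le> (1 + \<bar>ln t\<bar>) ^ (2 * j)" by (intro power_mono) auto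
    have "(1 + \<bar>ln t\<bar>) ^ (2 * j) \<le> (2 * \<bar>ln t\<bar>) ^ (2 * j)" using l by (intro power_mono) auto
    also have "\<dots> = 2 ^ (2 * j) * \<bar>ln t\<bar> ^ (2 * j)" by (rule power_mult_distrib)
    also have "\<dots> \<le> 2 ^ 4 * \<bar>ln t\<bar> ^ (2 * j)" using j by (intro mult_right_mono power_increasing) auto
    finally have 2: "(1 + \<bar>ln t\<bar>) ^ (2 * j) \<le> 16 * \<bar>ln t\<bar> ^ (2 * j)" by simp
    have "t\<^sup>2 * \<bar>ln t\<bar> ^ (2 * j) \<le> t\<^sup>2 * (1 + \<bar>ln t\<bar>) ^ (2 * j)"
      "t\<^sup>2 * (1 + \<bar>ln t\<bar>) ^ (2 * j) \<le> t\<^sup>2 * (16 * \<bar>ln t\<bar> ^ (2 * j))"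
      by (intro mult_left_mono 1 2; simp)+
    then show ?thesis using ft[OF t] by (simp add: weight_def flip: t_def)
  qed (use orlicz_basics(1) in simp)
  have p: "0 < f t" if t: "0 < t" "t < t0" for t
    unfolding ft[OF t] using ln1[OF t] t by (intro mult_pos_pos zero_less_power) auto
  show thesis using that t0(1,2) p c by blast
qed

text \<open>Summable terms tend to 0, so only the behaviour near 0 counts. Positivity of f at t0/2
  together with monotonicity excludes small values of f at arguments that are not small.\<close>

lemma summable_orlicz_iff: "summable (\<lambda>n. f (cmod (a n))) \<longleftrightarrow> summable (\<lambda>n. weight j (a n))"
proof -
  obtain t0 where t0: "0 < t0" "t0 < 1" "\<And>t. 0 < t \<Longrightarrow> t < t0 \<Longrightarrow> 0 < f t"
    "\<And>a. cmod a < t0 \<Longrightarrow> f (cmod a) \<le> weight j a"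
    "\<And>a. cmod a < t0 \<Longrightarrow> weight j a \<le> 16 * f (cmod a)" using orlicz_near_zero by metis
  show ?thesis
  proof
    assume s: "summable (\<lambda>n. f (cmod (a n)))"
    have "f (t0 / 2) > 0" using t0 by simp
    then have "eventually (\<lambda>n. f (cmod (a n)) < f (t0 / 2)) sequentially"
      by (rule order_tendstoD(2)[OF summable_LIMSEQ_zero[OF s]])
    then have "eventually (\<lambda>n. norm (weight j (a n)) \<le> 16 * f (cmod (a n))) sequentially"
    proof eventually_elim
      case (elim n)
      have "cmod (a n) < t0 / 2"
        using elim orlicz_basics(2)[of "t0 / 2" "cmod (a n)"] t0(1) by (meson half_gt_zero less_imp_le not_le)
      then show ?case using t0(1,5) by simp
    qed
    then show "summable (\<lambda>n. weight j (a n))"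
      by (rule summable_comparison_test_ev) (rule summable_mult[OF s])
  next
    assume s: "summable (\<lambda>n. weight j (a n))"
    have "eventually (\<lambda>n. weight j (a n) < t0\<^sup>2) sequentially"
      by (rule order_tendstoD(2)[OF summable_LIMSEQ_zero[OF s]]) (use t0 in simp)
    then have "eventually (\<lambda>n. norm (f (cmod (a n))) \<le> weight j (a n)) sequentially"
    proof eventually_elim
      case (elim n)
      have "(cmod (a n))\<^sup>2 < t0\<^sup>2" using elim weight_ge_square[of "a n" j] by linarith
      then have "cmod (a n) < t0" using t0(1) by (simp add: power2_less_imp_less)
      then show ?case using t0(4) orlicz_basics(3)[of "cmod (a n)"] by simp
    qed
    then show "summable (\<lambda>n. f (cmod (a n)))" by (rule summable_comparison_test_ev) (rule s)
  qed
qed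

lemma summable_orlicz_scale:
  assumes "summable (\<lambda>n. weight j (a n))" "\<rho> > 0"
  shows "summable (\<lambda>n. f (cmod (a n) / \<rho>))"
proof -
  have "summable (\<lambda>n. f (cmod (of_real (1/\<rho>) * a n)))"
    unfolding summable_orlicz_iff by (rule summable_weight_scale[OF assms(1)])
  then show ?thesis using assms(2) by (simp add: norm_mult norm_divide)
qed

text \<open>Weights tolerate scaling, so f (|a n| / \<rho>) is summable for every \<rho>; taking
  \<rho> = e/2, tails of modular at most 1 have Luxemburg norm at most e/2. Conversely each
  coordinate is bounded by a multiple of the norm, which identifies the limit with
  \<open>a\<close>.\<close>

lemma orlicz_unit_seq_iff:
  "(\<exists>w. series_sums (orlicz_space f) a unit_seq w) \<longleftrightarrow> summable (\<lambda>n. weight j (a n))"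
proof
  define R where "R z = {\<rho>. \<rho> > 0 \<and> summable (\<lambda>n. f (cmod (z n) / \<rho>)) \<and> (\<Sum>n. f (cmod (z n) / \<rho>)) \<le> 1}" for z :: cseq
  have nrm: "nrm (orlicz_space f) z = Inf (R z)" for z by (simp add: orlicz_space_def R_def)
  {
    assume a: "summable (\<lambda>n. weight j (a n))"
    have "(\<lambda>N. Inf (R ((\<Sum>n<N. seq_smul (a n) (unit_seq n)) - a))) \<longlonglongrightarrow> 0"
      unfolding LIMSEQ_iff
    proof (intro allI impI)
      fix e :: real assume e: "e > 0"
      define \<rho> where "\<rho> = e / 2"
      have \<rho>: "\<rho> > 0" using e by (simp add: \<rho>_def)
      have sf: "summable (\<lambda>n. f (cmod (a n) / \<rho>))" by (rule summable_orlicz_scale[OF a \<rho>])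
      have "(\<lambda>N. \<Sum>n<N. f (cmod (a n) / \<rho>)) \<longlonglongrightarrow> (\<Sum>n. f (cmod (a n) / \<rho>))" by (rule summable_LIMSEQ[OF sf])
      then have "eventually (\<lambda>N. (\<Sum>n<N. f (cmod (a n) / \<rho>)) > (\<Sum>n. f (cmod (a n) / \<rho>)) - 1) sequentially"
        by (rule order_tendstoD) simp
      then obtain N0 where N0: "\<And>N. N \<ge> N0 \<Longrightarrow> (\<Sum>n<N. f (cmod (a n) / \<rho>)) > (\<Sum>n. f (cmod (a n) / \<rho>)) - 1"
        unfolding eventually_sequentially by blast
      have "norm (Inf (R ((\<Sum>n<N. seq_smul (a n) (unit_seq n)) - a)) - 0) < e" if N: "N \<ge> N0" for N
      proof -
        define z where "z = (\<Sum>n<N. seq_smul (a n) (unit_seq n)) - a"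
        have "(\<lambda>k. f (cmod (a k) / \<rho>) - (if k \<in> {..<N} then f (cmod (a k) / \<rho>) else 0)) sums
            ((\<Sum>n. f (cmod (a n) / \<rho>)) - (\<Sum>n<N. f (cmod (a n) / \<rho>)))"
          by (intro sums_diff summable_sums sf sums_If_finite_set) simp
        moreover have "(\<lambda>k. f (cmod (a k) / \<rho>) - (if k \<in> {..<N} then f (cmod (a k) / \<rho>) else 0)) =
            (\<lambda>k. f (cmod (z k) / \<rho>))"
          using orlicz_basics(1) by (auto simp: sum_unit_seq z_def)
        ultimately have "\<rho> \<in> R z" using \<rho> N0[OF N] by (simp add: R_def sums_iff)
        moreover have "bdd_below (R z)" by (rule bdd_belowI[of _ 0]) (auto simp: R_def)
        ultimately have "Inf (R z) \<le> \<rho>" by (rule cInf_lower)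
        moreover have "0 \<le> Inf (R z)" using \<open>\<rho> \<in> R z\<close> by (intro cInf_greatest) (auto simp: R_def)
        ultimately show ?thesis using e by (simp add: \<rho>_def flip: z_def)
      qed
      then show "\<exists>N0. \<forall>N\<ge>N0. norm (Inf (R ((\<Sum>n<N. seq_smul (a n) (unit_seq n)) - a)) - 0) < e" by blast
    qed
    moreover have "summable (\<lambda>n. f (cmod (a n) / 1))" by (rule summable_orlicz_scale[OF a]) simp
    then have "\<exists>\<rho>>0. summable (\<lambda>n. f (cmod (a n) / \<rho>))" by (intro exI[of _ 1]) simp
    ultimately have "series_sums (orlicz_space f) a unit_seq a"
      unfolding series_sums_def nrm by (simp add: orlicz_space_def)
    then show "\<exists>w. series_sums (orlicz_space f) a unit_seq w" by (rule exI[of _ a])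
  }
  assume "\<exists>w. series_sums (orlicz_space f) a unit_seq w"
  then obtain w \<rho> where \<rho>: "\<rho> > 0" and sw: "summable (\<lambda>n. f (cmod (w n) / \<rho>))"
    and lim: "(\<lambda>N. Inf (R ((\<Sum>n<N. seq_smul (a n) (unit_seq n)) - w))) \<longlonglongrightarrow> 0"
    unfolding series_sums_def nrm by (auto simp: orlicz_space_def)
  have "\<forall>\<^sub>F t in at_top. f t \<ge> 2" using f by (simp add: orlicz_function_def filterlim_at_top)
  \<comment> \<open>Any threshold value above 1 works: modular at most 1 at radius r forces d / r
    below T, hence \<open>d / T \<le> r\<close>.\<close>
  then obtain T where T: "T > 0" "\<And>t. t \<ge> T \<Longrightarrow> f t \<ge> 2"
    unfolding eventually_at_top_linorder by (metis gt_ex less_le_trans less_imp_le linorder_le_cases order_trans)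
  have "a k = w k" for k
  proof -
    define d where "d = cmod (a k - w k)"
    have "d / T \<le> Inf (R ((\<Sum>n<N. seq_smul (a n) (unit_seq n)) - w))" if N: "N > k" for N
    proof (rule cInf_greatest)
      define z where "z = (\<Sum>n<N. seq_smul (a n) (unit_seq n)) - w"
      have zk: "cmod (z k) = d" using N by (simp add: z_def sum_unit_seq d_def)
      have sz: "summable (\<lambda>n. f (cmod (z n) / \<rho>))"
        by (rule summable_finite_change[OF sw, of N]) (simp add: z_def sum_unit_seq)
      \<comment> \<open>Convexity with f 0 = 0 lets division by S bring the modular down to 1, so
        the set of admissible radii is nonempty and its infimum is meaningful.\<close>
      define S where "S = max 1 (\<Sum>n. f (cmod (z n) / \<rho>))"
      have S: "S \<ge> 1" by (simp add: S_def)
      have le: "f (cmod (z n) / (\<rho> * S)) \<le> 1 / S * f (cmod (z n) / \<rho>)" for n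
        using orlicz_basics(4)[of "cmod (z n) / \<rho>" "1 / S"] \<rho> S by (simp add: mult.commute)
      have s2: "summable (\<lambda>n. f (cmod (z n) / (\<rho> * S)))"
        by (rule summable_comparison_test'[OF summable_mult[OF sz, of "1 / S"], of 0])
          (use le orlicz_basics(3) \<rho> S in simp)
      have "(\<Sum>n. f (cmod (z n) / (\<rho> * S))) \<le> (\<Sum>n. 1 / S * f (cmod (z n) / \<rho>))"
        by (rule suminf_le[OF le s2 summable_mult[OF sz]])
      also have "\<dots> = 1 / S * (\<Sum>n. f (cmod (z n) / \<rho>))" by (rule suminf_mult[OF sz])
      also have "\<dots> \<le> 1" using S by (simp add: S_def divide_le_eq)
      finally have "\<rho> * S \<in> R z" using s2 \<rho> S by (simp add: R_def)
      then show "R ((\<Sum>n<N. seq_smul (a n) (unit_seq n)) - w) \<noteq> {}" unfolding z_def by blast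
      fix r assume "r \<in> R ((\<Sum>n<N. seq_smul (a n) (unit_seq n)) - w)"
      then have r: "r > 0" "summable (\<lambda>n. f (cmod (z n) / r))" "(\<Sum>n. f (cmod (z n) / r)) \<le> 1"
        by (auto simp: R_def z_def)
      have "f (d / r) \<le> (\<Sum>n. f (cmod (z n) / r))"
        using sum_le_suminf[OF r(2), of "{k}"] orlicz_basics(3) r(1) by (simp add: zk)
      then have "\<not> T \<le> d / r" using T(2)[of "d / r"] r(3) by auto
      then show "d / T \<le> r" using r(1) T(1) by (simp add: field_simps)
    qed
    then have "d / T \<le> 0" by (intro LIMSEQ_le_const[OF lim]) (auto intro!: exI[of _ "Suc k"])
    then have "d \<le> 0" using T(1) by (simp add: divide_le_0_iff)
    then show ?thesis by (simp add: d_def)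
  qed
  then have "a = w" by auto
  with sw have "summable (\<lambda>n. f (cmod (of_real (1/\<rho>) * a n)))" using \<rho> by (simp add: norm_mult norm_divide)
  then have "summable (\<lambda>n. weight j (of_real (1/\<rho>) * a n))" unfolding summable_orlicz_iff .
  then have "summable (\<lambda>n. weight j (of_real \<rho> * (of_real (1/\<rho>) * a n)))" by (rule summable_weight_scale)
  then show "summable (\<lambda>n. weight j (a n))" using \<rho> by simp
qed

end

section \<open>Coordinatewise limits of basic sequences\<close>

lemma series_sums_Z3:
  assumes x: "\<And>n. x n \<in> points Z3"
  shows "series_sums Z3 a x v \<longleftrightarrow> v \<in> points Z3 \<and> expands (\<lambda>n. Abs_zspace (x n)) a (Abs_zspace v)"
proof (cases "v \<in> points Z3")
  case True
  have "Rep_zspace (\<Sum>n\<in>F. cs (a n) (Abs_zspace (x n))) = (\<Sum>n\<in>F. smul Z3 (a n) (x n))" for F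
    by (induction F rule: infinite_finite_induct) (simp_all add: Rep_zero Rep_add Rep_cs Abs_zspace_inverse x)
  then have "nrm Z3 ((\<Sum>n<N. smul Z3 (a n) (x n)) - v) = norm ((\<Sum>n<N. cs (a n) (Abs_zspace (x n))) - Abs_zspace v)" for N
    using Rep_add[of "\<Sum>n<N. cs (a n) (Abs_zspace (x n))" "- Abs_zspace v"]
    by (simp add: norm_zspace_def Rep_uminus Abs_zspace_inverse True)
  then show ?thesis using True
    by (simp add: series_sums_def expands_def sums_def tendsto_norm_zero_iff LIM_zero_iff)
qed (simp add: series_sums_def)

lemma series_sums_Z3_iff_summable:
  assumes x: "\<And>n. x n \<in> points Z3"
  shows "(\<exists>v. series_sums Z3 a x v) \<longleftrightarrow> summable (\<lambda>n. cs (a n) (Abs_zspace (x n)))"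
  unfolding series_sums_Z3[OF x] summable_def expands_def
  by (metis Rep_zspace Rep_zspace_inverse)

lemma basic_sequence_expands:
  assumes b: "basic_sequence Z3 x" and v: "v \<in> closure (lspan (\<lambda>n. Abs_zspace (x n)) UNIV)"
  shows "\<exists>!a. expands (\<lambda>n. Abs_zspace (x n)) a v"
proof -
  have x: "x n \<in> points Z3" for n using b by (auto simp: basic_sequence_def)
  have "Rep_zspace v \<in> closed_span Z3 (range x)"
    unfolding closed_span_def
  proof (intro CollectI conjI allI impI Rep_zspace)
    fix e :: real assume "e > 0"
    then obtain u where u: "u \<in> lspan (\<lambda>n. Abs_zspace (x n)) UNIV" "dist u v < e"
      using v closure_approachable by blast
    then obtain F c where F: "finite F" "u = (\<Sum>n\<in>F. cs (c n) (Abs_zspace (x n)))" by (auto simp: lspan_def)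
    have "Rep_zspace u = (\<Sum>n\<in>F. smul Z3 (c n) (x n))"
      unfolding F(2) by (induction F rule: infinite_finite_induct)
        (simp_all add: Rep_zero Rep_add Rep_cs Abs_zspace_inverse x)
    then have "Rep_zspace u \<in> Z3.span (range x)"
      by (simp add: Z3.span_sum Z3.span_scale Z3.span_base)
    moreover have "nrm Z3 (Rep_zspace v - Rep_zspace u) = norm (v - u)"
      using Rep_add[of v "- u"] by (simp add: norm_zspace_def Rep_uminus)
    ultimately show "\<exists>u\<in>Z3.span (range x). nrm Z3 (Rep_zspace v - u) < e"
      using u(2) by (intro bexI[of _ "Rep_zspace u"]) (simp_all add: dist_norm norm_minus_commute)
  qed
  then have "\<exists>!a. series_sums Z3 a x (Rep_zspace v)" using b by (simp add: basic_sequence_def)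
  then show ?thesis by (simp add: series_sums_Z3[OF x] Rep_zspace Rep_zspace_inverse)
qed

text \<open>The exponent 2 is the one available for arbitrary blocks, since level 0 is no condition.
  Logarithms to the fourth power do not spoil the convergence of the series of 1/n^2.\<close>

lemma harmonic_weight: "summable (\<lambda>n. weight 2 (of_real (1 / real (Suc n))))"
proof -
  have "(\<lambda>n. (1 / real (Suc n))\<^sup>2 * (1 + \<bar>ln (1 / real (Suc n))\<bar>) ^ 4) \<in> O(\<lambda>n. real n powr (-3/2))"
    by real_asymp
  moreover have "summable (\<lambda>n. norm (real n powr (-3/2)))" by (simp add: summable_real_powr_iff)
  ultimately have "summable (\<lambda>n. (1 / real (Suc n))\<^sup>2 * (1 + \<bar>ln (1 / real (Suc n))\<bar>) ^ 4)"
    by (rule summable_comparison_test_bigo[rotated])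
  moreover have "weight 2 (of_real c) = c\<^sup>2 * (1 + \<bar>ln c\<bar>) ^ 4" if "c > 0" for c
    using that by (simp add: weight_def)
  from this[of "1 / real (Suc n)" for n]
  have "weight 2 (of_real (1 / real (Suc n))) = (1 / real (Suc n))\<^sup>2 * (1 + \<bar>ln (1 / real (Suc n))\<bar>) ^ 4" for n
    by simp
  ultimately show ?thesis by presburger
qed

text \<open>With the divergent weights \<open>1/(n+1)\<close> the blocks still sum, so weighted averages of the sequence
  converge to its coordinatewise limit (a Banach-Saks argument).\<close>

lemma coordinatewise_limit_in_tails:
  assumes s: "strict_mono s" and null: "\<And>i k. i \<le> 2 \<Longrightarrow> (\<lambda>n. co (x (s n)) i k) \<longlonglongrightarrow> co X i k"
    and nx: "\<And>n. norm (x n) = 1" and e: "e > 0"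
  shows "\<exists>u\<in>lspan x {m..}. norm (X - u) < e"
proof -
  define D where "D n = x (s n) - X" for n
  have nD: "norm (D n) \<le> 1 + norm X" for n
    unfolding D_def using norm_triangle_ineq4[of "x (s n)" X] nx by simp
  have "(\<lambda>n. co (D n) i k) \<longlonglongrightarrow> 0" if "i \<le> 2" for i k
    unfolding D_def co_diff using null[OF that] by (rule LIM_zero)
  from exists_block_approximation[OF this, of "\<lambda>n. (1/2) ^ n"]
  obtain r A B where r: "strict_mono r" and bl: "blocks A B" and
    DB: "\<And>n. norm (D (r n) - B n) \<le> (1/2) ^ n" and nB: "\<And>n. norm (B n) \<le> norm (D (r n))" by auto
  \<comment> \<open>The shift by m puts every index used into the tail beyond m.\<close>
  define t where "t n = s (r (n + m))" for n
  have sh: "strict_mono (\<lambda>n. n + m)" by (rule strict_monoI_Suc) simp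
  have tm: "strict_mono t" using s r sh unfolding t_def strict_mono_def by blast
  have t_ge: "t n \<ge> m" for n
  proof -
    have "n + m \<le> r (n + m)" "r (n + m) \<le> s (r (n + m))" using seq_suble r s by auto
    then show ?thesis by (simp add: t_def)
  qed
  define a where "a n = complex_of_real (1 / real (Suc n))" for n
  have na: "cmod (a n) \<le> 1" for n unfolding a_def norm_of_real by simp
  have "summable (\<lambda>n. cs (a n) (B (n + m)))"
  proof (rule block_upper_summable[OF blocks_subseq[OF bl sh], of 0])
    show "norm (B (n + m)) \<le> 1 + norm X" for n using nB nD order_trans by blast
    show "summable (\<lambda>n. weight (2 - 0) (a n))" using harmonic_weight by (simp add: a_def)
  qed (auto simp: level_def)
  moreover have "summable (\<lambda>n. cs (a n) (D (r (n + m)) - B (n + m)))"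
  proof (rule summable_comparison_test'[of "\<lambda>n. (1/2) ^ n" 0])
    fix n
    have "cmod (a n) * norm (D (r (n + m)) - B (n + m)) \<le> 1 * (1/2) ^ (n + m)"
      using DB[of "n + m"] na[of n] by (intro mult_mono) auto
    also have "\<dots> \<le> (1/2) ^ n" by (simp add: power_add mult_le_cancel_left1 power_le_one)
    finally show "norm (cs (a n) (D (r (n + m)) - B (n + m))) \<le> (1/2) ^ n" by simp
  qed simp
  ultimately have "summable (\<lambda>n. cs (a n) (B (n + m)) + cs (a n) (D (r (n + m)) - B (n + m)))" by (rule summable_add)
  then have "summable (\<lambda>n. cs (a n) (D (r (n + m))))" by (simp flip: cs_distrib)
  from summable_imp_sums_bounded[OF this]
  obtain L where L: "\<And>N. norm (\<Sum>n<N. cs (a n) (D (r (n + m)))) \<le> L" unfolding bounded_iff by blast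
  define H where "H N = (\<Sum>n<N. 1 / real (Suc n))" for N
  have "\<not> summable (\<lambda>n. 1 / real (Suc n))"
    using not_summable_harmonic[where 'a = real] summable_Suc_iff[of "\<lambda>n. inverse (real n)"] by (simp add: inverse_eq_divide)
  then have "\<exists>N. H N > max 1 (L / e)"
    unfolding H_def by (metis divide_nonneg_nonneg linorder_not_le of_nat_0_le_iff summableI_nonneg_bounded zero_le_one)
  then obtain N where N: "H N > 1" "H N > L / e" by auto
  \<comment> \<open>Division by H N makes the weights sum to 1, so X - u is minus the average of the
    differences D. Their weighted sums stay below L while H N exceeds L / e.\<close>
  define u where "u = cs (of_real (1 / H N)) (\<Sum>n<N. cs (a n) (x (t n)))"
  have "X - u = - cs (of_real (1 / H N)) (\<Sum>n<N. cs (a n) (D (r (n + m))))"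
  proof -
    have "(\<Sum>n<N. cs (a n) (D (r (n + m)))) = (\<Sum>n<N. cs (a n) (x (t n))) - cs (\<Sum>n<N. a n) X"
      unfolding D_def t_def cs_distrib sum_subtractf
      by (intro arg_cong2[of _ _ _ _ "(-)"] refl zspace_eqI) (simp add: sum_distrib_right)
    moreover have "(\<Sum>n<N. a n) = of_real (H N)" by (simp add: a_def H_def)
    ultimately show ?thesis using N(1) by (simp add: u_def cs_distrib)
  qed
  then have "norm (X - u) = 1 / H N * norm (\<Sum>n<N. cs (a n) (D (r (n + m))))" using N(1) by (simp add: norm_divide)
  also have "\<dots> \<le> 1 / H N * L" using N(1) L by (intro mult_left_mono) auto
  also have "\<dots> < e" using N e by (simp add: field_simps)
  finally have "norm (X - u) < e" .
  moreover have "u \<in> lspan x {m..}"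
  proof -
    define c where "c l = of_real (1 / H N) * a (inv_into UNIV t l)" for l
    have inj: "inj t" using tm by (simp add: strict_mono_imp_inj_on)
    have "u = (\<Sum>n<N. cs (c (t n)) (x (t n)))"
      unfolding u_def cs_sum c_def using inj by (simp add: inv_f_f)
    also have "\<dots> = (\<Sum>l\<in>t ` {..<N}. cs (c l) (x l))"
      by (rule sum.reindex_cong[symmetric, of t]) (use inj in \<open>auto intro: inj_on_subset\<close>)
    finally show ?thesis unfolding lspan_def using t_ge by blast
  qed
  ultimately show ?thesis by blast
qed

lemma normalized_basic_subsequence:
  fixes x :: "nat \<Rightarrow> zspace"
  assumes nx: "\<And>n. norm (x n) = 1"
    and basic: "\<And>v. v \<in> closure (lspan x UNIV) \<Longrightarrow> \<exists>!a. expands x a v"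
  shows "\<exists>r j. strict_mono r \<and> j \<le> 2 \<and> governed j (\<lambda>n. x (r n))"
proof -
  have "norm (co (x n) (fst p) (snd p)) \<le> 4" for n p
    using co_bound[of "x n"] nx[of n] by simp
  note bound = this
  obtain s :: "nat \<Rightarrow> nat" where s: "strict_mono s"
    and lim: "\<And>p. \<exists>l. (\<lambda>n. co (x (s n)) (fst p) (snd p)) \<longlonglongrightarrow> l"
  proof (rule function_convergent_subsequence[of UNIV "\<lambda>n p. co (x n) (fst p) (snd p)" 4])
    show "countable (UNIV :: (nat \<times> nat) set)" by simp
    show "norm (co (x n) (fst p) (snd p)) \<le> 4" for n p by (rule bound)
    fix k :: "nat \<Rightarrow> nat"
    assume "strict_mono k" "\<And>p. p \<in> UNIV \<Longrightarrow> \<exists>l. (\<lambda>n. co (x (k n)) (fst p) (snd p)) \<longlonglongrightarrow> l"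
    then show thesis using that by simp
  qed
  have "\<forall>i k. \<exists>l. (\<lambda>n. co (x (s n)) i k) \<longlonglongrightarrow> l" using lim[of "(i, k)" for i k] by simp
  then obtain c where c: "\<And>i k. (\<lambda>n. co (x (s n)) i k) \<longlonglongrightarrow> c i k" by metis
  have "\<exists>V. (\<forall>i\<le>2. \<forall>k. co V i k = (if k < p then c i k else 0))" for p
    using exists_finite_coefficients[OF finite_lessThan[of p], of c] unfolding lessThan_iff by blast
  then obtain V where V: "\<And>p i k. i \<le> 2 \<Longrightarrow> co (V p) i k = (if k < p then c i k else 0)" by metis
  \<comment> \<open>Each finite section of the limiting array is the norm limit of contractive
    projections of unit vectors; this uniform bound is what bounded completeness needs.\<close>
  have "norm (V p) \<le> 1" for p
  proof -
    have "(\<lambda>n. pr {..<p} (x (s n)) - V p) \<longlonglongrightarrow> 0"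
    proof (rule tendsto_zero_finite_support[of "{..<p}"])
      fix i k :: nat assume i: "i \<le> 2"
      show "(\<lambda>n. co (pr {..<p} (x (s n)) - V p) i k) \<longlonglongrightarrow> 0"
        using LIM_zero[OF c[of i k]] by (cases "k < p") (simp_all add: i V)
    qed (auto simp: V)
    then have "(\<lambda>n. norm (pr {..<p} (x (s n)))) \<longlonglongrightarrow> norm (V p)"
      by (intro tendsto_norm) (simp add: LIM_zero_iff)
    moreover have "norm (pr {..<p} (x (s n))) \<le> 1" for n using norm_pr_le[of "{..<p}" "x (s n)"] nx by simp
    ultimately show ?thesis by (intro LIMSEQ_le_const2) auto
  qed
  from boundedly_complete[OF V this] obtain X where X: "\<And>i k. i \<le> 2 \<Longrightarrow> co X i k = c i k" by blast
  have "X = 0"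
    by (rule tails_zero[OF nx basic])
      (auto intro: coordinatewise_limit_in_tails[OF s _ nx] simp: X c)
  then have "(\<lambda>n. co (x (s n)) i k) \<longlonglongrightarrow> 0" if "i \<le> 2" for i k
    using c[of i k] X[OF that, of k] by simp
  \<comment> \<open>The factor 1/4 keeps the approximating blocks away from 0, and the geometric
    factor makes the errors summable.\<close>
  from exists_block_approximation[OF this, of "\<lambda>n. 1/4 * (1/2) ^ n"]
  obtain r A B where r: "strict_mono r" and bl: "blocks A B" and
    xB: "\<And>n. norm (x (s (r n)) - B n) \<le> 1/4 * (1/2) ^ n" and nB: "\<And>n. norm (B n) \<le> 1" using nx by auto
  have half: "1/2 \<le> norm (B n)" for n
  proof -
    have "1/4 * (1/2) ^ n \<le> (1/4 :: real)" by (simp add: power_le_one)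
    then have "norm (x (s (r n)) - B n) \<le> 1/4" using xB[of n] by linarith
    then show ?thesis using norm_triangle_ineq2[of "x (s (r n))" "B n"] nx[of "s (r n)"] by linarith
  qed
  obtain r' j where r': "strict_mono r'" "j \<le> 2" "governed j (\<lambda>n. B (r' n))"
    using block_subsequence[OF bl _ _ nB _ half, of 0] by (auto simp: level_def)
  have "governed j (\<lambda>n. x (s (r (r' n))))"
  proof (rule governed_perturb[OF r'(3)])
    have "norm (x (s (r (r' n))) - B (r' n)) \<le> 1/4 * (1/2) ^ n" for n
    proof -
      have "(1/2 :: real) ^ r' n \<le> (1/2) ^ n" using seq_suble[OF r'(1)] by (intro power_decreasing) auto
      then show ?thesis using xB[of "r' n"] by linarith
    qed
    moreover have "summable (\<lambda>n. 1/4 * (1/2 :: real) ^ n)" by (intro summable_mult summable_geometric) simp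
    ultimately show "summable (\<lambda>n. norm (x (s (r (r' n))) - B (r' n)))"
      by (rule_tac summable_comparison_test'[where g = "\<lambda>n. 1/4 * (1/2) ^ n" and N = 0]) simp_all
    show "(1::real) > 0" "1 \<le> norm (x (s (r (r' n))))" for n using nx by simp_all
  qed
  moreover have "strict_mono (\<lambda>n. s (r (r' n)))" using s r r'(1) unfolding strict_mono_def by blast
  ultimately show ?thesis using r'(2) by blast
qed

lemma governed_iff:
  assumes "governed j X"
  shows "summable (\<lambda>n. cs (a n) (X n)) \<longleftrightarrow> summable (\<lambda>n. weight j (a n))"
proof
  assume "summable (\<lambda>n. cs (a n) (X n))"
  from summable_imp_sums_bounded[OF this]
  obtain K where "\<And>N. norm (\<Sum>n<N. cs (a n) (X n)) \<le> K" unfolding bounded_iff by blast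
  then show "summable (\<lambda>n. weight j (a n))" using assms unfolding governed_def by blast
qed (use assms in \<open>simp add: governed_def\<close>)

theorem theorem7p9:
  fixes f g :: "real \<Rightarrow> real"
    and x :: "nat \<Rightarrow> cseq \<times> cseq \<times> cseq"
  assumes "orlicz_function f" and "\<forall>\<^sub>F t in at_right 0. f t = t\<^sup>2 * (ln t)\<^sup>2"
    and "orlicz_function g" and "\<forall>\<^sub>F t in at_right 0. g t = t\<^sup>2 * (ln t) ^ 4"
    and "basic_sequence Z3 x" and "normalized Z3 x"
  shows "\<exists>r::nat \<Rightarrow> nat. strict_mono r \<and>
           (equivalent_sequences Z3 (x \<circ> r) l2 unit_seq \<or>
            equivalent_sequences Z3 (x \<circ> r) (orlicz_space f) unit_seq \<or>
            equivalent_sequences Z3 (x \<circ> r) (orlicz_space g) unit_seq)"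
proof -
  have pts: "x n \<in> points Z3" for n using assms(5) by (auto simp: basic_sequence_def)
  have "norm (Abs_zspace (x n)) = 1" for n
    using assms(6) by (simp add: norm_zspace_def Abs_zspace_inverse pts normalized_def)
  from normalized_basic_subsequence[OF this basic_sequence_expands[OF assms(5)]]
  obtain r j where r: "strict_mono r" "j \<le> 2" "governed j (\<lambda>n. Abs_zspace (x (r n)))" by blast
  have Z: "(\<exists>v. series_sums Z3 a (x \<circ> r) v) \<longleftrightarrow> summable (\<lambda>n. weight j (a n))" for a
    using series_sums_Z3_iff_summable[of "x \<circ> r" a] governed_iff[OF r(3), of a] pts by simp
  have f: "(\<exists>w. series_sums (orlicz_space f) a unit_seq w) \<longleftrightarrow> summable (\<lambda>n. weight 1 (a n))" for a
    using assms(1,2) by (intro orlicz_unit_seq_iff) auto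
  have g: "(\<exists>w. series_sums (orlicz_space g) a unit_seq w) \<longleftrightarrow> summable (\<lambda>n. weight 2 (a n))" for a
    using assms(3,4) by (intro orlicz_unit_seq_iff) auto
  consider "j = 0" | "j = 1" | "j = 2" using r(2) by linarith
  then show ?thesis
    using r(1) Z f g l2_unit_seq_iff by cases (auto simp: equivalent_sequences_def)
qed

end
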